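(* Let $M$ be a smooth manifold of even dimension $n$ and let $g$ be a locally conformally flat metric of signature $(p,q)$ on $M$. Let $v^{(n)}$ be the coefficient of order $n$ in the expansion of the volume form of a Poincaré metric for $g$, and let $\mathrm{Pff}$ be the Pfaffian of $g$. Then $$v^{(n)}=(-2)^{-n/2}\,\bigl((n/2)!\bigr)^{-1}\,\mathrm{Pff}.$$
   Context: Poincaré metric. For $n=\dim M$ even, a Poincaré metric for $(M,g)$ is a metric $g_+$ on $M\times(0,a)$, for some $a>0$, of the form $g_+=x^{-2}(dx^2+g_x)$, where $x$ is the coordinate on $(0,a)$ and $g_x$ is a 1-parameter family of metrics on $M$, smooth up to $x=0$, with $g_0=g$, such that $\mathrm{Ric}(g_+)+n g_+=O(x^{n-2})$ and $\mathrm{tr}_{g_+}(\mathrm{Ric}(g_+)+n g_+)=O(x^{n+2})$ as $x\to0$ (components in coordinates smooth on $M\times[0,a)$, locally uniformly on $M$). It is known that such a $g_+$ always exists; $g_x$ is unique up to addition of a term $x^n h_x$, with $h_x$ a smooth 1-parameter family of symmetric 2-tensors on $M$ satisfying $\mathrm{tr}_g(h_0)=0$; and the Taylor expansion of $g_x$ at $x=0$ is even through order $n$. Volume coefficients. The functions $v^{(2k)}\in C^\infty(M)$, $0\le k\le n/2$, are defined by $v^{(0)}=1$ and $$\left(\frac{\det g_x}{\det g}\right)^{1/2}=1+v^{(2)}x^2+v^{(4)}x^4+\cdots+v^{(n)}x^n+\cdots\quad (x\to0).$$ They do not depend on the choice of Poincaré metric. Pfaffian. For $n$ even, $\mathrm{Pff}$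 is defined by $$2^n\,(n/2)!\,\mathrm{Pff}=(-1)^q\,\mu^{i_1\ldots i_n}\mu^{j_1\ldots j_n}R_{i_1i_2j_1j_2}\cdots R_{i_{n-1}i_nj_{n-1}j_n},$$ where $\mu_{i_1\ldots i_n}=\sqrt{|\det g|}\,\epsilon_{i_1\ldots i_n}$ is the volume form, $\epsilon_{i_1\ldots i_n}$ is the sign of the permutation, indices are raised with $g$, and $R_{ijkl}$ is the Riemann curvature tensor of $g$ with sign convention such that a metric of constant sectional curvature $1$ has $R_{ijkl}=g_{ik}g_{jl}-g_{il}g_{jk}$. *)

theory Defs
  imports "HOL-Analysis.Analysis" "HOL-Library.Landau_Symbols"
begin

section \<open>Smooth functions\<close>

text \<open>\<open>Ck_on k S f\<close> is meaningful for open \<open>S\<close> only; \<open>smooth_on\<close> then covers arbitrary sets, in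
  particular half-open cylinders \<open>U \<times> [0,a)\<close>, by local smooth extension.\<close>

primrec Ck_on ::
  "nat \<Rightarrow> 'a::real_normed_vector set \<Rightarrow> ('a \<Rightarrow> 'b::real_normed_vector) \<Rightarrow> bool" where
  "Ck_on 0 S f \<longleftrightarrow> continuous_on S f"
| "Ck_on (Suc k) S f \<longleftrightarrow>
     (\<forall>x\<in>S. f differentiable (at x)) \<and> (\<forall>v. Ck_on k S (\<lambda>x. frechet_derivative f (at x) v))"

definition smooth_on ::
  "'a::real_normed_vector set \<Rightarrow> ('a \<Rightarrow> 'b::real_normed_vector) \<Rightarrow> bool" where
  "smooth_on S f \<longleftrightarrow>
     (\<forall>x\<in>S. \<exists>V F. open V \<and> x \<in> V \<and> (\<forall>k. Ck_on k V F) \<and> (\<forall>y\<in>S \<inter> V. F y = f y))"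


section \<open>Smooth manifolds\<close>

type_synonym ('a, 'n) chart = "'a set \<times> ('a \<Rightarrow> real ^ 'n)"

definition in_coords :: "('a, 'n) chart \<Rightarrow> ('a \<Rightarrow> 'b) \<Rightarrow> real ^ 'n \<Rightarrow> 'b" where
  "in_coords c F y = F (inv_into (fst c) (snd c) y)"

text \<open>The atlas need not be maximal; all notions below are invariant under compatible changes
  of coordinates.\<close>

definition smooth_manifold :: "'a topology \<Rightarrow> ('a, 'n::finite) chart set \<Rightarrow> bool" where
  "smooth_manifold M A \<longleftrightarrow>
     Hausdorff_space M \<and>
     second_countable M \<and>
     (\<Union>c\<in>A. fst c) = topspace M \<and>
     (\<forall>(U, \<phi>)\<in>A. openin M U \<and> open (\<phi> ` U) \<and>
        homeomorphic_map (subtopology M U) (top_of_set (\<phi> ` U)) \<phi>) \<and>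
     (\<forall>(U, \<phi>)\<in>A. \<forall>(V, \<psi>)\<in>A. smooth_on (\<phi> ` (U \<inter> V)) (in_coords (U, \<phi>) \<psi>))"

definition smooth_fun_on ::
  "('a, 'n::finite) chart set \<Rightarrow> 'a set \<Rightarrow> ('a \<Rightarrow> real) \<Rightarrow> bool" where
  "smooth_fun_on A W f \<longleftrightarrow> (\<forall>(U, \<phi>)\<in>A. smooth_on (\<phi> ` (U \<inter> W)) (in_coords (U, \<phi>) f))"


section \<open>Pseudo-Riemannian metrics\<close>

text \<open>A 2-tensor field is given by its component matrix in each chart at each point; only the
  values at points of the chart domain matter.\<close>

type_synonym ('a, 'n) tensor2 = "('a, 'n) chart \<Rightarrow> 'a \<Rightarrow> real ^ 'n ^ 'n"

definition is_tensor2 :: "('a, 'n::finite) chart set \<Rightarrow> ('a, 'n) tensor2 \<Rightarrow> bool" where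
  "is_tensor2 A g \<longleftrightarrow>
     (\<forall>c\<in>A. \<forall>d\<in>A. \<forall>m\<in>fst c \<inter> fst d.
        let J = jacobian (in_coords c (snd d)) (at (snd c m))
        in g c m = transpose J ** g d m ** J)"

definition pseudo_metric :: "('a, 'n::finite) chart set \<Rightarrow> ('a, 'n) tensor2 \<Rightarrow> bool" where
  "pseudo_metric A g \<longleftrightarrow>
     is_tensor2 A g \<and>
     (\<forall>c\<in>A. smooth_on (snd c ` fst c) (in_coords c (g c))) \<and>
     (\<forall>c\<in>A. \<forall>m\<in>fst c. transpose (g c m) = g c m \<and> invertible (g c m))"

definition form_signature :: "nat \<Rightarrow> nat \<Rightarrow> real ^ 'n::finite ^ 'n \<Rightarrow> bool" where
  "form_signature p q G \<longleftrightarrow>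
     (\<exists>(B :: real ^ 'n ^ 'n) \<sigma>. invertible B \<and> transpose B ** G ** B = (\<chi> i j. if i = j then \<sigma> i else 0) \<and>
        (\<forall>i. \<sigma> i = 1 \<or> \<sigma> i = -1) \<and> card {i. \<sigma> i = 1} = p \<and> card {i. \<sigma> i = -1} = q)"

definition metric_signature ::
  "('a, 'n::finite) chart set \<Rightarrow> ('a, 'n) tensor2 \<Rightarrow> nat \<Rightarrow> nat \<Rightarrow> bool" where
  "metric_signature A g p q \<longleftrightarrow> (\<forall>c\<in>A. \<forall>m\<in>fst c. form_signature p q (g c m))"


section \<open>Curvature of a metric given in coordinates\<close>

definition partial :: "'m \<Rightarrow> (real ^ 'm::finite \<Rightarrow> real) \<Rightarrow> real ^ 'm \<Rightarrow> real" where
  "partial i f y = frechet_derivative f (at y) (axis i 1)"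

definition christoffel ::
  "(real ^ 'm \<Rightarrow> real ^ 'm ^ 'm) \<Rightarrow> 'm::finite \<Rightarrow> 'm \<Rightarrow> 'm \<Rightarrow> real ^ 'm \<Rightarrow> real" where
  "christoffel G k i j y =
     1 / 2 * (\<Sum>l\<in>UNIV. matrix_inv (G y) $ k $ l *
       (partial i (\<lambda>z. G z $ j $ l) y + partial j (\<lambda>z. G z $ i $ l) y
        - partial l (\<lambda>z. G z $ i $ j) y))"

text \<open>\<open>riemann_up G i j k l\<close> is $R^i{}_{jkl}$, with the sign for which constant sectional
  curvature 1 means $R_{ijkl} = g_{ik} g_{jl} - g_{il} g_{jk}$; accordingly the Ricci tensor
  $R_{jl} = R^i{}_{jil}$ of the unit sphere is positive.\<close>

definition riemann_up ::
  "(real ^ 'm \<Rightarrow> real ^ 'm ^ 'm) \<Rightarrow> 'm::finite \<Rightarrow> 'm \<Rightarrow> 'm \<Rightarrow> 'm \<Rightarrow> real ^ 'm \<Rightarrow> real" where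
  "riemann_up G i j k l y =
     partial k (christoffel G i j l) y - partial l (christoffel G i j k) y
     + (\<Sum>r\<in>UNIV. christoffel G i k r y * christoffel G r j l y
                 - christoffel G i l r y * christoffel G r j k y)"

definition riemann ::
  "(real ^ 'm \<Rightarrow> real ^ 'm ^ 'm) \<Rightarrow> 'm::finite \<Rightarrow> 'm \<Rightarrow> 'm \<Rightarrow> 'm \<Rightarrow> real ^ 'm \<Rightarrow> real" where
  "riemann G i j k l y = (\<Sum>r\<in>UNIV. G y $ i $ r * riemann_up G r j k l y)"

definition ricci :: "(real ^ 'm \<Rightarrow> real ^ 'm ^ 'm) \<Rightarrow> real ^ 'm::finite \<Rightarrow> real ^ 'm ^ 'm" where
  "ricci G y = (\<chi> j l. \<Sum>i\<in>UNIV. riemann_up G i j i l y)"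

definition metric_trace :: "real ^ 'm ^ 'm \<Rightarrow> real ^ 'm ^ 'm \<Rightarrow> real" where
  "metric_trace G E = (\<Sum>i\<in>UNIV. \<Sum>j\<in>UNIV. matrix_inv G $ i $ j * E $ i $ j)"


section \<open>Local conformal flatness\<close>

definition flat_on ::
  "('a, 'n::finite) chart set \<Rightarrow> 'a set \<Rightarrow> ('a, 'n) tensor2 \<Rightarrow> bool" where
  "flat_on A W g \<longleftrightarrow>
     (\<forall>c\<in>A. \<forall>m\<in>fst c \<inter> W. \<forall>i j k l. riemann (in_coords c (g c)) i j k l (snd c m) = 0)"

definition locally_conformally_flat ::
  "'a topology \<Rightarrow> ('a, 'n::finite) chart set \<Rightarrow> ('a, 'n) tensor2 \<Rightarrow> bool" where
  "locally_conformally_flat M A g \<longleftrightarrow>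
     (\<forall>m\<in>topspace M. \<exists>W \<omega>. openin M W \<and> m \<in> W \<and> smooth_fun_on A W \<omega> \<and>
        flat_on A W (\<lambda>c x. exp (2 * \<omega> x) *\<^sub>R g c x))"


section \<open>Poincare metrics\<close>

text \<open>Coordinates on \<open>M \<times> (0,a)\<close> induced by a chart of \<open>M\<close>: index \<open>None\<close> is the coordinate on
  \<open>(0,a)\<close>, and \<open>Some i\<close> is the \<open>i\<close>-th coordinate on \<open>M\<close>.\<close>

definition cyl_point :: "real ^ 'n \<Rightarrow> real \<Rightarrow> real ^ 'n::finite option" where
  "cyl_point y x = (\<chi> I. case I of None \<Rightarrow> x | Some i \<Rightarrow> y $ i)"

text \<open>The components of \<open>g\<^sub>+ = x\<^sup>-\<^sup>2 (dx\<^sup>2 + h\<^sub>x)\<close>.\<close>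

definition gplus ::
  "(real \<Rightarrow> ('a, 'n) tensor2) \<Rightarrow> ('a, 'n::finite) chart
     \<Rightarrow> real ^ 'n option \<Rightarrow> real ^ 'n option ^ 'n option" where
  "gplus h c z =
     (let x = z $ None; y = (\<chi> i. z $ Some i) in
      \<chi> I J. 1 / x\<^sup>2 *
        (case (I, J) of
           (None, None) \<Rightarrow> 1
         | (Some i, Some j) \<Rightarrow> in_coords c (h x c) y $ i $ j
         | _ \<Rightarrow> 0))"

definition einstein_defect ::
  "(real \<Rightarrow> ('a, 'n) tensor2) \<Rightarrow> ('a, 'n::finite) chart
     \<Rightarrow> real ^ 'n option \<Rightarrow> real ^ 'n option ^ 'n option" where
  "einstein_defect h c z = ricci (gplus h c) z + real CARD('n) *\<^sub>R gplus h c z"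

text \<open>\<open>h\<close> is the family \<open>g\<^sub>x\<close>, \<open>0 \<le> x < a\<close>, which determines \<open>g\<^sub>+\<close>. In dimension \<open>n\<close> even the
  natural number subtraction \<open>n - 2\<close> does not truncate.\<close>

definition poincare_metric ::
  "('a, 'n::finite) chart set \<Rightarrow> ('a, 'n) tensor2 \<Rightarrow> real
     \<Rightarrow> (real \<Rightarrow> ('a, 'n) tensor2) \<Rightarrow> bool" where
  "poincare_metric A g a h \<longleftrightarrow>
     0 < a \<and>
     (\<forall>x\<in>{0..<a}. pseudo_metric A (h x)) \<and>
     (\<forall>c\<in>A. smooth_on ((snd c ` fst c) \<times> {0..<a}) (\<lambda>(y, x). in_coords c (h x c) y)) \<and>
     (\<forall>c\<in>A. \<forall>m\<in>fst c. h 0 c m = g c m) \<and>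
     (\<forall>c\<in>A. \<forall>K. compact K \<and> K \<subseteq> snd c ` fst c \<longrightarrow>
        (\<exists>C. \<forall>\<^sub>F x in at_right 0. \<forall>y\<in>K. \<forall>I J.
           \<bar>einstein_defect h c (cyl_point y x) $ I $ J\<bar> \<le> C * x ^ (CARD('n) - 2)) \<and>
        (\<exists>C. \<forall>\<^sub>F x in at_right 0. \<forall>y\<in>K.
           \<bar>metric_trace (gplus h c (cyl_point y x)) (einstein_defect h c (cyl_point y x))\<bar>
             \<le> C * x ^ (CARD('n) + 2)))"


section \<open>Volume coefficients\<close>

text \<open>\<open>v k\<close> stands for $v^{(k)}$, \<open>k\<close> even. The quotient of determinants does not depend on the
  chart \<open>c\<close> around \<open>m\<close>.\<close>

definition volume_expansion ::
  "('a, 'n) tensor2 \<Rightarrow> (real \<Rightarrow> ('a, 'n) tensor2) \<Rightarrow> ('a, 'n::finite) chart \<Rightarrow> 'a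
     \<Rightarrow> (nat \<Rightarrow> real) \<Rightarrow> bool" where
  "volume_expansion g h c m v \<longleftrightarrow>
     v 0 = 1 \<and>
     (\<lambda>x. sqrt (det (h x c m) / det (g c m)) - (\<Sum>k\<le>CARD('n) div 2. v (2 * k) * x ^ (2 * k)))
       \<in> o[at_right 0](\<lambda>x. x ^ CARD('n))"

definition volume_coeff ::
  "('a, 'n) tensor2 \<Rightarrow> (real \<Rightarrow> ('a, 'n) tensor2) \<Rightarrow> ('a, 'n::finite) chart \<Rightarrow> nat \<Rightarrow> 'a
     \<Rightarrow> real" where
  "volume_coeff g h c k m = (SOME v. volume_expansion g h c m v) k"


section \<open>The Pfaffian\<close>

text \<open>The sign of a multi-index requires a numbering of the coordinates. A different numbering
  only changes the sign of $\mu$, which occurs twice in the Pfaffian.\<close>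

definition index_enum :: "nat \<Rightarrow> 'n::finite" where
  "index_enum = (SOME e. bij_betw e {..<CARD('n)} UNIV)"

definition multi_indices :: "(nat \<Rightarrow> 'n::finite) set" where
  "multi_indices = {..<CARD('n)} \<rightarrow>\<^sub>E UNIV"

definition levi_civita :: "(nat \<Rightarrow> 'n::finite) \<Rightarrow> real" where
  "levi_civita s =
     (if bij_betw s {..<CARD('n)} UNIV
      then of_int (sign (\<lambda>r. if r < CARD('n)
                             then inv_into {..<CARD('n)} index_enum (s r) else r))
      else 0)"

definition vol_form :: "real ^ 'n ^ 'n \<Rightarrow> (nat \<Rightarrow> 'n::finite) \<Rightarrow> real" where
  "vol_form G s = sqrt \<bar>det G\<bar> * levi_civita s"

definition vol_form_up :: "real ^ 'n ^ 'n \<Rightarrow> (nat \<Rightarrow> 'n::finite) \<Rightarrow> real" where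
  "vol_form_up G s =
     (\<Sum>t\<in>multi_indices. (\<Prod>r<CARD('n). matrix_inv G $ s r $ t r) * vol_form G t)"

definition pfaffian ::
  "nat \<Rightarrow> ('a, 'n) tensor2 \<Rightarrow> ('a, 'n::finite) chart \<Rightarrow> 'a \<Rightarrow> real" where
  "pfaffian q g c m =
     (-1) ^ q / (2 ^ CARD('n) * fact (CARD('n) div 2)) *
     (\<Sum>s\<in>multi_indices. \<Sum>t\<in>multi_indices.
        vol_form_up (g c m) s * vol_form_up (g c m) t *
        (\<Prod>r<CARD('n) div 2.
           riemann (in_coords c (g c)) (s (2 * r)) (s (2 * r + 1)) (t (2 * r)) (t (2 * r + 1))
             (snd c m)))"

end

theory Submission imports Defs begin

text \<open>
  Conformal flatness of \<open>g\<close> gives, near every point, a symmetric tensor \<open>P\<close> (an endomorphism after raising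
  an index) that satisfies the Codazzi equation and determines the curvature:
  $R_{ijkl} = P_{ik} g_{jl} - P_{il} g_{jk} - P_{jk} g_{il} + P_{jl} g_{ik}$ (\<open>conformally_flat\<close>). For such a metric
  the Poincare metric is explicit: the family \<open>g(1 - x\<^sup>2P/2)\<^sup>2\<close> solves the Einstein equation exactly
  (\<open>model_einstein\<close>). The reason is that \<open>A = 1 - x\<^sup>2P/2\<close> satisfies the Codazzi equation as well, so that
  \<open>A\<close>, as a change of frame, carries the Levi-Civita connection of \<open>g\<close> to that of \<open>g A\<^sup>2\<close>
  (\<open>levi_civita_gauge\<close>), and the curvature of the new metric is conjugate to that of \<open>g\<close>.

  An arbitrary Poincare metric agrees with this model to order \<open>n\<close>, and its trace agrees to
  order \<open>n + 1\<close>, because the indicial equation has no root below \<open>n\<close> and, at \<open>n\<close>, only trace-free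
  tensors in its kernel (\<open>expansion_unique\<close>). Hence the volume density is \<open>det(1 - x\<^sup>2P/2)\<close> up to
  \<open>o(x\<^sup>n)\<close> (\<open>local_expansion\<close>), and \<open>v\<^sup>(\<^sup>n\<^sup>)\<close> is \<open>(-1/2)\<close> to the power \<open>n/2\<close> times the middle coefficient of
  \<open>det(1 + tP)\<close>. The Pfaffian is the same coefficient up to a factorial: antisymmetrising, each
  curvature factor can be replaced by $4 P_{ik} g_{jl}$, which turns the Pfaffian into the
  polarised determinant with half of its arguments equal to \<open>gP\<close> and half equal to \<open>g\<close>
  (\<open>pfaffian_pencil\<close>).

  The calculations take place in a commutative ring with commuting derivations, which is later
  instantiated with the germs of smooth functions at a boundary point of \<open>M \<times> [0,a)\<close>, extended
  across the boundary. Multiplied by \<open>4x\<close>, the Einstein equation has no denominators in this ring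
  (\<open>cone_einstein\<close>), and \<open>O(x\<^sup>k)\<close> means that the normal derivatives of order less than \<open>k\<close> vanish
  on the boundary.
\<close>

section \<open>Smooth functions on open sets\<close>

lemma Ck_on_cong:
  assumes "open V" "\<And>x. x \<in> V \<Longrightarrow> f x = g x"
  shows "Ck_on k V f \<longleftrightarrow> Ck_on k V g"
  using assms(2)
proof (induction k arbitrary: f g)
  case 0
  then show ?case by (simp cong: continuous_on_cong)
next
  case (Suc k)
  have diff: "f differentiable at x \<longleftrightarrow> g differentiable at x" if "x \<in> V" for x
    using Suc.prems assms(1) that
    by (metis differentiable_def has_derivative_transform_within_open)
  have fd: "frechet_derivative f (at x) = frechet_derivative g (at x)"
    if "x \<in> V" "f differentiable at x" for x
    using frechet_derivative_transform_within_open[OF that(2) assms(1) that(1)] Suc.prems by blast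
  have "Ck_on k V (\<lambda>x. frechet_derivative f (at x) v) \<longleftrightarrow> Ck_on k V (\<lambda>x. frechet_derivative g (at x) v)"
    if "\<forall>x\<in>V. f differentiable at x" for v
    using Suc.IH fd that by (metis (no_types, lifting))
  then show ?case
    using diff by (metis Ck_on.simps(2))
qed

lemma Ck_on_subset: "Ck_on k V f \<Longrightarrow> W \<subseteq> V \<Longrightarrow> Ck_on k W f"
  by (induction k arbitrary: f) (auto intro: continuous_on_subset)

lemma Ck_on_Suc: "Ck_on (Suc k) V f \<Longrightarrow> Ck_on k V f"
proof (induction k arbitrary: f)
  case 0
  then show ?case
    unfolding Ck_on.simps
    by (meson continuous_at_imp_continuous_on differentiable_imp_continuous_within)
next
  case (Suc k)
  then show ?case by (metis Ck_on.simps(2))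
qed

lemma Ck_on_Suc_I:
  assumes "open V" "\<And>x. x \<in> V \<Longrightarrow> (f has_derivative f' x) (at x)"
    "\<And>v. Ck_on k V (\<lambda>x. f' x v)"
  shows "Ck_on (Suc k) V f"
proof -
  have "Ck_on k V (\<lambda>x. frechet_derivative f (at x) v)" for v
    using assms(3)[of v] Ck_on_cong[OF assms(1), of "\<lambda>x. frechet_derivative f (at x) v" "\<lambda>x. f' x v" k]
      frechet_derivative_at[OF assms(2)] by simp
  then show ?thesis
    using assms(2) by (auto simp: differentiable_def)
qed

lemma Ck_on_SucD':
  "Ck_on (Suc k) V f \<Longrightarrow> Ck_on k V (\<lambda>x. frechet_derivative f (at x) v)"
  by simp

lemma Ck_on_SucD:
  assumes "Ck_on (Suc k) V f" "x \<in> V"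
  shows "(f has_derivative frechet_derivative f (at x)) (at x)"
  using assms by (simp add: frechet_derivative_works)

lemma Ck_on_const: "open V \<Longrightarrow> Ck_on k V (\<lambda>x. c)"
  by (induction k arbitrary: c) auto

lemma Ck_on_add:
  assumes "open V" "Ck_on k V f" "Ck_on k V g"
  shows "Ck_on k V (\<lambda>x. f x + g x)"
  using assms(2,3)
proof (induction k arbitrary: f g)
  case 0
  then show ?case by (simp add: continuous_on_add)
next
  case (Suc k)
  show ?case
    by (rule Ck_on_Suc_I[OF assms(1) has_derivative_add[OF Ck_on_SucD[OF Suc.prems(1)] Ck_on_SucD[OF Suc.prems(2)]]])
      (assumption+, intro Suc.IH Ck_on_SucD' Suc.prems)
qed

lemma Ck_on_linear:
  assumes "bounded_linear L" "open V" "Ck_on k V f"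
  shows "Ck_on k V (\<lambda>x. L (f x))"
  using assms(3)
proof (induction k arbitrary: f)
  case 0
  then show ?case using assms(1) by (simp add: bounded_linear.continuous_on)
next
  case (Suc k)
  show ?case
    by (rule Ck_on_Suc_I[OF assms(2) bounded_linear.has_derivative[OF assms(1) Ck_on_SucD[OF Suc.prems]]])
      (assumption, intro Suc.IH Ck_on_SucD' Suc.prems)
qed

lemma Ck_on_mult:
  fixes f g :: "_ \<Rightarrow> real"
  assumes "open V" "Ck_on k V f" "Ck_on k V g"
  shows "Ck_on k V (\<lambda>x. f x * g x)"
  using assms(2,3)
proof (induction k arbitrary: f g)
  case 0
  then show ?case by (simp add: continuous_on_mult)
next
  case (Suc k)
  have f: "Ck_on k V f" and g: "Ck_on k V g"
    using Suc.prems Ck_on_Suc by blast+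
  show ?case
    by (rule Ck_on_Suc_I[OF assms(1) has_derivative_mult[OF Ck_on_SucD[OF Suc.prems(1)] Ck_on_SucD[OF Suc.prems(2)]]])
      (assumption+, intro Ck_on_add assms(1) Suc.IH Ck_on_SucD' Suc.prems f g)
qed

lemma Ck_on_inverse:
  fixes f :: "_ \<Rightarrow> real"
  assumes "open V" "Ck_on k V f" "\<And>x. x \<in> V \<Longrightarrow> f x \<noteq> 0"
  shows "Ck_on k V (\<lambda>x. inverse (f x))"
  using assms(2)
proof (induction k)
  case 0
  then show ?case using assms(3) by (auto simp: continuous_on_inverse)
next
  case (Suc k)
  have "Ck_on k V (\<lambda>x. inverse (f x))"
    using Suc.IH[OF Ck_on_Suc[OF Suc.prems]] .
  moreover have "Ck_on k V (\<lambda>x. - frechet_derivative f (at x) v)" for v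
    using Ck_on_linear[OF bounded_linear_minus[OF bounded_linear_ident] assms(1) Ck_on_SucD'[OF Suc.prems]] .
  ultimately have *: "Ck_on k V (\<lambda>x. - (inverse (f x) * frechet_derivative f (at x) v * inverse (f x)))" for v
    using Ck_on_mult[OF assms(1) Ck_on_mult[OF assms(1)], of k "\<lambda>x. inverse (f x)" "\<lambda>x. - frechet_derivative f (at x) v" "\<lambda>x. inverse (f x)"]
    by simp
  show ?case
    by (rule Ck_on_Suc_I[OF assms(1) Deriv.has_derivative_inverse[OF assms(3) Ck_on_SucD[OF Suc.prems]]])
      (assumption+, rule *)
qed

lemma Ck_on_exp:
  fixes f :: "_ \<Rightarrow> real"
  assumes "open V" "Ck_on k V f"
  shows "Ck_on k V (\<lambda>x. exp (f x))"
  using assms(2)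
proof (induction k)
  case 0
  then show ?case by (auto simp: continuous_on_exp)
next
  case (Suc k)
  have d: "((\<lambda>x. exp (f x)) has_derivative (\<lambda>v. frechet_derivative f (at x) v * exp (f x))) (at x)"
    if "x \<in> V" for x
    using has_derivative_exp[OF Ck_on_SucD[OF Suc.prems that]] by (simp add: mult.commute)
  have e: "Ck_on k V (\<lambda>x. exp (f x))"
    using Suc.IH[OF Ck_on_Suc[OF Suc.prems]] .
  show ?case
    by (rule Ck_on_Suc_I[OF assms(1) d]) (assumption, intro Ck_on_mult assms(1) e Ck_on_SucD' Suc.prems)
qed

lemma Ck_on_affine:
  assumes "bounded_linear L" "open V" "Ck_on k V f"
  shows "Ck_on k ((\<lambda>x. c + L x) -` V) (\<lambda>x. f (c + L x))"
  using assms(3)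
proof (induction k arbitrary: f)
  case 0
  have "continuous_on ((\<lambda>x. c + L x) -` V) (\<lambda>x. c + L x)"
    by (intro continuous_intros bounded_linear.continuous_on[OF assms(1)])
  from continuous_on_compose2[OF _ this, of V f] 0 show ?case by auto
next
  case (Suc k)
  have op: "open ((\<lambda>x. c + L x) -` V)"
    by (intro open_vimage assms(2) continuous_intros bounded_linear.continuous_on[OF assms(1)])
  have d: "((\<lambda>x. f (c + L x)) has_derivative (\<lambda>v. frechet_derivative f (at (c + L x)) (L v))) (at x)"
    if "x \<in> (\<lambda>x. c + L x) -` V" for x
  proof (rule has_derivative_compose[OF _ Ck_on_SucD[OF Suc.prems]])
    show "((\<lambda>x. c + L x) has_derivative L) (at x)"
      using has_derivative_add[OF has_derivative_const bounded_linear_imp_has_derivative[OF assms(1)]] by simp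
  qed (use that in auto)
  show ?case
    by (rule Ck_on_Suc_I[OF op d]) (assumption, intro Suc.IH Ck_on_SucD' Suc.prems)
qed

definition smooth_near :: "'v::real_normed_vector \<Rightarrow> ('v \<Rightarrow> real) \<Rightarrow> bool" where
  "smooth_near z f \<longleftrightarrow> (\<exists>V. open V \<and> z \<in> V \<and> (\<forall>k. Ck_on k V f))"

lemma smooth_near_transform:
  assumes "smooth_near z f" "\<forall>\<^sub>F x in nhds z. f x = g x"
  shows "smooth_near z g"
proof -
  obtain V where V: "open V" "z \<in> V" "\<And>k. Ck_on k V f"
    using assms(1) unfolding smooth_near_def by blast
  obtain W where W: "open W" "z \<in> W" "\<And>x. x \<in> W \<Longrightarrow> f x = g x"
    using assms(2) unfolding eventually_nhds by blast
  have "Ck_on k (V \<inter> W) g" for k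
  proof (rule Ck_on_cong[THEN iffD1])
    show "Ck_on k (V \<inter> W) f"
      by (rule Ck_on_subset[OF V(3)]) simp
    show "open (V \<inter> W)"
      using V(1) W(1) by (rule open_Int)
    show "f x = g x" if "x \<in> V \<inter> W" for x
      using that by (intro W(3)) simp
  qed
  then show ?thesis
    unfolding smooth_near_def using V(1,2) W(1,2)
    by (intro exI[of _ "V \<inter> W"] conjI allI open_Int IntI)
qed

lemma smooth_near_binary:
  assumes "\<And>V k. open V \<Longrightarrow> Ck_on k V f \<Longrightarrow> Ck_on k V g \<Longrightarrow> Ck_on k V h"
    "smooth_near z f" "smooth_near z g"
  shows "smooth_near z h"
proof -
  obtain V where V: "open V" "z \<in> V" "\<And>k. Ck_on k V f"
    using assms(2) unfolding smooth_near_def by blast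
  obtain W where W: "open W" "z \<in> W" "\<And>k. Ck_on k W g"
    using assms(3) unfolding smooth_near_def by blast
  have "Ck_on k (V \<inter> W) h" for k
    by (rule assms(1)[OF open_Int[OF V(1) W(1)] Ck_on_subset[OF V(3)] Ck_on_subset[OF W(3)]]) simp_all
  then show ?thesis
    unfolding smooth_near_def using V(1,2) W(1,2)
    by (intro exI[of _ "V \<inter> W"] conjI allI open_Int IntI)
qed

lemma smooth_near_const: "smooth_near z (\<lambda>x. c)"
  unfolding smooth_near_def by (intro exI[of _ UNIV]) (auto simp: Ck_on_const)

lemma smooth_near_add: "smooth_near z f \<Longrightarrow> smooth_near z g \<Longrightarrow> smooth_near z (\<lambda>x. f x + g x)"
  by (rule smooth_near_binary[of f g]) (rule Ck_on_add; assumption)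

lemma smooth_near_mult: "smooth_near z f \<Longrightarrow> smooth_near z g \<Longrightarrow> smooth_near z (\<lambda>x. f x * g x)"
  by (rule smooth_near_binary[of f g]) (rule Ck_on_mult; assumption)

lemma smooth_near_uminus: "smooth_near z f \<Longrightarrow> smooth_near z (\<lambda>x. - f x)"
  by (rule smooth_near_binary[of f f])
    (rule Ck_on_linear[OF bounded_linear_minus[OF bounded_linear_ident]]; assumption)

lemma smooth_near_exp: "smooth_near z f \<Longrightarrow> smooth_near z (\<lambda>x. exp (f x))"
  by (rule smooth_near_binary[of f f]) (rule Ck_on_exp; assumption)

lemma smooth_near_inverse:
  assumes "smooth_near z f" "f z \<noteq> 0"
  shows "smooth_near z (\<lambda>x. inverse (f x))"
proof -
  obtain V where V: "open V" "z \<in> V" "\<And>k. Ck_on k V f"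
    using assms(1) unfolding smooth_near_def by blast
  have "continuous_on V f"
    using V(3)[of 0] by simp
  then have op: "open (V \<inter> f -` (- {0}))"
    using V(1) by (intro continuous_open_preimage) auto
  have "Ck_on k (V \<inter> f -` (- {0})) (\<lambda>x. inverse (f x))" for k
    by (intro Ck_on_inverse op Ck_on_subset[OF V(3)]) auto
  then show ?thesis
    unfolding smooth_near_def using V(2) op assms(2)
    by (intro exI[of _ "V \<inter> f -` (- {0})"]) blast
qed

lemma smooth_near_eventually:
  assumes "smooth_near z f"
  shows "\<forall>\<^sub>F x in nhds z. smooth_near x f \<and> f differentiable at x"
proof -
  obtain V where V: "open V" "z \<in> V" "\<And>k. Ck_on k V f"
    using assms unfolding smooth_near_def by blast
  have "smooth_near x f \<and> f differentiable at x" if "x \<in> V" for x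
    using V V(3)[of "Suc 0"] that unfolding smooth_near_def Ck_on.simps(2) by blast
  then show ?thesis
    using V(1,2) unfolding eventually_nhds by blast
qed

lemma smooth_near_differentiable: "smooth_near z f \<Longrightarrow> f differentiable at z"
  using eventually_nhds_x_imp_x[OF smooth_near_eventually] by blast

lemma smooth_near_isCont: "smooth_near z f \<Longrightarrow> isCont f z"
  using smooth_near_differentiable differentiable_imp_continuous_within by blast

lemma smooth_near_derivative:
  assumes "smooth_near z f"
  shows "smooth_near z (\<lambda>x. frechet_derivative f (at x) v)"
proof -
  obtain V where V: "open V" "z \<in> V" "\<And>k. Ck_on k V f"
    using assms unfolding smooth_near_def by blast
  then show ?thesis
    unfolding smooth_near_def using Ck_on_SucD'[OF V(3)] by blast
qed

lemma smooth_near_affine: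
  assumes "bounded_linear L" "smooth_near (c + L z) f"
  shows "smooth_near z (\<lambda>x. f (c + L x))"
proof -
  obtain V where V: "open V" "c + L z \<in> V" "\<And>k. Ck_on k V f"
    using assms(2) unfolding smooth_near_def by blast
  have "open ((\<lambda>x. c + L x) -` V)"
    by (intro open_vimage V continuous_intros bounded_linear.continuous_on[OF assms(1)])
  then show ?thesis
    unfolding smooth_near_def using Ck_on_affine[OF assms(1) V(1) V(3)] V(2)
    by (intro exI[of _ "(\<lambda>x. c + L x) -` V"]) blast
qed

lemma frechet_derivative_affine:
  assumes "bounded_linear L" "f differentiable at (c + L z)"
  shows "frechet_derivative (\<lambda>x. f (c + L x)) (at z) v = frechet_derivative f (at (c + L z)) (L v)"
proof -
  have "((\<lambda>x. c + L x) has_derivative L) (at z)"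
    using has_derivative_add[OF has_derivative_const bounded_linear_imp_has_derivative[OF assms(1)]] by simp
  from has_derivative_compose[OF this, of f] assms(2)
  have "((\<lambda>x. f (c + L x)) has_derivative (\<lambda>v. frechet_derivative f (at (c + L z)) (L v))) (at z)"
    by (simp add: frechet_derivative_works)
  from frechet_derivative_at[OF this] show ?thesis by metis
qed

lemma frechet_derivative_cong:
  assumes "\<forall>\<^sub>F x in nhds z. f x = g x"
  shows "frechet_derivative f (at z) = frechet_derivative g (at z)"
proof -
  obtain W where W: "open W" "z \<in> W" "\<And>x. x \<in> W \<Longrightarrow> f x = g x"
    using assms by (auto simp: eventually_nhds)
  have "(f has_derivative f') (at z) \<longleftrightarrow> (g has_derivative f') (at z)" for f'
    using W has_derivative_transform_within_open[of f f' z UNIV W g]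
      has_derivative_transform_within_open[of g f' z UNIV W f] by metis
  then show ?thesis
    by (simp add: frechet_derivative_def)
qed

lemma ball_add_norm: "norm w < r \<Longrightarrow> z + w \<in> ball z r"
  by (simp add: dist_norm)

text \<open>The classical argument: the second difference of \<open>f\<close> along \<open>u\<close> and \<open>v\<close> is, by the mean
  value theorem applied in the two possible orders, a value of either mixed derivative.\<close>

lemma second_difference:
  fixes f :: "'v::real_normed_vector \<Rightarrow> real"
  assumes "r > 0" "\<And>x. x \<in> ball z r \<Longrightarrow> f differentiable at x"
    "\<And>x. x \<in> ball z r \<Longrightarrow> (\<lambda>x. frechet_derivative f (at x) u) differentiable at x"
    "h > 0" "h * (norm u + norm v) < r"
  obtains a b where "0 < a" "a < h" "0 < b" "b < h"
    "f (z + h *\<^sub>R u + h *\<^sub>R v) - f (z + h *\<^sub>R u) - f (z + h *\<^sub>R v) + f z =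
      h * h * frechet_derivative (\<lambda>x. frechet_derivative f (at x) u) (at (z + a *\<^sub>R u + b *\<^sub>R v)) v"
proof -
  define f1 where "f1 x = frechet_derivative f (at x) u" for x
  have inb: "z + a *\<^sub>R u + b *\<^sub>R v \<in> ball z r" if "0 \<le> a" "a \<le> h" "0 \<le> b" "b \<le> h" for a b
  proof -
    have "norm (a *\<^sub>R u + b *\<^sub>R v) \<le> a * norm u + b * norm v"
      using that by (metis abs_of_nonneg norm_scaleR norm_triangle_ineq)
    also have "\<dots> \<le> h * (norm u + norm v)"
      using that by (simp add: distrib_left add_mono mult_right_mono)
    finally have "norm (a *\<^sub>R u + b *\<^sub>R v) < r" using assms(5) by linarith
    then show ?thesis
      using ball_add_norm[of "a *\<^sub>R u + b *\<^sub>R v" r z] by (simp only: add.assoc)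
  qed
  have df: "((\<lambda>s. f (z + s *\<^sub>R u + b *\<^sub>R v)) has_real_derivative f1 (z + s *\<^sub>R u + b *\<^sub>R v)) (at s)"
    if "0 \<le> s" "s \<le> h" "0 \<le> b" "b \<le> h" for s b
  proof -
    have "((\<lambda>s. f (z + s *\<^sub>R u + b *\<^sub>R v)) has_derivative
      (\<lambda>t. frechet_derivative f (at (z + s *\<^sub>R u + b *\<^sub>R v)) (t *\<^sub>R u))) (at s)"
      using assms(2)[OF inb[OF that]]
      by (intro has_derivative_compose[of "\<lambda>s. z + s *\<^sub>R u + b *\<^sub>R v" "\<lambda>t. t *\<^sub>R u" s UNIV f])
        (auto intro!: derivative_eq_intros simp: frechet_derivative_works)
    moreover have "frechet_derivative f (at (z + s *\<^sub>R u + b *\<^sub>R v)) (t *\<^sub>R u) = f1 (z + s *\<^sub>R u + b *\<^sub>R v) * t" for t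
      using linear_frechet_derivative[OF assms(2)[OF inb[OF that]]]
      by (simp add: f1_def linear_scale mult.commute)
    ultimately show ?thesis by (simp add: has_field_derivative_def)
  qed
  have df1: "((\<lambda>t. f1 (z + a *\<^sub>R u + t *\<^sub>R v)) has_real_derivative
      frechet_derivative f1 (at (z + a *\<^sub>R u + t *\<^sub>R v)) v) (at t)"
    if "0 \<le> a" "a \<le> h" "0 \<le> t" "t \<le> h" for t a
  proof -
    have d: "f1 differentiable at (z + a *\<^sub>R u + t *\<^sub>R v)"
      using assms(3)[OF inb[OF that]] by (simp add: f1_def[abs_def])
    have "((\<lambda>t. f1 (z + a *\<^sub>R u + t *\<^sub>R v)) has_derivative
      (\<lambda>s. frechet_derivative f1 (at (z + a *\<^sub>R u + t *\<^sub>R v)) (s *\<^sub>R v))) (at t)"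
      using d
      by (intro has_derivative_compose[of "\<lambda>t. z + a *\<^sub>R u + t *\<^sub>R v" "\<lambda>s. s *\<^sub>R v" t UNIV f1])
        (auto intro!: derivative_eq_intros simp: frechet_derivative_works)
    moreover have "frechet_derivative f1 (at (z + a *\<^sub>R u + t *\<^sub>R v)) (s *\<^sub>R v)
      = frechet_derivative f1 (at (z + a *\<^sub>R u + t *\<^sub>R v)) v * s" for s
      using linear_frechet_derivative[OF d] by (simp add: linear_scale mult.commute)
    ultimately show ?thesis by (simp add: has_field_derivative_def)
  qed
  have "\<exists>a>0. a < h \<and> (f (z + h *\<^sub>R u + h *\<^sub>R v) - f (z + h *\<^sub>R u + 0 *\<^sub>R v)) - (f (z + 0 *\<^sub>R u + h *\<^sub>R v) - f (z + 0 *\<^sub>R u + 0 *\<^sub>R v))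
    = (h - 0) * (f1 (z + a *\<^sub>R u + h *\<^sub>R v) - f1 (z + a *\<^sub>R u + 0 *\<^sub>R v))"
    by (rule MVT2[OF \<open>h > 0\<close>, of "\<lambda>s. f (z + s *\<^sub>R u + h *\<^sub>R v) - f (z + s *\<^sub>R u + 0 *\<^sub>R v)"
      "\<lambda>s. f1 (z + s *\<^sub>R u + h *\<^sub>R v) - f1 (z + s *\<^sub>R u + 0 *\<^sub>R v)"])
      (intro DERIV_diff df; use \<open>h > 0\<close> in simp)
  then obtain a where a: "0 < a" "a < h" "f (z + h *\<^sub>R u + h *\<^sub>R v) - f (z + h *\<^sub>R u) - f (z + h *\<^sub>R v) + f z =
    h * (f1 (z + a *\<^sub>R u + h *\<^sub>R v) - f1 (z + a *\<^sub>R u + 0 *\<^sub>R v))" by auto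
  have "\<exists>b>0. b < h \<and> f1 (z + a *\<^sub>R u + h *\<^sub>R v) - f1 (z + a *\<^sub>R u + 0 *\<^sub>R v) = (h - 0) * frechet_derivative f1 (at (z + a *\<^sub>R u + b *\<^sub>R v)) v"
    by (rule MVT2[OF \<open>h > 0\<close>, of "\<lambda>t. f1 (z + a *\<^sub>R u + t *\<^sub>R v)"
      "\<lambda>t. frechet_derivative f1 (at (z + a *\<^sub>R u + t *\<^sub>R v)) v"])
      (intro df1; use a in simp)
  then obtain b where "0 < b" "b < h" "f1 (z + a *\<^sub>R u + h *\<^sub>R v) - f1 (z + a *\<^sub>R u + 0 *\<^sub>R v) = h * frechet_derivative f1 (at (z + a *\<^sub>R u + b *\<^sub>R v)) v"
    by auto
  then show ?thesis using that[of a b] a by (simp add: f1_def[abs_def])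
qed

lemma second_difference_limit:
  assumes "smooth_near z f"
  shows "((\<lambda>h. (f (z + h *\<^sub>R u + h *\<^sub>R v) - f (z + h *\<^sub>R u) - f (z + h *\<^sub>R v) + f z) / (h * h)) \<longlongrightarrow>
      frechet_derivative (\<lambda>x. frechet_derivative f (at x) u) (at z) v) (at_right 0)"
proof (rule tendstoI)
  fix e :: real assume "e > 0"
  define F where "F = (\<lambda>x. frechet_derivative (\<lambda>x. frechet_derivative f (at x) u) (at x) v)"
  have sF: "smooth_near z F" and s1: "smooth_near z (\<lambda>x. frechet_derivative f (at x) u)"
    unfolding F_def by (intro smooth_near_derivative assms)+
  have "\<forall>\<^sub>F x in at z. dist (F x) (F z) < e"
    using tendstoD[OF smooth_near_isCont[OF sF, unfolded isCont_def] \<open>e > 0\<close>] .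
  then have "\<forall>\<^sub>F x in nhds z. dist (F x) (F z) < e"
    unfolding eventually_at_filter by (rule eventually_mono) (use \<open>e > 0\<close> in auto)
  then have "\<forall>\<^sub>F x in nhds z. f differentiable at x \<and>
      (\<lambda>x. frechet_derivative f (at x) u) differentiable at x \<and> dist (F x) (F z) < e"
    using smooth_near_eventually[OF assms] smooth_near_eventually[OF s1]
    by eventually_elim auto
  then obtain r where r: "r > 0" "\<And>x. x \<in> ball z r \<Longrightarrow> f differentiable at x \<and>
      (\<lambda>x. frechet_derivative f (at x) u) differentiable at x \<and> dist (F x) (F z) < e"
    by (auto simp: eventually_nhds_metric dist_commute)
  define c where "c = r / (norm u + norm v + 1)"
  have c: "c > 0" unfolding c_def using r(1) by (simp add: add_nonneg_pos)
  show "\<forall>\<^sub>F h in at_right 0. dist ((f (z + h *\<^sub>R u + h *\<^sub>R v) - f (z + h *\<^sub>R u) - f (z + h *\<^sub>R v) + f z) / (h * h))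
      (frechet_derivative (\<lambda>x. frechet_derivative f (at x) u) (at z) v) < e"
    unfolding eventually_at_right_field
  proof (intro exI[of _ c] conjI c allI impI)
    fix h :: real assume h: "0 < h" "h < c"
    have "h * (norm u + norm v + 1) < r"
      using h(2) by (simp add: c_def pos_less_divide_eq add_nonneg_pos)
    then have hr: "h * (norm u + norm v) < r"
      using h(1) by (simp add: distrib_left)
    obtain a b where ab: "0 < a" "a < h" "0 < b" "b < h"
      "f (z + h *\<^sub>R u + h *\<^sub>R v) - f (z + h *\<^sub>R u) - f (z + h *\<^sub>R v) + f z = h * h * F (z + a *\<^sub>R u + b *\<^sub>R v)"
      using second_difference[OF r(1) _ _ h(1) hr, of z f] r(2) unfolding F_def by blast
    have "norm (a *\<^sub>R u + b *\<^sub>R v) \<le> a * norm u + b * norm v"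
      using ab by (metis abs_of_pos norm_scaleR norm_triangle_ineq)
    also have "\<dots> \<le> h * (norm u + norm v)"
      using ab by (simp add: distrib_left add_mono mult_right_mono)
    finally have "norm (a *\<^sub>R u + b *\<^sub>R v) < r" using hr by linarith
    then have "z + a *\<^sub>R u + b *\<^sub>R v \<in> ball z r"
      using ball_add_norm[of "a *\<^sub>R u + b *\<^sub>R v" r z] by (simp only: add.assoc)
    with r(2) have "dist (F (z + a *\<^sub>R u + b *\<^sub>R v)) (F z) < e" by blast
    then show "dist ((f (z + h *\<^sub>R u + h *\<^sub>R v) - f (z + h *\<^sub>R u) - f (z + h *\<^sub>R v) + f z) / (h * h))
      (frechet_derivative (\<lambda>x. frechet_derivative f (at x) u) (at z) v) < e"
      using h(1) unfolding ab(5) by (simp add: F_def)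
  qed
qed

lemma mixed_derivatives_commute:
  assumes "smooth_near z f"
  shows "frechet_derivative (\<lambda>x. frechet_derivative f (at x) u) (at z) v =
    frechet_derivative (\<lambda>x. frechet_derivative f (at x) v) (at z) u"
proof -
  have "((\<lambda>h. (f (z + h *\<^sub>R u + h *\<^sub>R v) - f (z + h *\<^sub>R u) - f (z + h *\<^sub>R v) + f z) / (h * h)) \<longlongrightarrow>
      frechet_derivative (\<lambda>x. frechet_derivative f (at x) v) (at z) u) (at_right 0)"
    using second_difference_limit[OF assms, of v u] by (simp add: algebra_simps)
  with second_difference_limit[OF assms, of u v] show ?thesis
    using tendsto_unique trivial_limit_at_right_real by blast
qed

section \<open>The differential ring of germs\<close>

lemma smooth_near_diff: "smooth_near z f \<Longrightarrow> smooth_near z g \<Longrightarrow> smooth_near z (\<lambda>x. f x - g x)"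
  using smooth_near_add[OF _ smooth_near_uminus, of z f g] by simp

definition germ_eq :: "('v::real_normed_vector \<Rightarrow> real) \<Rightarrow> ('v \<Rightarrow> real) \<Rightarrow> bool" where
  "germ_eq f g \<longleftrightarrow> smooth_near 0 f \<and> smooth_near 0 g \<and> (\<forall>\<^sub>F x in nhds 0. f x = g x)"

lemma germ_eq_sym: "germ_eq f g \<Longrightarrow> germ_eq g f"
  unfolding germ_eq_def by (simp add: eq_commute[of "g _"])

lemma germ_eq_trans: "germ_eq f g \<Longrightarrow> germ_eq g h \<Longrightarrow> germ_eq f h"
  unfolding germ_eq_def using eventually_elim2[of "\<lambda>x. f x = g x" "nhds 0" "\<lambda>x. g x = h x" "\<lambda>x. f x = h x"]
  by simp

lemma germ_eqI: "smooth_near 0 f \<Longrightarrow> f = g \<Longrightarrow> germ_eq f g"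
  unfolding germ_eq_def by simp

lemma germ_eqD: "germ_eq f g \<Longrightarrow> smooth_near 0 f" "germ_eq f g \<Longrightarrow> smooth_near 0 g"
  unfolding germ_eq_def by simp_all

lemma germ_eq_binary:
  fixes f f' g g' :: "'v::real_normed_vector \<Rightarrow> real"
  assumes "germ_eq f f'" "germ_eq g g'"
    "\<And>f g :: 'v \<Rightarrow> real. smooth_near 0 f \<Longrightarrow> smooth_near 0 g \<Longrightarrow> smooth_near 0 (\<lambda>x. h (f x) (g x))"
  shows "germ_eq (\<lambda>x. h (f x) (g x)) (\<lambda>x. h (f' x) (g' x))"
proof -
  have "\<forall>\<^sub>F x in nhds 0. f x = f' x" "\<forall>\<^sub>F x in nhds 0. g x = g' x"
    using assms(1,2) by (simp_all add: germ_eq_def)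
  then have "\<forall>\<^sub>F x in nhds 0. h (f x) (g x) = h (f' x) (g' x)"
    by eventually_elim simp
  then show ?thesis
    using assms(3)[OF germ_eqD(1)[OF assms(1)] germ_eqD(1)[OF assms(2)]]
      assms(3)[OF germ_eqD(2)[OF assms(1)] germ_eqD(2)[OF assms(2)]]
    unfolding germ_eq_def by blast
qed

text \<open>Germs at the origin of smooth functions. Germs at other points are obtained by translation,
  so that one type serves for all of them.\<close>

quotient_type (overloaded) 'v germ = "'v::real_normed_vector \<Rightarrow> real" / partial: germ_eq
proof (rule part_equivpI)
  show "\<exists>f. germ_eq f f"
    by (rule exI[of _ "\<lambda>_. 0"]) (simp add: germ_eq_def smooth_near_const)
qed (rule sympI, erule germ_eq_sym, rule transpI, erule germ_eq_trans, assumption)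

lift_definition germ_const :: "real \<Rightarrow> 'v::real_normed_vector germ" is "\<lambda>c _. c"
  by (simp add: germ_eq_def smooth_near_const)

lemma germ_eq_deriv:
  assumes "germ_eq f g"
  shows "germ_eq (\<lambda>x. frechet_derivative f (at x) v) (\<lambda>x. frechet_derivative g (at x) v)"
proof -
  obtain W where W: "open W" "0 \<in> W" "\<And>x. x \<in> W \<Longrightarrow> f x = g x"
    using assms unfolding germ_eq_def eventually_nhds by blast
  have "frechet_derivative f (at x) v = frechet_derivative g (at x) v" if "x \<in> W" for x
  proof -
    have "\<forall>\<^sub>F x in nhds x. f x = g x"
      unfolding eventually_nhds using W(1,3) that by blast
    from frechet_derivative_cong[OF this] show ?thesis by simp
  qed
  then have "\<forall>\<^sub>F x in nhds 0. frechet_derivative f (at x) v = frechet_derivative g (at x) v"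
    unfolding eventually_nhds using W(1,2) by blast
  then show ?thesis
    unfolding germ_eq_def
    by (intro conjI smooth_near_derivative germ_eqD[OF assms])
qed

lift_definition germ_deriv :: "'v \<Rightarrow> 'v::real_normed_vector germ \<Rightarrow> 'v germ"
  is "\<lambda>v f x. frechet_derivative f (at x) v"
  by (rule germ_eq_deriv)

lift_definition germ_value :: "'v::real_normed_vector germ \<Rightarrow> real" is "\<lambda>f. f 0"
  unfolding germ_eq_def by (blast dest: eventually_nhds_x_imp_x)

instantiation germ :: (real_normed_vector) comm_ring_1
begin

lift_definition zero_germ :: "'a germ" is "\<lambda>_. 0"
  by (simp add: germ_eq_def smooth_near_const)
lift_definition one_germ :: "'a germ" is "\<lambda>_. 1"
  by (simp add: germ_eq_def smooth_near_const)
lift_definition plus_germ :: "'a germ \<Rightarrow> 'a germ \<Rightarrow> 'a germ" is "\<lambda>f g x. f x + g x"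
  by (rule germ_eq_binary[where h = "(+)"]; (assumption | rule smooth_near_add; assumption))
lift_definition uminus_germ :: "'a germ \<Rightarrow> 'a germ" is "\<lambda>f x. - f x"
  by (rule germ_eq_binary[where h = "\<lambda>a b. - a"]; (assumption | rule smooth_near_uminus; assumption))
lift_definition minus_germ :: "'a germ \<Rightarrow> 'a germ \<Rightarrow> 'a germ" is "\<lambda>f g x. f x - g x"
  by (rule germ_eq_binary[where h = "(-)"]; (assumption | rule smooth_near_diff; assumption))
lift_definition times_germ :: "'a germ \<Rightarrow> 'a germ \<Rightarrow> 'a germ" is "\<lambda>f g x. f x * g x"
  by (rule germ_eq_binary[where h = "\<lambda>a b. a * b"]; (assumption | rule smooth_near_mult; assumption))

instance
proof
  fix a b c :: "'a germ"
  show "a + b + c = a + (b + c)" by transfer (simp add: germ_eq_def smooth_near_add smooth_near_mult smooth_near_uminus smooth_near_diff smooth_near_const ac_simps)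
  show "a + b = b + a" by transfer (simp add: germ_eq_def smooth_near_add smooth_near_mult smooth_near_uminus smooth_near_diff smooth_near_const ac_simps)
  show "0 + a = a" by transfer (simp add: germ_eq_def smooth_near_add smooth_near_mult smooth_near_uminus smooth_near_diff smooth_near_const ac_simps)
  show "- a + a = 0" by transfer (simp add: germ_eq_def smooth_near_add smooth_near_mult smooth_near_uminus smooth_near_diff smooth_near_const ac_simps)
  show "a - b = a + - b" by transfer (simp add: germ_eq_def smooth_near_add smooth_near_mult smooth_near_uminus smooth_near_diff smooth_near_const ac_simps)
  show "a * b * c = a * (b * c)" by transfer (simp add: germ_eq_def smooth_near_add smooth_near_mult smooth_near_uminus smooth_near_diff smooth_near_const ac_simps)
  show "a * b = b * a" by transfer (simp add: germ_eq_def smooth_near_add smooth_near_mult smooth_near_uminus smooth_near_diff smooth_near_const ac_simps)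
  show "1 * a = a" by transfer (simp add: germ_eq_def smooth_near_add smooth_near_mult smooth_near_uminus smooth_near_diff smooth_near_const ac_simps)
  show "(a + b) * c = a * c + b * c"
    by transfer (simp add: germ_eq_def smooth_near_add smooth_near_mult distrib_right)
  show "(0 :: 'a germ) \<noteq> 1"
    by transfer (simp add: germ_eq_def)
qed

end

definition represents :: "'v::real_normed_vector \<Rightarrow> ('v \<Rightarrow> real) \<Rightarrow> 'v germ \<Rightarrow> bool" where
  "represents z f \<gamma> \<longleftrightarrow> smooth_near z f \<and> \<gamma> = abs_germ (\<lambda>w. f (z + w))"

lemma smooth_near_translate:
  assumes "smooth_near z f" shows "smooth_near 0 (\<lambda>w. f (z + w))"
  using smooth_near_affine[OF bounded_linear_ident, of z 0 f] assms by simp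

lemma eventually_translate:
  fixes z :: "'v::real_normed_vector"
  assumes "\<forall>\<^sub>F x in nhds z. P x" shows "\<forall>\<^sub>F w in nhds 0. P (z + w)"
proof -
  have "((\<lambda>w. z + w) \<longlongrightarrow> z + 0) (nhds 0)"
    by (intro tendsto_add tendsto_const filterlim_ident)
  then show ?thesis using assms by (simp add: filterlim_iff)
qed

lemma eventually_translate_iff:
  fixes z :: "'v::real_normed_vector"
  shows "(\<forall>\<^sub>F w in nhds 0. P (z + w)) \<longleftrightarrow> (\<forall>\<^sub>F x in nhds z. P x)"
proof
  assume *: "\<forall>\<^sub>F w in nhds 0. P (z + w)"
  have "((\<lambda>x. x - z) \<longlongrightarrow> z - z) (nhds z)"
    by (intro tendsto_diff tendsto_const filterlim_ident)
  then have "\<forall>\<^sub>F x in nhds z. P (z + (x - z))"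
    using * by (auto simp: filterlim_iff)
  then show "\<forall>\<^sub>F x in nhds z. P x" by simp
qed (rule eventually_translate)

lemma represents_abs:
  assumes "represents z f \<gamma>"
  shows "germ_eq (\<lambda>w. f (z + w)) (\<lambda>w. f (z + w))" "\<gamma> = abs_germ (\<lambda>w. f (z + w))"
  using assms smooth_near_translate unfolding represents_def germ_eq_def by auto

lemma represents_smooth: "represents z f \<gamma> \<Longrightarrow> smooth_near z f"
  by (simp add: represents_def)

lemma represents_exists: "smooth_near z f \<Longrightarrow> \<exists>\<gamma>. represents z f \<gamma>"
  by (simp add: represents_def)

lemma germ_represented: "\<exists>f. represents 0 f \<gamma>"
proof -
  have "germ_eq (rep_germ \<gamma>) (rep_germ \<gamma>)" "abs_germ (rep_germ \<gamma>) = \<gamma>"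
    by (rule Quotient_rep_reflp[OF Quotient_germ], rule Quotient_abs_rep[OF Quotient_germ])
  then show ?thesis
    by (intro exI[of _ "rep_germ \<gamma>"]) (simp add: represents_def germ_eq_def)
qed

lemma represents_eq_iff:
  assumes "represents z f \<gamma>" "represents z g \<delta>"
  shows "\<gamma> = \<delta> \<longleftrightarrow> (\<forall>\<^sub>F x in nhds z. f x = g x)"
proof -
  have "\<gamma> = \<delta> \<longleftrightarrow> germ_eq (\<lambda>w. f (z + w)) (\<lambda>w. g (z + w))"
    using Quotient_rel[OF Quotient_germ, of "\<lambda>w. f (z + w)" "\<lambda>w. g (z + w)"]
      represents_abs(1)[OF assms(1)] represents_abs(1)[OF assms(2)]
    unfolding represents_abs(2)[OF assms(1)] represents_abs(2)[OF assms(2)] by simp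
  also have "\<dots> \<longleftrightarrow> (\<forall>\<^sub>F w in nhds 0. f (z + w) = g (z + w))"
    using represents_abs(1)[OF assms(1)] represents_abs(1)[OF assms(2)] unfolding germ_eq_def by blast
  also have "\<dots> \<longleftrightarrow> (\<forall>\<^sub>F x in nhds z. f x = g x)"
    by (rule eventually_translate_iff)
  finally show ?thesis .
qed

lemma represents_unique: "represents z f \<gamma> \<Longrightarrow> represents z f \<delta> \<Longrightarrow> \<gamma> = \<delta>"
  by (simp add: represents_def)

lemma represents_cong:
  assumes "represents z f \<gamma>" "\<forall>\<^sub>F x in nhds z. f x = g x"
  shows "represents z g \<gamma>"
proof -
  have "smooth_near z g"
    using smooth_near_transform[OF represents_smooth[OF assms(1)] assms(2)] .
  then obtain \<delta> where "represents z g \<delta>"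
    using represents_exists by blast
  then show ?thesis
    using represents_eq_iff[OF assms(1)] assms(2) by blast
qed

lemma represents_const: "represents z (\<lambda>_. c) (germ_const c)"
  by (simp add: represents_def smooth_near_const germ_const.abs_eq)

lemma represents_0: "represents z (\<lambda>_. 0) 0"
  by (simp add: represents_def smooth_near_const zero_germ.abs_eq)

lemma represents_1: "represents z (\<lambda>_. 1) 1"
  by (simp add: represents_def smooth_near_const one_germ.abs_eq)

lemma represents_add:
  assumes "represents z f \<gamma>" "represents z g \<delta>"
  shows "represents z (\<lambda>x. f x + g x) (\<gamma> + \<delta>)"
  using assms represents_abs[OF assms(1)] represents_abs[OF assms(2)]
  by (simp add: represents_def smooth_near_add plus_germ.abs_eq)

lemma represents_mult:
  assumes "represents z f \<gamma>" "represents z g \<delta>"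
  shows "represents z (\<lambda>x. f x * g x) (\<gamma> * \<delta>)"
  using assms represents_abs[OF assms(1)] represents_abs[OF assms(2)]
  by (simp add: represents_def smooth_near_mult times_germ.abs_eq)

lemma represents_uminus:
  assumes "represents z f \<gamma>"
  shows "represents z (\<lambda>x. - f x) (- \<gamma>)"
  using assms represents_abs[OF assms(1)]
  by (simp add: represents_def smooth_near_uminus uminus_germ.abs_eq)

lemma represents_diff:
  assumes "represents z f \<gamma>" "represents z g \<delta>"
  shows "represents z (\<lambda>x. f x - g x) (\<gamma> - \<delta>)"
  using represents_add[OF assms(1) represents_uminus[OF assms(2)]] by simp

lemma represents_sum:
  assumes "\<And>i. i \<in> S \<Longrightarrow> represents z (f i) (\<gamma> i)"
  shows "represents z (\<lambda>x. \<Sum>i\<in>S. f i x) (\<Sum>i\<in>S. \<gamma> i)"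
  using assms
  by (induction S rule: infinite_finite_induct) (simp_all add: represents_0 represents_add)

lemma represents_prod:
  assumes "\<And>i. i \<in> S \<Longrightarrow> represents z (f i) (\<gamma> i)"
  shows "represents z (\<lambda>x. \<Prod>i\<in>S. f i x) (\<Prod>i\<in>S. \<gamma> i)"
  using assms
  by (induction S rule: infinite_finite_induct) (simp_all add: represents_1 represents_mult)

lemma represents_deriv:
  assumes "represents z f \<gamma>"
  shows "represents z (\<lambda>x. frechet_derivative f (at x) v) (germ_deriv v \<gamma>)"
proof -
  have s: "smooth_near z f"
    using represents_smooth[OF assms] .
  have "germ_deriv v \<gamma> = abs_germ (\<lambda>w. frechet_derivative (\<lambda>w. f (z + w)) (at w) v)"
    using represents_abs[OF assms] by (simp add: germ_deriv.abs_eq)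
  moreover have "\<forall>\<^sub>F w in nhds 0. frechet_derivative (\<lambda>w. f (z + w)) (at w) v = frechet_derivative f (at (z + w)) v"
    using eventually_translate[OF smooth_near_eventually[OF s]]
    by eventually_elim (simp add: frechet_derivative_affine[OF bounded_linear_ident])
  then have "germ_eq (\<lambda>w. frechet_derivative (\<lambda>w. f (z + w)) (at w) v) (\<lambda>w. frechet_derivative f (at (z + w)) v)"
    unfolding germ_eq_def
    using smooth_near_derivative[OF smooth_near_translate[OF s]] smooth_near_translate[OF smooth_near_derivative[OF s]]
    by blast
  then have "abs_germ (\<lambda>w. frechet_derivative (\<lambda>w. f (z + w)) (at w) v) = abs_germ (\<lambda>w. frechet_derivative f (at (z + w)) v)"
    by (rule Quotient_rel_abs[OF Quotient_germ])
  ultimately show ?thesis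
    unfolding represents_def using smooth_near_derivative[OF s] by simp
qed

lemma represents_value: "represents z f \<gamma> \<Longrightarrow> germ_value \<gamma> = f z"
  using represents_abs[of z f \<gamma>] by (simp add: germ_value.abs_eq)

lemma germ_deriv_add: "germ_deriv v (a + b) = germ_deriv v a + germ_deriv v b"
proof -
  obtain f g where fg: "represents 0 f a" "represents 0 g b"
    using germ_represented by metis
  have "\<forall>\<^sub>F x in nhds 0. frechet_derivative (\<lambda>x. f x + g x) (at x) v
      = frechet_derivative f (at x) v + frechet_derivative g (at x) v"
    using smooth_near_eventually[OF represents_smooth[OF fg(1)]] smooth_near_eventually[OF represents_smooth[OF fg(2)]]
  proof eventually_elim
    case (elim x)
    then show ?case
      using fun_cong[OF frechet_derivative_at[OF has_derivative_add[of f "frechet_derivative f (at x)" "at x" g "frechet_derivative g (at x)"]], of v]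
      by (simp add: frechet_derivative_works)
  qed
  then show ?thesis
    using represents_eq_iff[OF represents_deriv[OF represents_add[OF fg]] represents_add[OF represents_deriv[OF fg(1)] represents_deriv[OF fg(2)]]]
    by blast
qed

lemma germ_deriv_mult: "germ_deriv v (a * b) = germ_deriv v a * b + a * germ_deriv v b"
proof -
  obtain f g where fg: "represents 0 f a" "represents 0 g b"
    using germ_represented by metis
  have "\<forall>\<^sub>F x in nhds 0. frechet_derivative (\<lambda>x. f x * g x) (at x) v
      = frechet_derivative f (at x) v * g x + f x * frechet_derivative g (at x) v"
    using smooth_near_eventually[OF represents_smooth[OF fg(1)]] smooth_near_eventually[OF represents_smooth[OF fg(2)]]
  proof eventually_elim
    case (elim x)
    then show ?case
      using fun_cong[OF frechet_derivative_at[OF has_derivative_mult[of f "frechet_derivative f (at x)" x UNIV g "frechet_derivative g (at x)"]], of v]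
      by (simp add: frechet_derivative_works)
  qed
  then show ?thesis
    using represents_eq_iff[OF represents_deriv[OF represents_mult[OF fg]] represents_add[OF represents_mult[OF represents_deriv[OF fg(1)] fg(2)]
       represents_mult[OF fg(1) represents_deriv[OF fg(2)]]]]
    by blast
qed

lemma germ_deriv_commute: "germ_deriv u (germ_deriv v a) = germ_deriv v (germ_deriv u a)"
proof -
  obtain f where f: "represents 0 f a"
    using germ_represented by metis
  have "\<forall>\<^sub>F x in nhds 0. frechet_derivative (\<lambda>x. frechet_derivative f (at x) v) (at x) u
      = frechet_derivative (\<lambda>x. frechet_derivative f (at x) u) (at x) v"
    using smooth_near_eventually[OF represents_smooth[OF f]]
    by eventually_elim (simp add: mixed_derivatives_commute)
  then show ?thesis
    using represents_eq_iff[OF represents_deriv[OF represents_deriv[OF f]] represents_deriv[OF represents_deriv[OF f]]]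
    by blast
qed

lemma germ_const_arith:
  "germ_const (a + b) = germ_const a + germ_const b"
  "germ_const (a * b) = germ_const a * germ_const b"
  "germ_const 1 = 1" "germ_const 0 = 0"
  by (transfer; simp add: germ_eqI smooth_near_const)+

lemma germ_double_eq_0:
  fixes a :: "'v::real_normed_vector germ"
  assumes "a + a = 0" shows "a = 0"
proof -
  have "germ_const (1/2) * (a + a) = (germ_const (1/2) + germ_const (1/2)) * a"
    by (simp add: algebra_simps)
  also have "\<dots> = a"
    by (simp add: germ_const_arith(1)[symmetric] germ_const_arith(3))
  finally show ?thesis using assms by simp
qed

section \<open>Square matrices over a commutative ring\<close>

text \<open>Square matrices as a type of their own, so that matrix multiplication is the product of an
  instance of the class of rings. Most of the index calculations below thereby become
  calculations in a noncommutative ring.\<close>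

typedef ('r, 'n) sqmat = "UNIV :: ('n \<Rightarrow> 'n \<Rightarrow> 'r) set"
  morphisms ent Mat ..

lemma ent_Mat [simp]: "ent (Mat f) = f"
  by (simp add: Mat_inverse)

lemma sqmat_eqI: "(\<And>i j. ent A i j = ent B i j) \<Longrightarrow> A = B"
  using ent_inject[of A B] by blast

instantiation sqmat :: (comm_ring_1, finite) ring_1
begin

definition "0 = Mat (\<lambda>i j. 0)"
definition "1 = Mat (\<lambda>i j. if i = j then 1 else 0)"
definition "A + B = Mat (\<lambda>i j. ent A i j + ent B i j)"
definition "A - B = Mat (\<lambda>i j. ent A i j - ent B i j)"
definition "- A = Mat (\<lambda>i j. - ent A i j)"
definition "A * B = Mat (\<lambda>i j. \<Sum>k\<in>UNIV. ent A i k * ent B k j)"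

instance
proof
  fix a b c :: "('a, 'b) sqmat"
  show "a + b + c = a + (b + c)" "a + b = b + a" "0 + a = a" "- a + a = 0" "a - b = a + - b"
    by (rule sqmat_eqI; simp add: plus_sqmat_def zero_sqmat_def uminus_sqmat_def minus_sqmat_def)+
  show "1 * a = a" "a * 1 = a"
    by (rule sqmat_eqI; simp add: times_sqmat_def one_sqmat_def if_distrib if_distribR cong: if_cong)+
  show "(a + b) * c = a * c + b * c" "a * (b + c) = a * b + a * c"
    by (rule sqmat_eqI; simp add: times_sqmat_def plus_sqmat_def distrib_right distrib_left sum.distrib)+
  show "a * b * c = a * (b * c)"
  proof (rule sqmat_eqI)
    fix i j
    have "(\<Sum>k\<in>UNIV. \<Sum>l\<in>UNIV. ent a i l * ent b l k * ent c k j) =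
        (\<Sum>l\<in>UNIV. \<Sum>k\<in>UNIV. ent a i l * ent b l k * ent c k j)"
      by (rule sum.swap)
    then show "ent (a * b * c) i j = ent (a * (b * c)) i j"
      by (simp add: times_sqmat_def sum_distrib_left sum_distrib_right mult.assoc)
  qed
  show "(0 :: ('a, 'b) sqmat) \<noteq> 1"
  proof
    assume "(0 :: ('a, 'b) sqmat) = 1"
    then have "ent (0 :: ('a, 'b) sqmat) undefined undefined = ent 1 undefined undefined"
      by simp
    then show False by (simp add: zero_sqmat_def one_sqmat_def)
  qed
qed

end

lemma ent_simps [simp]:
  "ent 0 i j = 0"
  "ent (A + B) i j = ent A i j + ent B i j"
  "ent (A - B) i j = ent A i j - ent B i j"
  "ent (- A) i j = - ent A i j"
  by (simp_all add: zero_sqmat_def plus_sqmat_def minus_sqmat_def uminus_sqmat_def)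

lemma ent_one: "ent 1 i j = (if i = j then 1 else 0)"
  by (simp add: one_sqmat_def)

lemma ent_mult: "ent (A * B) i j = (\<Sum>k\<in>UNIV. ent A i k * ent B k j)"
  by (simp add: times_sqmat_def)

definition flip :: "('r, 'n) sqmat \<Rightarrow> ('r, 'n) sqmat" where
  "flip A = Mat (\<lambda>i j. ent A j i)"

definition smul :: "'r::comm_ring_1 \<Rightarrow> ('r, 'n) sqmat \<Rightarrow> ('r, 'n) sqmat" where
  "smul a A = Mat (\<lambda>i j. a * ent A i j)"

definition tr :: "('r::comm_ring_1, 'n::finite) sqmat \<Rightarrow> 'r" where
  "tr A = (\<Sum>i\<in>UNIV. ent A i i)"

definition map_mat :: "('r \<Rightarrow> 's) \<Rightarrow> ('r, 'n) sqmat \<Rightarrow> ('s, 'n) sqmat" where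
  "map_mat f A = Mat (\<lambda>i j. f (ent A i j))"

lemma ent_flip [simp]: "ent (flip A) i j = ent A j i"
  and ent_smul [simp]: "ent (smul a B) i j = a * ent B i j"
  and ent_map_mat [simp]: "ent (map_mat f C) i j = f (ent C i j)"
  by (simp_all add: flip_def smul_def map_mat_def)

lemma flip_simps:
  "flip (A + B) = flip A + flip B"
  "flip (A - B) = flip A - flip B"
  "flip (A * B) = flip B * flip A"
  "flip (smul a A) = smul a (flip A)"
  "flip (flip A) = A" "flip 1 = 1"
  by (rule sqmat_eqI; simp add: ent_mult ent_one mult.commute)+

lemma smul_mult: "smul a A * B = smul a (A * B)" "A * smul a B = smul a (A * B)"
  by (rule sqmat_eqI; simp add: ent_mult sum_distrib_left mult.left_commute mult.assoc)+

lemma smul_smul: "smul a (smul b A) = smul (a * b) A"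
  by (rule sqmat_eqI) (simp add: mult.assoc)

lemma tr_simps:
  "tr (A + B) = tr A + tr B" "tr (A - B) = tr A - tr B" "tr (smul a A) = a * tr A" "tr (- A) = - tr A"
  by (simp_all add: tr_def sum.distrib sum_subtractf sum_distrib_left sum_negf)

lemma tr_one: "tr (1 :: ('r::comm_ring_1, 'n::finite) sqmat) = of_nat CARD('n)"
  by (simp add: tr_def ent_one)

section \<open>Metrics, connections and curvature in a differential ring\<close>

text \<open>The rules of tensor calculus in coordinates: a ring of functions with commuting derivations. The
  absence of 2-torsion makes the Levi-Civita connection unique.\<close>

locale diff_ring =
  fixes d :: "'k \<Rightarrow> 'r::comm_ring_1 \<Rightarrow> 'r"
  assumes d_add: "d i (a + b) = d i a + d i b"
    and d_mult: "d i (a * b) = d i a * b + a * d i b"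
    and d_commute: "d i (d j a) = d j (d i a)"
    and double_eq_0: "a + a = 0 \<Longrightarrow> (a :: 'r) = 0"
begin

lemma d_0 [simp]: "d i 0 = 0"
  using d_add[of i 0 0] by simp

lemma d_1 [simp]: "d i 1 = 0"
  using d_mult[of i 1 1] by simp

lemma d_uminus: "d i (- a) = - d i a"
  using d_add[of i a "- a"] by (simp add: add_eq_0_iff)

lemma d_diff: "d i (a - b) = d i a - d i b"
  using d_add[of i a "- b"] d_uminus by simp

lemma d_sum: "d i (\<Sum>j\<in>S. f j) = (\<Sum>j\<in>S. d i (f j))"
  by (induction S rule: infinite_finite_induct) (simp_all add: d_add)

abbreviation D :: "'k \<Rightarrow> ('r, 'n) sqmat \<Rightarrow> ('r, 'n) sqmat" where
  "D i \<equiv> map_mat (d i)"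

lemma D_simps:
  "D i (A + B) = D i A + D i B"
  "D i (A - B) = D i A - D i B"
  "D i (- A) = - D i A"
  "D i (A * B) = D i A * B + A * D i B"
  "D i (smul a A) = smul (d i a) A + smul a (D i A)"
  "D i (flip A) = flip (D i A)"
  "D i 1 = 0"
  by (rule sqmat_eqI; simp add: ent_mult ent_one d_add d_diff d_uminus d_mult d_sum sum.distrib)+

lemma D_commute: "D i (D j A) = D j (D i A)"
  by (rule sqmat_eqI) (simp add: d_commute)

lemma d_tr: "d i (tr A) = tr (D i A)"
  by (simp add: tr_def d_sum)

lemma D_inverse:
  assumes "A * B = 1" "B * A = 1"
  shows "D i B = - (B * D i A * B)"
proof -
  have "D i A * B + A * D i B = 0"
    using arg_cong[OF assms(1), of "D i"] by (simp add: D_simps)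
  then have "B * (D i A * B + A * D i B) = 0" by simp
  then show ?thesis
    by (simp add: distrib_left mult.assoc[symmetric] assms(2) eq_neg_iff_add_eq_0 add.commute)
qed

end

lemma (in diff_ring) d_half:
  assumes "h + h = 1" shows "d i h = 0"
proof (rule double_eq_0)
  show "d i h + d i h = 0"
    by (simp only: d_add[symmetric] assms d_1)
qed

text \<open>Entry \<open>(k, j)\<close> of the matrix \<open>\<Gamma> i\<close> is $\Gamma^k{}_{ij}$; the two conditions say that the
  connection has no torsion and that it preserves the metric.\<close>

definition levi_civita_connection ::
  "('n \<Rightarrow> 'r::comm_ring_1 \<Rightarrow> 'r) \<Rightarrow> ('r, 'n::finite) sqmat \<Rightarrow> ('n \<Rightarrow> ('r, 'n) sqmat) \<Rightarrow> bool" where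
  "levi_civita_connection d G \<Gamma> \<longleftrightarrow>
     (\<forall>i j k. ent (\<Gamma> i) k j = ent (\<Gamma> j) k i) \<and>
     (\<forall>i. map_mat (d i) G = G * \<Gamma> i + flip (G * \<Gamma> i))"

definition curvature ::
  "('n \<Rightarrow> 'r::comm_ring_1 \<Rightarrow> 'r) \<Rightarrow> ('n \<Rightarrow> ('r, 'n::finite) sqmat) \<Rightarrow> 'n \<Rightarrow> 'n \<Rightarrow> ('r, 'n) sqmat" where
  "curvature d \<Gamma> k l = map_mat (d k) (\<Gamma> l) - map_mat (d l) (\<Gamma> k) + \<Gamma> k * \<Gamma> l - \<Gamma> l * \<Gamma> k"

definition ricci_mat ::
  "('n \<Rightarrow> 'r::comm_ring_1 \<Rightarrow> 'r) \<Rightarrow> ('n \<Rightarrow> ('r, 'n::finite) sqmat) \<Rightarrow> ('r, 'n) sqmat" where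
  "ricci_mat d \<Gamma> = Mat (\<lambda>j l. \<Sum>i\<in>UNIV. ent (curvature d \<Gamma> i l) i j)"

definition koszul ::
  "('n \<Rightarrow> 'r::comm_ring_1 \<Rightarrow> 'r) \<Rightarrow> ('r, 'n::finite) sqmat \<Rightarrow> 'n \<Rightarrow> ('r, 'n) sqmat" where
  "koszul d G i = Mat (\<lambda>l j. d i (ent G j l) + d j (ent G i l) - d l (ent G i j))"

text \<open>The Koszul formula, without a division by 2.\<close>

lemma levi_civita_koszul:
  assumes "levi_civita_connection d G \<Gamma>"
  shows "G * \<Gamma> i + G * \<Gamma> i = koszul d G i"
proof (rule sqmat_eqI)
  fix l j
  have sym: "ent (G * \<Gamma> i) l j = ent (G * \<Gamma> j) l i" for i j l
    using assms by (simp add: levi_civita_connection_def ent_mult)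
  have met: "d i (ent G l j) = ent (G * \<Gamma> i) l j + ent (G * \<Gamma> i) j l" for i j l
  proof -
    have "map_mat (d i) G = G * \<Gamma> i + flip (G * \<Gamma> i)"
      using assms by (simp add: levi_civita_connection_def)
    from arg_cong[OF this, of "\<lambda>M. ent M l j"] show ?thesis by simp
  qed
  show "ent (G * \<Gamma> i + G * \<Gamma> i) l j = ent (koszul d G i) l j"
    using sym[of i l j] sym[of i j l] sym[of j i l] by (simp add: koszul_def met algebra_simps)
qed

lemma (in diff_ring) levi_civita_unique:
  fixes G :: "('r, 'n::finite) sqmat"
  assumes "levi_civita_connection \<delta> G \<Gamma>" "levi_civita_connection \<delta> G \<Gamma>'" "Gi * G = 1"
  shows "\<Gamma> i = \<Gamma>' i"
proof -
  have "G * \<Gamma> i + G * \<Gamma> i = G * \<Gamma>' i + G * \<Gamma>' i"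
    using levi_civita_koszul[OF assms(1)] levi_civita_koszul[OF assms(2)] by simp
  then have "ent (G * \<Gamma> i) l j + ent (G * \<Gamma> i) l j = ent (G * \<Gamma>' i) l j + ent (G * \<Gamma>' i) l j" for l j
    by (metis ent_simps(2))
  then have "ent (G * \<Gamma> i) l j - ent (G * \<Gamma>' i) l j = 0" for l j
    using double_eq_0[of "ent (G * \<Gamma> i) l j - ent (G * \<Gamma>' i) l j"] by (simp add: algebra_simps)
  then have "G * \<Gamma> i = G * \<Gamma>' i"
    by (intro sqmat_eqI) simp
  then have "Gi * (G * \<Gamma> i) = Gi * (G * \<Gamma>' i)" by simp
  then show ?thesis
    by (simp add: mult.assoc[symmetric] assms(3))
qed

lemma levi_civita_exists:
  assumes "flip G = G" "G * Gi = 1" "h + h = 1"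
  shows "levi_civita_connection d G (\<lambda>i. smul h (Gi * koszul d G i))"
proof -
  have sym: "ent G i j = ent G j i" for i j
    using arg_cong[OF assms(1), of "\<lambda>M. ent M j i"] by simp
  have "ent (koszul d G i) l j = ent (koszul d G j) l i" for i j l
    by (simp add: koszul_def sym[of i j])
  then have 1: "ent (smul h (Gi * koszul d G i)) k j = ent (smul h (Gi * koszul d G j)) k i" for i j k
    by (simp add: ent_mult)
  have 2: "G * smul h (Gi * koszul d G i) = smul h (koszul d G i)" for i
    by (simp add: smul_mult mult.assoc[symmetric] assms(2))
  have "map_mat (d i) G = smul h (koszul d G i) + flip (smul h (koszul d G i))" for i
  proof (rule sqmat_eqI)
    fix l j
    have "ent (smul h (koszul d G i) + flip (smul h (koszul d G i))) l j = (h + h) * d i (ent G l j)"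
      using sym by (simp add: koszul_def algebra_simps)
    then show "ent (map_mat (d i) G) l j = ent (smul h (koszul d G i) + flip (smul h (koszul d G i))) l j"
      by (simp add: assms(3))
  qed
  with 1 2 show ?thesis
    by (simp add: levi_civita_connection_def)
qed

text \<open>A change of frame \<open>A\<close> carries a connection that preserves \<open>G\<close> to one that preserves
  \<open>A\<^sup>T G A\<close>. It remains free of torsion precisely if \<open>A\<close> satisfies the Codazzi equation.\<close>

lemma (in diff_ring) levi_civita_gauge:
  fixes e :: "'n::finite \<Rightarrow> 'k" and G A :: "('r, 'n) sqmat"
  assumes "levi_civita_connection (\<lambda>i. d (e i)) G \<Gamma>" "flip G = G" "A * Ai = 1"
    "\<And>i j k. ent (D (e i) A + \<Gamma> i * A) k j = ent (D (e j) A + \<Gamma> j * A) k i"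
  shows "levi_civita_connection (\<lambda>i. d (e i)) (flip A * G * A) (\<lambda>i. Ai * (D (e i) A + \<Gamma> i * A))"
proof -
  have A: "A * (Ai * B) = B" for B
    by (simp add: mult.assoc[symmetric] assms(3))
  have G: "D (e i) G = G * \<Gamma> i + flip (\<Gamma> i) * G" for i
    using assms(1,2) by (simp add: levi_civita_connection_def flip_simps)
  have 1: "ent (Ai * (D (e i) A + \<Gamma> i * A)) k j = ent (Ai * (D (e j) A + \<Gamma> j * A)) k i" for i j k
    unfolding ent_mult[of Ai] by (simp only: assms(4)[of i _ j])
  show ?thesis
    unfolding levi_civita_connection_def
    by (intro conjI allI 1) (simp add: D_simps flip_simps G assms(2) mult.assoc A distrib_left distrib_right ac_simps)
qed

lemma (in diff_ring) curvature_gauge: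
  fixes e :: "'n::finite \<Rightarrow> 'k" and A :: "('r, 'n) sqmat"
  assumes "A * Ai = 1" "Ai * A = 1"
  shows "curvature (\<lambda>i. d (e i)) (\<lambda>i. Ai * (D (e i) A + \<Gamma> i * A)) k l =
    Ai * curvature (\<lambda>i. d (e i)) \<Gamma> k l * A"
proof -
  have A: "A * (Ai * B) = B" "Ai * (A * B) = B" for B
    by (simp_all add: mult.assoc[symmetric] assms)
  show ?thesis
    by (simp add: curvature_def D_simps D_inverse[OF assms] mult.assoc A algebra_simps D_commute[of "e l"])
qed

section \<open>Conformally flat metrics\<close>

lemma sum_ent_one [simp]:
  fixes f :: "'n::finite \<Rightarrow> 'r::comm_ring_1"
  shows "(\<Sum>k\<in>UNIV. ent 1 i k * f k) = f i" "(\<Sum>k\<in>UNIV. f k * ent 1 k i) = f i"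
  by (simp_all add: ent_one if_distrib if_distribR cong: if_cong)

definition outer :: "('n \<Rightarrow> 'r::comm_ring_1) \<Rightarrow> ('n \<Rightarrow> 'r) \<Rightarrow> ('r, 'n) sqmat" where
  "outer u w = Mat (\<lambda>i j. u i * w j)"

lemma ent_outer [simp]: "ent (outer u w) i j = u i * w j"
  by (simp add: outer_def)

lemma ent_mult_outer: "ent (M * outer u w) i j = (\<Sum>r\<in>UNIV. ent M i r * u r) * w j"
  by (simp add: ent_mult sum_distrib_right mult.assoc)

lemma ent_outer_mult: "ent (outer u w * M) i j = u i * (\<Sum>r\<in>UNIV. w r * ent M r j)"
  by (simp add: ent_mult sum_distrib_left mult.assoc)

lemma outer_mult_outer: "outer u w * outer u' w' = smul (\<Sum>r\<in>UNIV. w r * u' r) (outer u w')"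
  by (rule sqmat_eqI) (simp add: ent_mult_outer sum_distrib_left sum_distrib_right mult.assoc mult.left_commute)

text \<open>The curvature of a conformally flat metric \<open>G\<close> is determined by a symmetric tensor \<open>P\<close>,
  the Schouten tensor in dimension at least 3, that satisfies the Codazzi equation. Here \<open>P\<close> is
  computed from the conformal factor, which also gives a tensor with these properties in
  dimension 2: if \<open>\<Upsilon>\<close> is the differential of the logarithmic factor and \<open>U\<close> its gradient, then
  \<open>P = \<nabla>U - U \<otimes> \<Upsilon> + |U|\<^sup>2/2\<close>.\<close>

lemma (in diff_ring) conformally_flat:
  fixes e :: "'n::finite \<Rightarrow> 'k" and G Gi :: "('r, 'n) sqmat"
  assumes lc: "levi_civita_connection (\<lambda>i. d (e i)) G \<Gamma>"
    and G: "flip G = G" "G * Gi = 1" "Gi * G = 1"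
    and closed: "\<And>i j. d (e i) (\<Upsilon> j) = d (e j) (\<Upsilon> i)"
    and E: "\<And>i. d (e i) E = (\<Upsilon> i + \<Upsilon> i) * E"
    and flat: "\<And>\<Gamma>' k l. levi_civita_connection (\<lambda>i. d (e i)) (smul E G) \<Gamma>' \<Longrightarrow>
      curvature (\<lambda>i. d (e i)) \<Gamma>' k l = 0"
    and h: "h + h = (1 :: 'r)"
  obtains P where "flip (G * P) = G * P"
    "\<And>k l a b. ent (curvature (\<lambda>i. d (e i)) \<Gamma> k l) a b =
      ent P a k * ent G b l - ent P a l * ent G b k - ent 1 a l * ent (G * P) b k + ent 1 a k * ent (G * P) b l"
    "\<And>i k l. ent (D (e k) P + \<Gamma> k * P) i l = ent (D (e l) P + \<Gamma> l * P) i k"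
    "\<And>m. D m G = 0 \<Longrightarrow> (\<And>i. d m (\<Upsilon> i) = 0) \<Longrightarrow> D m P = 0"
proof -
  define Y :: "('r, 'n) sqmat" where "Y = Mat (\<lambda>i j. \<Upsilon> i)"
  define W where "W = Gi * Y"
  define U where "U i = (\<Sum>r\<in>UNIV. ent Gi i r * \<Upsilon> r)" for i
  define V where "V k = D (e k) W + \<Gamma> k * W" for k
  define q where "q = h * (\<Sum>r\<in>UNIV. U r * \<Upsilon> r)"
  define P where "P = Mat (\<lambda>i k. ent (V k) i i - U i * \<Upsilon> k) + smul q 1"
  define \<delta> where "\<delta> = (\<lambda>i. d (e i))"
  have entY: "ent Y i j = \<Upsilon> i" for i j by (simp add: Y_def)
  have entW: "ent W i j = U i" for i j by (simp add: W_def U_def ent_mult entY)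
  have entV: "ent (V k) i j = ent (V k) i i" for i j k
    by (simp add: V_def ent_mult entW)
  have entGV: "ent (G * V k) a j = ent (G * V k) a a" for a j k
  proof -
    have "ent (V k) r j = ent (V k) r a" for r
      using entV[of k r j] entV[of k r a] by simp
    then show ?thesis by (simp add: ent_mult)
  qed
  have GW: "G * W = Y"
    by (simp add: W_def mult.assoc[symmetric] G)
  have GU: "(\<Sum>r\<in>UNIV. ent G i r * U r) = \<Upsilon> i" for i
    using arg_cong[OF GW, of "\<lambda>M. ent M i i"] by (simp add: ent_mult entY entW)
  have symG: "ent G i j = ent G j i" for i j
    using arg_cong[OF G(1), of "\<lambda>M. ent M j i"] by simp
  have sym\<Gamma>: "ent (\<Gamma> i) k j = ent (\<Gamma> j) k i" for i j k
    using lc by (simp add: levi_civita_connection_def)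
  have DG: "D (e k) G = G * \<Gamma> k + flip (\<Gamma> k) * G" for k
    using lc G(1) by (simp add: levi_civita_connection_def flip_simps)
  have sym_lower: "ent (G * \<Gamma> i) k j = ent (G * \<Gamma> j) k i" for i j k
    unfolding ent_mult using sym\<Gamma>[of i _ j] by simp
  have dG: "d (e k) (ent G l j) = ent (G * \<Gamma> k) l j + ent (G * \<Gamma> k) j l" for k l j
    using arg_cong[OF DG[of k], of "\<lambda>M. ent M l j"] by (simp add: ent_mult symG mult.commute)
  have DY: "D (e k) Y = G * V k + flip (\<Gamma> k) * Y" for k
    unfolding GW[symmetric] D_simps DG V_def by (simp add: algebra_simps)
  have dY: "d (e k) (\<Upsilon> a) = ent (G * V k) a a + (\<Sum>r\<in>UNIV. \<Upsilon> r * ent (\<Gamma> k) r a)" for k a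
    using arg_cong[OF DY[of k], of "\<lambda>M. ent M a a"] by (simp add: entY ent_mult[of "flip (\<Gamma> k)"] mult.commute)
  have symGV: "ent (G * V k) a a = ent (G * V a) k k" for k a
    using closed[of k a] sym\<Gamma>[of k _ a] by (simp add: dY)
  have entP: "ent P i k = ent (V k) i i - U i * \<Upsilon> k + q * ent 1 i k" for i k
    by (simp add: P_def)
  have entGP: "ent (G * P) a k = ent (G * V k) a a - \<Upsilon> a * \<Upsilon> k + q * ent G a k" for a k
  proof -
    have "ent (G * P) a k = (\<Sum>r\<in>UNIV. ent G a r * ent (V k) r r) - (\<Sum>r\<in>UNIV. ent G a r * U r) * \<Upsilon> k
        + q * (\<Sum>r\<in>UNIV. ent G a r * ent 1 r k)"
      unfolding ent_mult entP
      by (simp add: algebra_simps sum.distrib sum_subtractf sum_distrib_left sum_distrib_right del: sum_ent_one)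
    also have "(\<Sum>r\<in>UNIV. ent G a r * ent (V k) r r) = ent (G * V k) a a"
      unfolding ent_mult[of G] by (simp add: entV[of k _ a])
    finally show ?thesis by (simp add: GU)
  qed
  have P_sym: "flip (G * P) = G * P"
    by (rule sqmat_eqI) (simp add: entGP symGV symG mult.commute)
  \<comment> \<open>The Levi-Civita connection of the flat metric is \<open>\<Gamma> + B\<close>.\<close>
  define B where "B l = smul (\<Upsilon> l) 1 + outer (\<lambda>i. ent 1 i l) \<Upsilon> - outer U (\<lambda>j. ent G l j)" for l
  have GB: "G * B i + flip (G * B i) = smul (\<Upsilon> i + \<Upsilon> i) G" for i
    by (rule sqmat_eqI)
      (simp add: B_def distrib_left right_diff_distrib ent_mult_outer smul_mult GU GU[unfolded mult.commute[of "ent G _ _"]] symG algebra_simps)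
  have lcB: "levi_civita_connection (\<lambda>i. d (e i)) (smul E G) (\<lambda>i. \<Gamma> i + B i)"
    unfolding levi_civita_connection_def
  proof (intro conjI allI)
    fix i j k
    show "ent (\<Gamma> i + B i) k j = ent (\<Gamma> j + B j) k i"
      by (simp add: B_def sym\<Gamma>[of i k j] symG[of i j] algebra_simps)
    have "D (e i) (smul E G) = smul E (smul (\<Upsilon> i + \<Upsilon> i) G + G * \<Gamma> i + flip (G * \<Gamma> i))"
      by (rule sqmat_eqI) (simp add: D_simps E dG algebra_simps)
    also have "\<dots> = smul E G * (\<Gamma> i + B i) + flip (smul E G * (\<Gamma> i + B i))"
      unfolding GB[symmetric] by (rule sqmat_eqI) (simp add: smul_mult algebra_simps)
    finally show "D (e i) (smul E G) = smul E G * (\<Gamma> i + B i) + flip (smul E G * (\<Gamma> i + B i))" .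
  qed
  define X where "X k l = D (e k) (B l) + \<Gamma> k * B l - B l * \<Gamma> k + B k * B l" for k l
  have curv0: "curvature (\<lambda>i. d (e i)) \<Gamma> k l = X l k - X k l" for k l
  proof -
    have "curvature (\<lambda>i. d (e i)) (\<lambda>i. \<Gamma> i + B i) k l = curvature (\<lambda>i. d (e i)) \<Gamma> k l + (X k l - X l k)"
      by (simp add: curvature_def X_def D_simps algebra_simps)
    with flat[OF lcB, of k l] show ?thesis
      by (simp add: algebra_simps eq_neg_iff_add_eq_0)
  qed
  have UY: "(\<Sum>r\<in>UNIV. \<Upsilon> r * U r) = q + q"
    by (simp add: q_def distrib_right[symmetric] h mult.commute)
  have entX: "ent (X k l) i j =
      ent 1 i j * d (e k) (\<Upsilon> l) + ent 1 i l * ent (G * V k) j j - ent (V k) i i * ent G l j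
      - U i * ent (G * \<Gamma> k) j l + ent (\<Gamma> k) i l * \<Upsilon> j
      + ent 1 i j * \<Upsilon> k * \<Upsilon> l + ent 1 i l * \<Upsilon> k * \<Upsilon> j + ent 1 i k * \<Upsilon> j * \<Upsilon> l + ent 1 i k * \<Upsilon> l * \<Upsilon> j
      - ent 1 i k * (q + q) * ent G l j - U i * ent G k j * \<Upsilon> l - U i * ent G k l * \<Upsilon> j" for k l i j
  proof -
    have 1: "ent (D (e k) (B l)) i j = ent 1 i j * d (e k) (\<Upsilon> l) + ent 1 i l * d (e k) (\<Upsilon> j)
        - d (e k) (U i) * ent G l j - U i * (ent (G * \<Gamma> k) l j + ent (G * \<Gamma> k) j l)"
      by (simp add: B_def d_add d_diff d_mult dG ent_one algebra_simps)
    have VV: "ent (V k) i i = d (e k) (U i) + (\<Sum>r\<in>UNIV. ent (\<Gamma> k) i r * U r)"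
      by (simp add: V_def entW ent_mult)
    have 2: "ent (\<Gamma> k * B l) i j = ent (\<Gamma> k) i j * \<Upsilon> l + ent (\<Gamma> k) i l * \<Upsilon> j
        - (\<Sum>r\<in>UNIV. ent (\<Gamma> k) i r * U r) * ent G l j"
      by (simp add: B_def distrib_left right_diff_distrib smul_mult ent_mult_outer mult.commute[of "\<Upsilon> _"])
    have 3: "ent (B l * \<Gamma> k) i j = \<Upsilon> l * ent (\<Gamma> k) i j + ent 1 i l * (\<Sum>r\<in>UNIV. \<Upsilon> r * ent (\<Gamma> k) r j)
        - U i * ent (G * \<Gamma> k) l j"
      by (simp add: B_def distrib_right left_diff_distrib smul_mult ent_outer_mult ent_mult[of G])
    have 4: "ent (B k * B l) i j = ent 1 i j * \<Upsilon> k * \<Upsilon> l + ent 1 i l * \<Upsilon> k * \<Upsilon> j + ent 1 i k * \<Upsilon> j * \<Upsilon> l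
        + ent 1 i k * \<Upsilon> l * \<Upsilon> j - ent 1 i k * (q + q) * ent G l j - U i * ent G k j * \<Upsilon> l - U i * ent G k l * \<Upsilon> j"
      by (simp add: B_def distrib_left right_diff_distrib distrib_right left_diff_distrib smul_mult
          outer_mult_outer UY GU)
    show ?thesis
      unfolding X_def ent_simps 1 2 3 4 VV dY[of k j] by (simp add: algebra_simps)
  qed
  have R: "ent (curvature (\<lambda>i. d (e i)) \<Gamma> k l) a b =
      ent P a k * ent G b l - ent P a l * ent G b k - ent 1 a l * ent (G * P) b k + ent 1 a k * ent (G * P) b l"
    for k l a b
    unfolding curv0 ent_simps entX entP entGP closed[of k l] sym_lower[of k b l] sym\<Gamma>[of k a l]
      symG[of k l] symG[of k b] symG[of l b]
    by (simp add: algebra_simps)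
  define \<rho> where "\<rho> k = (\<Sum>j\<in>UNIV. U j * ent (G * V k) j j)" for k
  have dq: "d (e k) q = \<rho> k" for k
  proof -
    have q2: "ent (flip W * G * W) i i = q + q" for i
      unfolding UY[symmetric] by (simp add: mult.assoc GW ent_mult[of "flip W"] entW entY mult.commute)
    have "D (e k) (flip W * G * W) = flip W * (G * V k) + flip (flip W * (G * V k))"
      by (simp add: D_simps DG V_def flip_simps G(1) mult.assoc distrib_left distrib_right add.assoc add.left_commute)
    from arg_cong[OF this, of "\<lambda>M. ent M undefined undefined"]
    have "d (e k) (q + q) = ent (flip W * (G * V k)) undefined undefined + ent (flip W * (G * V k)) undefined undefined"
      by (simp add: q2)
    also have "ent (flip W * (G * V k)) undefined undefined = \<rho> k"
      unfolding \<rho>_def ent_mult[of "flip W"] ent_flip entW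
      by (simp only: entGV[of k _ undefined])
    finally have "(d (e k) q - \<rho> k) + (d (e k) q - \<rho> k) = 0"
      unfolding d_add by (simp only: algebra_simps) simp
    then show ?thesis using double_eq_0[of "d (e k) q - \<rho> k"] by simp
  qed
  have GPU: "(\<Sum>j\<in>UNIV. ent (G * P) j k * U j) = \<rho> k - q * \<Upsilon> k" for k
  proof -
    have "(\<Sum>j\<in>UNIV. ent (G * P) j k * U j) =
        \<rho> k - (\<Sum>r\<in>UNIV. \<Upsilon> r * U r) * \<Upsilon> k + q * (\<Sum>r\<in>UNIV. ent G k r * U r)"
      unfolding entGP \<rho>_def sum_distrib_left sum_distrib_right
      by (simp add: symG[of k] algebra_simps sum.distrib sum_subtractf)
    then show ?thesis unfolding UY GU by (simp add: algebra_simps)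
  qed
  have comm: "D (e k) (V l) + \<Gamma> k * V l - (D (e l) (V k) + \<Gamma> l * V k) = curvature (\<lambda>i. d (e i)) \<Gamma> k l * W" for k l
    by (simp add: V_def curvature_def D_simps D_commute[of "e l"] algebra_simps)
  have RW: "ent (curvature (\<lambda>i. d (e i)) \<Gamma> k l * W) i i =
     ent P i k * \<Upsilon> l - ent P i l * \<Upsilon> k - ent 1 i l * (\<rho> k - q * \<Upsilon> k) + ent 1 i k * (\<rho> l - q * \<Upsilon> l)" for k l i
  proof -
    have "ent (curvature (\<lambda>i. d (e i)) \<Gamma> k l * W) i i =
      ent P i k * (\<Sum>j\<in>UNIV. ent G l j * U j) - ent P i l * (\<Sum>j\<in>UNIV. ent G k j * U j)
      - ent 1 i l * (\<Sum>j\<in>UNIV. ent (G * P) j k * U j) + ent 1 i k * (\<Sum>j\<in>UNIV. ent (G * P) j l * U j)"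
      unfolding ent_mult[of "curvature _ _ _ _"] R entW sum_distrib_left
      by (simp add: symG[of l] symG[of k] algebra_simps sum.distrib sum_subtractf del: sum_ent_one)
    then show ?thesis by (simp only: GU GPU)
  qed
  have entDP: "ent (D (e k) P + \<Gamma> k * P) i l = ent (D (e k) (V l) + \<Gamma> k * V l) i i - ent (V k) i i * \<Upsilon> l
      - U i * d (e k) (\<Upsilon> l) + \<rho> k * ent 1 i l + q * ent (\<Gamma> k) i l" for i k l
  proof -
    have 1: "ent (D (e k) P) i l = d (e k) (ent (V l) i i) - d (e k) (U i) * \<Upsilon> l - U i * d (e k) (\<Upsilon> l) + \<rho> k * ent 1 i l"
      by (simp add: entP d_add d_diff d_mult dq ent_one)
    have "ent (\<Gamma> k * P) i l = (\<Sum>r\<in>UNIV. ent (\<Gamma> k) i r * ent (V l) r r) - (\<Sum>r\<in>UNIV. ent (\<Gamma> k) i r * U r) * \<Upsilon> l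
        + q * (\<Sum>r\<in>UNIV. ent (\<Gamma> k) i r * ent 1 r l)"
      unfolding ent_mult entP
      by (simp add: algebra_simps sum.distrib sum_subtractf sum_distrib_left sum_distrib_right del: sum_ent_one)
    also have "(\<Sum>r\<in>UNIV. ent (\<Gamma> k) i r * ent (V l) r r) = ent (\<Gamma> k * V l) i i"
      unfolding ent_mult[of "\<Gamma> k"] by (simp add: entV[of l _ i])
    finally have 2: "ent (\<Gamma> k * P) i l = ent (\<Gamma> k * V l) i i - (\<Sum>r\<in>UNIV. ent (\<Gamma> k) i r * U r) * \<Upsilon> l + q * ent (\<Gamma> k) i l"
      by simp
    have VV: "ent (V k) i i = d (e k) (U i) + (\<Sum>r\<in>UNIV. ent (\<Gamma> k) i r * U r)"
      by (simp add: V_def entW ent_mult)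
    show ?thesis
      unfolding ent_simps 1 2 VV by (simp add: algebra_simps)
  qed
  have codazzi: "ent (D (e k) P + \<Gamma> k * P) i l = ent (D (e l) P + \<Gamma> l * P) i k" for i k l
  proof -
    have "ent (D (e k) (V l) + \<Gamma> k * V l) i i - ent (D (e l) (V k) + \<Gamma> l * V k) i i =
      ent P i k * \<Upsilon> l - ent P i l * \<Upsilon> k - ent 1 i l * (\<rho> k - q * \<Upsilon> k) + ent 1 i k * (\<rho> l - q * \<Upsilon> l)"
      unfolding RW[symmetric] comm[symmetric] by simp
    then show ?thesis
      unfolding entDP entP using closed[of k l] sym\<Gamma>[of k i l] by (simp add: algebra_simps)
  qed
  have const: "D m P = 0" if DG0: "D m G = 0" and d\<Upsilon>: "\<And>i. d m (\<Upsilon> i) = 0" for m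
  proof -
    have DGi: "D m Gi = 0"
      using D_inverse[OF G(2,3), of m] DG0 by simp
    have DW: "D m W = 0"
    proof -
      have "D m Y = 0" by (rule sqmat_eqI) (simp add: entY d\<Upsilon>)
      then show ?thesis unfolding W_def D_simps DGi by simp
    qed
    have D\<Gamma>: "D m (\<Gamma> k) = 0" for k
    proof -
      have dG0: "d m (ent G i j) = 0" for i j
        using arg_cong[OF DG0, of "\<lambda>M. ent M i j"] by simp
      have "D m (koszul (\<lambda>i. d (e i)) G k) = 0"
        by (rule sqmat_eqI) (simp add: koszul_def d_add d_diff d_commute[of m "e _"] dG0)
      then have e: "G * D m (\<Gamma> k) + G * D m (\<Gamma> k) = 0"
        unfolding levi_civita_koszul[OF lc, symmetric] D_simps DG0 by (simp only: mult_zero_left add_0_left)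
      have "ent (G * D m (\<Gamma> k)) i j = 0" for i j
        by (rule double_eq_0) (use arg_cong[OF e, of "\<lambda>M. ent M i j"] in \<open>simp only: ent_simps\<close>)
      then have "G * D m (\<Gamma> k) = 0"
        by (intro sqmat_eqI) (simp only: ent_simps)
      then have "Gi * (G * D m (\<Gamma> k)) = 0" by simp
      then show ?thesis by (simp add: mult.assoc[symmetric] G)
    qed
    have DV: "D m (V k) = 0" for k
      unfolding V_def D_simps D_commute[of m "e k"] DW D\<Gamma> by (rule sqmat_eqI) simp
    have dV: "d m (ent (V k) i j) = 0" for i j k
      using arg_cong[OF DV[of k], of "\<lambda>M. ent M i j"] by simp
    have dU: "d m (U i) = 0" for i
      using arg_cong[OF DW, of "\<lambda>M. ent M i i"] by (simp add: entW)
    have "d m q = 0"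
      by (simp add: q_def d_mult d_sum dU d\<Upsilon> d_half[OF h])
    then show ?thesis
      by (intro sqmat_eqI) (simp add: entP d_add d_diff d_mult dV dU d\<Upsilon> ent_one)
  qed
  show ?thesis
    by (rule that[OF P_sym R codazzi const])
qed

section \<open>The Einstein equation in normal form\<close>

lemma sum_UNIV_option:
  fixes f :: "'n::finite option \<Rightarrow> 'r::comm_monoid_add"
  shows "(\<Sum>I\<in>UNIV. f I) = f None + (\<Sum>i\<in>UNIV. f (Some i))"
  by (simp add: UNIV_option_conv sum.reindex)

definition block :: "'r \<Rightarrow> ('n \<Rightarrow> 'r) \<Rightarrow> ('n \<Rightarrow> 'r) \<Rightarrow> ('r, 'n) sqmat \<Rightarrow> ('r, 'n option) sqmat" where
  "block a u w M = Mat (\<lambda>I J. case I of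
     None \<Rightarrow> (case J of None \<Rightarrow> a | Some j \<Rightarrow> u j)
   | Some i \<Rightarrow> (case J of None \<Rightarrow> w i | Some j \<Rightarrow> ent M i j))"

lemma ent_block [simp]:
  "ent (block a u w M) None None = a"
  "ent (block a u w M) None (Some j) = u j"
  "ent (block a u w M) (Some i) None = w i"
  "ent (block a u w M) (Some i) (Some j) = ent M i j"
  by (simp_all add: block_def)

lemma sqmat_option_eqI:
  assumes "ent A None None = ent B None None" "\<And>j. ent A None (Some j) = ent B None (Some j)"
    "\<And>i. ent A (Some i) None = ent B (Some i) None" "\<And>i j. ent A (Some i) (Some j) = ent B (Some i) (Some j)"
  shows "A = B"
proof (rule sqmat_eqI)
  fix I J show "ent A I J = ent B I J"
    using assms by (cases I; cases J) auto
qed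

text \<open>The metric \<open>x\<^sup>-\<^sup>2(dx\<^sup>2 + H)\<close>, with \<open>y\<close> the reciprocal of \<open>x\<close>, and its Levi-Civita connection.
  The matrix \<open>N\<close> is the rescaled second fundamental form of the slices.\<close>

definition cone_metric :: "'r::comm_ring_1 \<Rightarrow> ('r, 'n) sqmat \<Rightarrow> ('r, 'n option) sqmat" where
  "cone_metric y H = block (y * y) (\<lambda>_. 0) (\<lambda>_. 0) (smul (y * y) H)"

definition cone_connection ::
  "'r::comm_ring_1 \<Rightarrow> ('r, 'n::finite) sqmat \<Rightarrow> ('r, 'n) sqmat \<Rightarrow> ('n \<Rightarrow> ('r, 'n) sqmat) \<Rightarrow>
    'n option \<Rightarrow> ('r, 'n option) sqmat" where
  "cone_connection y N S \<Gamma> I = (case I of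
     None \<Rightarrow> block (- y) (\<lambda>_. 0) (\<lambda>_. 0) (- S)
   | Some i \<Rightarrow> block 0 (\<lambda>j. ent N i j) (\<lambda>k. - ent S k i) (\<Gamma> i))"

lemma (in diff_ring) d_reciprocal:
  assumes "x * y = 1" shows "d i y = - (y * y) * d i x"
proof -
  have "d i x * y + x * d i y = 0"
    using arg_cong[OF assms, of "d i"] by (simp add: d_mult)
  then have "y * (d i x * y + x * d i y) = 0" by simp
  then have "y * y * d i x + (x * y) * d i y = 0"
    by (simp add: algebra_simps)
  then show ?thesis
    by (simp add: assms eq_neg_iff_add_eq_0 add.commute)
qed

lemma cone_levi_civita:
  fixes d :: "'n::finite option \<Rightarrow> 'r::comm_ring_1 \<Rightarrow> 'r"
  assumes ring: "diff_ring d"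
    and x: "d None x = 1" "\<And>i. d (Some i) x = 0" "x * y = 1"
    and h: "h + h = 1"
    and H: "flip H = H" "H * Hi = 1"
    and lc: "levi_civita_connection (\<lambda>i. d (Some i)) H \<Gamma>"
    and N: "N = smul y H - smul h (map_mat (d None) H)"
  shows "levi_civita_connection d (cone_metric y H) (cone_connection y N (Hi * N) \<Gamma>)"
proof -
  interpret diff_ring d by (fact ring)
  have symH: "ent H i j = ent H j i" for i j
    using arg_cong[OF H(1), of "\<lambda>M. ent M j i"] by simp
  have symN: "ent N i j = ent N j i" for i j
    by (simp add: N symH)
  have sym\<Gamma>: "ent (\<Gamma> i) k j = ent (\<Gamma> j) k i" for i j k
    using lc by (simp add: levi_civita_connection_def)
  have dy: "d None y = - (y * y)" "d (Some i) y = 0" for i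
    using d_reciprocal[OF x(3)] x by simp_all
  have HN: "(\<Sum>k\<in>UNIV. ent H i k * ent (Hi * N) k j) = ent N i j" for i j
    unfolding ent_mult[symmetric] by (simp add: mult.assoc[symmetric] H)
  have HN': "(\<Sum>k\<in>UNIV. y * (y * (ent H i k * ent (Hi * N) k j))) = y * (y * ent N i j)" for i j
    unfolding HN[symmetric] by (simp add: sum_distrib_left)
  have D\<Gamma>: "d (Some i) (ent H k j) = (\<Sum>r\<in>UNIV. ent H k r * ent (\<Gamma> i) r j) + (\<Sum>r\<in>UNIV. ent H j r * ent (\<Gamma> i) r k)" for i k j
  proof -
    have "map_mat (d (Some i)) H = H * \<Gamma> i + flip (H * \<Gamma> i)"
      using lc by (simp add: levi_civita_connection_def)
    from arg_cong[OF this, of "\<lambda>M. ent M k j"] show ?thesis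
      by (simp add: ent_mult)
  qed
  have N2: "ent N i j + ent N i j = y * ent H i j + y * ent H i j - d None (ent H i j)" for i j
  proof -
    have "ent N i j + ent N i j = y * ent H i j + y * ent H i j - (h + h) * d None (ent H i j)"
      by (simp add: N algebra_simps)
    then show ?thesis by (simp add: h)
  qed
  show ?thesis
    unfolding levi_civita_connection_def
  proof (intro conjI allI)
    fix I J K :: "'n option"
    show "ent (cone_connection y N (Hi * N) \<Gamma> I) K J = ent (cone_connection y N (Hi * N) \<Gamma> J) K I"
      by (cases I; cases J; cases K) (simp_all add: cone_connection_def symN sym\<Gamma>)
    show "map_mat (d I) (cone_metric y H) = cone_metric y H * cone_connection y N (Hi * N) \<Gamma> I
      + flip (cone_metric y H * cone_connection y N (Hi * N) \<Gamma> I)"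
    proof (cases I)
      case None
      have "d None (y * y * ent H i j) = - (y * (y * (ent N i j + ent N j i)))" for i j
        unfolding symN[of j] N2 by (simp add: d_mult dy algebra_simps)
      then show ?thesis
        by (intro sqmat_option_eqI)
          (simp_all add: None cone_metric_def cone_connection_def ent_mult[where A = "block a u w M" for a u w M] sum_UNIV_option d_mult dy
             HN' mult.assoc sum_negf algebra_simps)
    next
      case (Some m)
      show ?thesis
        by (intro sqmat_option_eqI)
          (simp_all add: Some cone_metric_def cone_connection_def ent_mult[where A = "block a u w M" for a u w M] sum_UNIV_option d_mult dy
             HN' mult.assoc sum_negf symN D\<Gamma> sum_distrib_left distrib_left)
    qed
  qed
qed

lemma cone_ricci:
  fixes d :: "'n::finite option \<Rightarrow> 'r::comm_ring_1 \<Rightarrow> 'r"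
  assumes "diff_ring d" "flip N = N"
  shows "ent (ricci_mat d (cone_connection y N S \<Gamma>)) (Some j) (Some l) =
      ent (ricci_mat (\<lambda>i. d (Some i)) \<Gamma>) j l
      + ent (map_mat (d None) N - smul y N - smul (tr S) N + N * S + flip (N * S)) l j"
    and "ent (ricci_mat d (cone_connection y N S \<Gamma>)) None None = d None (tr S) + y * tr S - tr (S * S)"
proof -
  interpret diff_ring d by (fact assms(1))
  have symN: "ent N i j = ent N j i" for i j
    using arg_cong[OF assms(2), of "\<lambda>M. ent M j i"] by simp
  show "ent (ricci_mat d (cone_connection y N S \<Gamma>)) (Some j) (Some l) =
      ent (ricci_mat (\<lambda>i. d (Some i)) \<Gamma>) j l
      + ent (map_mat (d None) N - smul y N - smul (tr S) N + N * S + flip (N * S)) l j"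
    by (simp add: ricci_mat_def curvature_def cone_connection_def sum_UNIV_option ent_mult tr_def
        sum.distrib sum_subtractf sum_negf sum_distrib_left sum_distrib_right symN algebra_simps)
  show "ent (ricci_mat d (cone_connection y N S \<Gamma>)) None None = d None (tr S) + y * tr S - tr (S * S)"
    by (simp add: ricci_mat_def curvature_def cone_connection_def sum_UNIV_option ent_mult tr_def d_sum d_uminus
        sum.distrib sum_subtractf sum_negf sum_distrib_left sum_distrib_right algebra_simps)
qed

text \<open>The slice and the normal component of \<open>4x(Ric + n g\<^sub>+)\<close>, in terms of \<open>H\<close>, its first two
  derivatives \<open>H1\<close> and \<open>H2\<close> along \<open>x\<close>, its inverse and its Ricci tensor. The factor removes
  all denominators, so that these expressions make sense up to \<open>x = 0\<close>.\<close>

definition slice_equation ::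
  "'r::comm_ring_1 \<Rightarrow> ('r, 'n::finite) sqmat \<Rightarrow> ('r, 'n) sqmat \<Rightarrow> ('r, 'n) sqmat \<Rightarrow> ('r, 'n) sqmat \<Rightarrow>
    ('r, 'n) sqmat \<Rightarrow> ('r, 'n) sqmat" where
  "slice_equation x H H1 H2 Hi R =
     smul (2 * x) (H1 * Hi * H1 - H2) + smul (2 * (of_nat CARD('n) - 1) - x * tr (Hi * H1)) H1
     + smul (2 * tr (Hi * H1)) H + smul (4 * x) R"

definition normal_equation ::
  "'r::comm_ring_1 \<Rightarrow> ('r, 'n::finite) sqmat \<Rightarrow> ('r, 'n) sqmat \<Rightarrow> ('r, 'n) sqmat \<Rightarrow> 'r" where
  "normal_equation x H1 H2 Hi = x * (tr (Hi * H1 * Hi * H1) - 2 * tr (Hi * H2)) + 2 * tr (Hi * H1)"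

lemma cone_einstein:
  fixes d :: "'n::finite option \<Rightarrow> 'r::comm_ring_1 \<Rightarrow> 'r" and H Hi :: "('r, 'n) sqmat"
  assumes ring: "diff_ring d"
    and x: "d None x = 1" "x * y = 1"
    and h: "h + h = 1"
    and H: "flip H = H" "H * Hi = 1" "Hi * H = 1"
    and N: "N = smul y H - smul h (map_mat (d None) H)"
    and H1: "H1 = map_mat (d None) H" and H2: "H2 = map_mat (d None) H1"
    and Ric: "Ric = ricci_mat d (cone_connection y N (Hi * N) \<Gamma>)"
      "R = ricci_mat (\<lambda>i. d (Some i)) \<Gamma>"
  shows "4 * x * (ent Ric (Some j) (Some l) + of_nat CARD('n) * (y * y * ent H j l)) =
      ent (slice_equation x H H1 H2 Hi R) j l"
    and "4 * x * (ent Ric None None + of_nat CARD('n) * (y * y)) = normal_equation x H1 H2 Hi"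
proof -
  interpret diff_ring d by (fact ring)
  have Hm: "H * (Hi * M) = M" "Hi * (H * M) = M" for M
    by (simp_all add: mult.assoc[symmetric] H)
  define a where "a = smul h H1"
  define b where "b = smul h H2"
  have H1a: "H1 = a + a"
    by (rule sqmat_eqI) (simp add: a_def distrib_right[symmetric] h)
  have H2b: "H2 = b + b"
    by (rule sqmat_eqI) (simp add: b_def distrib_right[symmetric] h)
  have Da: "D None a = b"
    by (simp add: a_def b_def H2 D_simps d_half[OF h]) (rule sqmat_eqI, simp)
  have flip_a: "flip a = a"
    unfolding a_def flip_simps H1 using D_simps(6)[of None H] by (simp add: H(1))
  have Na: "N = smul y H - a" by (simp add: N a_def H1)
  have flipN: "flip N = N" by (simp add: Na flip_simps flip_a H)
  have dy: "d None y = - (y * y)"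
    using d_reciprocal[OF x(2)] x(1) by simp
  have DN: "D None N = smul (- (y * y)) H + smul y (a + a) - b"
    by (simp add: Na D_simps dy Da H1[symmetric] H1a)
  define s where "s = tr (Hi * a)"
  have S: "Hi * N = smul y 1 - Hi * a"
    by (simp add: Na right_diff_distrib smul_mult H)
  have trS: "tr (Hi * N) = of_nat CARD('n) * y - s"
    by (simp add: S tr_simps tr_one s_def mult.commute)
  have NHN: "N * (Hi * N) = smul (y * y) H - smul y (a + a) + a * Hi * a"
    unfolding S unfolding Na
    by (rule sqmat_eqI) (simp add: algebra_simps smul_mult smul_smul Hm mult.assoc)
  have flipHi: "flip Hi = Hi"
  proof -
    have "flip (Hi * H) = 1" unfolding H(3) flip_simps ..
    then have "H * flip Hi = 1" unfolding flip_simps H(1) .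
    then have "Hi * (H * flip Hi) = Hi" by simp
    then show ?thesis by (simp add: Hm)
  qed
  have flipNHN: "flip (N * (Hi * N)) = N * (Hi * N)"
    by (simp add: flip_simps flipN flipHi mult.assoc)
  have four_xy: "4 * x * (y * c) = 4 * c" for c
  proof -
    have "4 * x * (y * c) = 4 * (x * y) * c" by (simp only: mult.assoc)
    then show ?thesis by (simp add: x(2))
  qed
  have flipDN: "flip (D None N) = D None N"
    using D_simps(6)[of None N] by (simp add: flipN)
  define Z where "Z = D None N - smul y N - smul (tr (Hi * N)) N + N * (Hi * N) + flip (N * (Hi * N))"
  have "flip Z = Z"
    unfolding Z_def flipNHN by (simp add: flip_simps(1,2,4) flipDN flipN flipNHN)
  from arg_cong[OF this, of "\<lambda>M. ent M j l"] have symZ: "ent Z l j = ent Z j l" by simp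
  have "ent (slice_equation x H H1 H2 Hi R) j l =
      4 * x * (y * ((of_nat CARD('n) - 1) * ent a j l + s * ent H j l))
      + 4 * x * (ent R j l - ent b j l - s * ent a j l + 2 * ent (a * Hi * a) j l)"
    unfolding four_xy
    by (simp add: slice_equation_def H1a H2b s_def[symmetric] tr_simps distrib_left distrib_right mult.assoc algebra_simps)
  also have "\<dots> = 4 * x * (ent R j l + ent Z j l + of_nat CARD('n) * (y * y * ent H j l))"
    unfolding Z_def flipNHN unfolding DN NHN trS unfolding Na by (simp add: algebra_simps)
  also have "\<dots> = 4 * x * (ent Ric (Some j) (Some l) + of_nat CARD('n) * (y * y * ent H j l))"
    unfolding Ric(1) cone_ricci(1)[OF ring flipN] Ric(2)[symmetric] Z_def[symmetric] symZ ..
  finally show "4 * x * (ent Ric (Some j) (Some l) + of_nat CARD('n) * (y * y * ent H j l)) =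
      ent (slice_equation x H H1 H2 Hi R) j l" ..
  have DHi: "D None Hi = - (Hi * (a + a) * Hi)"
    using D_inverse[OF H(2,3)] by (simp add: H1[symmetric] H1a)
  have ds: "d None s = tr (Hi * b) - (tr (Hi * a * Hi * a) + tr (Hi * a * Hi * a))"
    by (simp add: s_def d_tr D_simps DHi Da algebra_simps tr_simps)
  have SS: "tr (Hi * N * (Hi * N)) = of_nat CARD('n) * (y * y) - y * (s + s) + tr (Hi * a * Hi * a)"
    unfolding S by (simp add: algebra_simps smul_mult smul_smul tr_simps tr_one s_def mult.assoc)
  have "normal_equation x H1 H2 Hi = 4 * x * (y * s) + 4 * x * (tr (Hi * a * Hi * a) - tr (Hi * b))"
    unfolding four_xy by (simp add: normal_equation_def H1a H2b s_def tr_simps algebra_simps)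
  also have "\<dots> = 4 * x * (d None (tr (Hi * N)) + y * tr (Hi * N) - tr (Hi * N * (Hi * N)) + of_nat CARD('n) * (y * y))"
  proof -
    have dn: "d None (of_nat m) = 0" for m :: nat
      by (induction m) (simp_all add: d_add)
    show ?thesis
      unfolding SS trS by (simp add: d_diff d_mult dn dy ds algebra_simps)
  qed
  finally show "4 * x * (ent Ric None None + of_nat CARD('n) * (y * y)) = normal_equation x H1 H2 Hi"
    unfolding Ric(1) cone_ricci(2)[OF ring flipN] by simp
qed

lemma commute_inverse:
  fixes A :: "'b::ring_1"
  assumes "A * P = P * A" "A * Ai = 1" "Ai * A = 1"
  shows "Ai * P = P * Ai"
proof -
  have "Ai * P = Ai * (P * A) * Ai"
    by (simp add: mult.assoc assms(2))
  also have "\<dots> = Ai * A * (P * Ai)"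
    by (simp only: assms(1)[symmetric] mult.assoc)
  finally show ?thesis by (simp add: assms(3))
qed

lemma ent_mult_outer_mult:
  "ent (B * outer u w * A) i j = (\<Sum>r\<in>UNIV. ent B i r * u r) * (\<Sum>r\<in>UNIV. ent A r j * w r)"
  unfolding ent_mult[of "B * outer u w"] ent_mult_outer sum_distrib_left
  by (simp add: mult.assoc mult.commute[of "w _"])

text \<open>For a metric as above, \<open>G(1 - x\<^sup>2P/2)\<^sup>2\<close> is an exact solution. Its Ricci tensor can be computed
  because \<open>A = 1 - x\<^sup>2P/2\<close> satisfies the Codazzi equation as well, so that \<open>A\<close> carries the
  Levi-Civita connection of \<open>G\<close> to that of the new metric.\<close>

lemma (in diff_ring) model_ricci:
  fixes e :: "'n::finite \<Rightarrow> 'k" and G P A Ai :: "('r, 'n) sqmat"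
  assumes G: "flip G = G" "flip (G * P) = G * P"
    and curv: "\<And>k l a b. ent (curvature (\<lambda>i. d (e i)) \<Gamma> k l) a b =
      ent P a k * ent G b l - ent P a l * ent G b k - ent 1 a l * ent (G * P) b k + ent 1 a k * ent (G * P) b l"
    and A: "A * Ai = 1" "Ai * A = 1" "flip A * G = G * A" "A * P = P * A"
  shows "ricci_mat (\<lambda>i. d (e i)) (\<lambda>i. Ai * (D (e i) A + \<Gamma> i * A)) =
    smul (tr (Ai * P)) (G * A) - G * P - G * P + smul (tr Ai) (G * A * P)"
proof -
  have contract: "(\<Sum>i\<in>UNIV. ent (Ai * Mat (\<lambda>a b. ent X a i * ent Z b l) * A) i j) = tr (Ai * X) * ent (flip A * Z) j l"
    for X Z :: "('r, 'n) sqmat" and j l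
  proof -
    have "ent (Ai * Mat (\<lambda>a b. ent X a i * ent Z b l) * A) i j = ent (Ai * X) i i * ent (flip A * Z) j l" for i
    proof -
      have "Mat (\<lambda>a b. ent X a i * ent Z b l) = outer (\<lambda>a. ent X a i) (\<lambda>b. ent Z b l)"
        by (rule sqmat_eqI) simp
      then show ?thesis
        by (simp only: ent_mult_outer_mult ent_mult[of "flip A"] ent_mult[of Ai X] ent_flip mult.commute)
    qed
    then show ?thesis by (simp add: tr_def sum_distrib_right)
  qed
  have contract': "(\<Sum>i\<in>UNIV. ent (Ai * Mat (\<lambda>a b. ent X a l * ent Z b i) * A) i j) = ent (flip A * Z * (Ai * X)) j l"
    for X Z :: "('r, 'n) sqmat" and j l
  proof -
    have "ent (Ai * Mat (\<lambda>a b. ent X a l * ent Z b i) * A) i j = ent (flip A * Z) j i * ent (Ai * X) i l" for i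
    proof -
      have "Mat (\<lambda>a b. ent X a l * ent Z b i) = outer (\<lambda>a. ent X a l) (\<lambda>b. ent Z b i)"
        by (rule sqmat_eqI) simp
      then show ?thesis
        by (simp only: ent_mult_outer_mult ent_mult[of "flip A"] ent_mult[of Ai X] ent_flip mult.commute)
    qed
    then show ?thesis by (simp add: ent_mult[of "flip A * Z"])
  qed
  have curvM: "curvature (\<lambda>i. d (e i)) \<Gamma> k l = Mat (\<lambda>a b. ent P a k * ent G b l) - Mat (\<lambda>a b. ent P a l * ent G b k)
     - Mat (\<lambda>a b. ent 1 a l * ent (G * P) b k) + Mat (\<lambda>a b. ent 1 a k * ent (G * P) b l)" for k l
    by (rule sqmat_eqI) (simp add: curv)
  have com: "Ai * P = P * Ai"
    by (rule commute_inverse[OF A(4,1,2)])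
  have "flip A * G * (Ai * P) = G * (A * Ai) * P"
    by (simp only: A(3) mult.assoc)
  moreover have FGP: "flip A * (G * P) = G * A * P"
    by (simp only: A(3) mult.assoc[symmetric])
  moreover have "flip A * (G * P) * Ai = G * P * (A * Ai)"
    unfolding FGP by (simp only: A(4) mult.assoc)
  ultimately have "flip A * G * (Ai * P) = G * P" "flip A * (G * P) = G * A * P" "flip A * (G * P) * Ai = G * P"
    by (simp_all only: A(1) mult_1_right)
  then show ?thesis
    unfolding ricci_mat_def curvature_gauge[OF A(1,2)] curvM
    by (intro sqmat_eqI)
      (simp add: distrib_left distrib_right right_diff_distrib left_diff_distrib
        sum.distrib sum_subtractf contract contract' A(3))
qed

text \<open>With the Ricci tensor of the model known, its Einstein equation is an identity between rational
  functions of the single matrix \<open>P\<close>. The element \<open>y\<close> stands for \<open>x\<^sup>2/2\<close>.\<close>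

lemma (in diff_ring) model_einstein:
  fixes G Gi P A Ai :: "('r, 'n::finite) sqmat"
  assumes x: "d m x = 1" "d m y = x" "y + y = x * x"
    and const: "D m G = 0" "D m P = 0"
    and G: "G * Gi = 1" "Gi * G = 1"
    and A: "A = 1 - smul y P" "A * Ai = 1" "Ai * A = 1"
    and R: "R = smul (tr (Ai * P)) (G * A) - G * P - G * P + smul (tr Ai) (G * A * P)"
    and K: "K = G * A * A" "Ki = Ai * Ai * Gi" "K1 = D m K" "K2 = D m K1"
  shows "slice_equation x K K1 K2 Ki R = 0" "normal_equation x K1 K2 Ki = 0"
proof -
  have com: "A * P = P * A"
    by (simp add: A(1) left_diff_distrib right_diff_distrib smul_mult)
  have comM: "P * (A * M) = A * (P * M)" for M
    by (simp only: mult.assoc[symmetric] com)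
  have comi: "Ai * P = P * Ai"
    by (rule commute_inverse[OF com A(2,3)])
  have comiM: "Ai * (P * M) = P * (Ai * M)" for M
    by (simp only: mult.assoc[symmetric] comi)
  have AM: "A * (Ai * M) = M" "Ai * (A * M) = M" "G * (Gi * M) = M" "Gi * (G * M) = M" for M
    by (simp_all add: mult.assoc[symmetric] A(2,3) G)
  have DA: "D m A = - smul x P"
    unfolding A(1) D_simps const x by (rule sqmat_eqI) simp
  have K1: "K1 = - smul (2 * x) (G * A * P)"
    unfolding K D_simps DA const
    by (rule sqmat_eqI) (simp add: algebra_simps smul_mult mult.assoc com[symmetric] comM)
  have d2: "d m (2 * x) = 2" 
    by (simp only: mult_2 d_add x) simp
  have K2: "K2 = - smul 2 (G * A * P) + smul (2 * x * x) (G * P * P)"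
    unfolding K(4) K1 D_simps DA const d2
    by (rule sqmat_eqI) (simp add: algebra_simps smul_mult smul_smul mult.assoc)
  define \<tau> where "\<tau> = tr (Ai * P)"
  have KK1: "Ki * K1 = - smul (2 * x) (Ai * P)"
    unfolding K(2) K1 by (simp add: smul_mult mult.assoc AM)
  have KK2: "Ki * K2 = - smul 2 (Ai * P) + smul (2 * x * x) (Ai * Ai * P * P)"
    unfolding K(2) K2 by (simp add: smul_mult mult.assoc AM distrib_left right_diff_distrib)
  have trK: "tr (Ki * K1) = - (2 * x * \<tau>)"
    by (simp add: KK1 tr_simps \<tau>_def)
  have K1KK1: "K1 * Ki * K1 = smul (4 * x * x) (G * P * P)"
  proof -
    have "K1 * (Ki * K1) = smul (4 * x * x) (G * (A * (P * (Ai * P))))"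
      unfolding KK1 unfolding K1 by (rule sqmat_eqI) (simp add: smul_mult mult.assoc algebra_simps)
    also have "A * (P * (Ai * P)) = P * P"
      by (simp add: comiM[symmetric] AM)
    finally show ?thesis by (simp add: mult.assoc)
  qed
  have Aiy: "Ai = 1 + smul y (Ai * P)"
    using A(3) unfolding A(1) by (simp add: right_diff_distrib smul_mult algebra_simps)
  have trAi: "tr Ai = of_nat CARD('n) + y * \<tau>"
    using arg_cong[OF Aiy, of tr] by (simp add: tr_simps tr_one \<tau>_def)
  have GAA: "G * A * A = G * A - smul y (G * A * P)"
    by (subst (2) A(1)) (simp add: right_diff_distrib smul_mult)
  have GAP: "G * A * P = G * P - smul y (G * P * P)"
    by (simp add: A(1) right_diff_distrib left_diff_distrib smul_mult mult.assoc)
  have xy: "x * x = 2 * y" using x(3) by (simp only: mult_2)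
  have xy': "x * (x * c) = 2 * y * c" for c
    by (simp add: mult.assoc[symmetric] xy)
  show "slice_equation x K K1 K2 Ki R = 0"
    unfolding slice_equation_def K1KK1 trK unfolding K(1) K1 K2 R trAi \<tau>_def[symmetric] GAA
    by (rule sqmat_eqI) (simp add: GAP[unfolded mult.assoc] algebra_simps xy xy')
  have sq: "Ki * K1 * Ki * K1 = smul (4 * x * x) (Ai * Ai * P * P)"
  proof -
    have "Ki * K1 * (Ki * K1) = smul (4 * x * x) (Ai * (P * (Ai * P)))"
      unfolding KK1 by (rule sqmat_eqI) (simp add: smul_mult mult.assoc algebra_simps)
    also have "Ai * (P * (Ai * P)) = Ai * Ai * P * P"
      by (simp add: comiM mult.assoc comi)
    finally show ?thesis by (simp add: mult.assoc)
  qed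
  show "normal_equation x K1 K2 Ki = 0"
    unfolding normal_equation_def sq KK2 trK by (simp add: tr_simps \<tau>_def[symmetric] algebra_simps)
qed

section \<open>Orders of vanishing and uniqueness of the expansion\<close>

text \<open>The coordinate \<open>x\<close> defines a hypersurface, and \<open>I\<close> is the ideal of functions that vanish on
  it. Derivatives along the hypersurface preserve \<open>I\<close>.\<close>

locale filtered_ring = diff_ring d for d :: "'n::finite option \<Rightarrow> 'r::comm_ring_1 \<Rightarrow> 'r" +
  fixes I :: "'r \<Rightarrow> bool" and x :: 'r
  assumes I_0: "I 0"
    and I_add: "I a \<Longrightarrow> I b \<Longrightarrow> I (a + b)"
    and I_mult: "I a \<Longrightarrow> I (b * a)"
    and I_d: "I a \<Longrightarrow> I (d (Some i) a)"
    and I_x: "I x" and d_x: "d None x = 1"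
    and nat_invertible: "k > 0 \<Longrightarrow> \<exists>r. r * of_nat k = (1 :: 'r)"
begin

primrec vanish :: "nat \<Rightarrow> 'r \<Rightarrow> bool" where
  "vanish 0 a \<longleftrightarrow> True"
| "vanish (Suc m) a \<longleftrightarrow> I a \<and> vanish m (d None a)"

lemma vanish_0 [simp]: "vanish m 0"
  by (induction m) (simp_all add: I_0)

lemma vanish_add: "vanish m a \<Longrightarrow> vanish m b \<Longrightarrow> vanish m (a + b)"
  by (induction m arbitrary: a b) (simp_all add: I_add d_add)

lemma vanish_Suc: "vanish (Suc m) a \<Longrightarrow> vanish m a"
proof (induction m arbitrary: a)
  case (Suc m)
  then have "I a" "vanish m (d None a)"
    using Suc.IH[of "d None a"] by auto
  then show ?case by simp
qed simp

lemma vanish_mono: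
  assumes "vanish m a" "k \<le> m" shows "vanish k a"
  using assms(2,1)
proof (induction rule: inc_induct)
  case (step n)
  then show ?case using vanish_Suc by blast
qed simp

lemma vanish_mult_left: "vanish m a \<Longrightarrow> vanish m (b * a)"
proof (induction m arbitrary: a b)
  case (Suc m)
  have "vanish m (d None b * a)" "vanish m (b * d None a)"
    using Suc.prems by (rule Suc.IH[OF vanish_Suc], intro Suc.IH) simp
  then show ?case
    using Suc.prems by (simp add: I_mult d_mult vanish_add)
qed simp

lemma vanish_mult_right: "vanish m a \<Longrightarrow> vanish m (a * b)"
  using vanish_mult_left[of m a b] by (simp add: mult.commute)

lemma vanish_uminus: "vanish m a \<Longrightarrow> vanish m (- a)"
  using vanish_mult_left[of m a "- 1"] by simp

lemma vanish_diff: "vanish m a \<Longrightarrow> vanish m b \<Longrightarrow> vanish m (a - b)"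
  using vanish_add[OF _ vanish_uminus, of m a b] by simp

lemma vanish_mult: "vanish j a \<Longrightarrow> vanish k b \<Longrightarrow> vanish (j + k) (a * b)"
proof (induction "j + k" arbitrary: j k a b)
  case (Suc m)
  show ?case
  proof (cases j; cases k)
    fix j' k' assume jk: "j = Suc j'" "k = Suc k'"
    have "vanish (j' + k) (d None a * b)" "vanish (j + k') (a * d None b)"
      using Suc.prems Suc.hyps(2) jk by (intro Suc.hyps(1); simp)+
    then have "vanish (j' + k) (d None (a * b))"
      unfolding d_mult using jk by (intro vanish_add) simp_all
    moreover have "I (a * b)"
      using Suc.prems(2) jk by (simp add: I_mult)
    ultimately show ?thesis
      by (simp add: jk(1))
  qed (use vanish_mult_left[OF Suc.prems(2)] vanish_mult_right[OF Suc.prems(1)] in simp_all)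
qed simp

lemma vanish_x: "vanish 1 x"
  by (simp add: I_x)

lemma vanish_x_mult:
  assumes "vanish (m - 1) a" shows "vanish m (x * a)"
  by (rule vanish_mono[OF vanish_mult[OF vanish_x assms]]) simp

lemma vanish_d: "vanish m a \<Longrightarrow> vanish m (d (Some i) a)"
proof (induction m arbitrary: a)
  case (Suc m)
  then have "I (d (Some i) a)" "vanish m (d (Some i) (d None a))"
    by (auto intro: I_d)
  then show ?case
    by (simp add: d_commute[of None "Some i"])
qed simp

lemma vanish_d_None: "vanish m a \<Longrightarrow> vanish (m - 1) (d None a)"
  by (cases m) simp_all

lemma vanish_sum: "(\<And>i. i \<in> S \<Longrightarrow> vanish m (f i)) \<Longrightarrow> vanish m (\<Sum>i\<in>S. f i)"
  by (induction S rule: infinite_finite_induct) (simp_all add: vanish_add)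

lemma vanish_divide:
  assumes "vanish m (of_nat k * a)" "k > 0" shows "vanish m a"
proof -
  obtain r where "r * of_nat k = (1 :: 'r)" using nat_invertible[OF assms(2)] ..
  then have "r * (of_nat k * a) = a" by (simp add: mult.assoc[symmetric])
  then show ?thesis using vanish_mult_left[OF assms(1), of r] by (simp only:)
qed

lemma d_of_nat [simp]: "d i (of_nat m) = 0"
  by (induction m) (simp_all add: d_add)

text \<open>The Euler operator acts on terms of order exactly \<open>k\<close> as multiplication by \<open>k\<close>.\<close>

lemma vanish_euler: "vanish k a \<Longrightarrow> vanish (Suc k) (x * d None a - of_nat k * a)"
proof (induction k arbitrary: a)
  case 0
  then show ?case using I_mult[OF I_x, of "d None a"] by (simp add: mult.commute)
next
  case (Suc k)
  have "I (x * d None a - of_nat (Suc k) * a)"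
    using I_add[OF I_mult[OF I_x, of "d None a"] I_mult[of a "- of_nat (Suc k)"]] Suc.prems
    by (simp add: mult.commute algebra_simps)
  moreover have "d None (x * d None a - of_nat (Suc k) * a) = x * d None (d None a) - of_nat k * d None a"
    by (simp add: d_diff d_mult d_x d_add algebra_simps)
  moreover have "vanish (Suc k) (x * d None (d None a) - of_nat k * d None a)"
    using Suc by simp
  ultimately show ?case
    by (simp only: vanish.simps(2)[of "Suc k"] simp_thms)
qed

definition vanish_mat :: "nat \<Rightarrow> ('r, 'm::finite) sqmat \<Rightarrow> bool" where
  "vanish_mat m A \<longleftrightarrow> (\<forall>i j. vanish m (ent A i j))"

lemma vanish_mat_add: "vanish_mat m A \<Longrightarrow> vanish_mat m B \<Longrightarrow> vanish_mat m (A + B)"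
  and vanish_mat_diff: "vanish_mat m A \<Longrightarrow> vanish_mat m B \<Longrightarrow> vanish_mat m (A - B)"
  and vanish_mat_uminus: "vanish_mat m A \<Longrightarrow> vanish_mat m (- A)"
  and vanish_mat_smul: "vanish_mat m A \<Longrightarrow> vanish_mat m (smul a A)"
  and vanish_mat_smul': "vanish m a \<Longrightarrow> vanish_mat m (smul a B)"
  and vanish_mat_x: "vanish_mat (m - 1) A \<Longrightarrow> vanish_mat m (smul x A)"
  and vanish_mat_smul_mult: "vanish j a \<Longrightarrow> vanish_mat k A \<Longrightarrow> vanish_mat (j + k) (smul a A)"
  by (simp_all add: vanish_mat_def vanish_add vanish_diff vanish_uminus vanish_mult_left vanish_mult_right
      vanish_x_mult vanish_mult)

lemma vanish_mat_mono: "vanish_mat m A \<Longrightarrow> k \<le> m \<Longrightarrow> vanish_mat k A"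
  unfolding vanish_mat_def using vanish_mono by blast

lemma vanish_mat_D_None: "vanish_mat m A \<Longrightarrow> vanish_mat (m - 1) (D None A)"
  unfolding vanish_mat_def ent_map_mat using vanish_d_None by blast

lemma vanish_mat_0 [simp]: "vanish_mat 0 A"
  by (simp add: vanish_mat_def)

lemma vanish_mat_mult: "vanish_mat j A \<Longrightarrow> vanish_mat k B \<Longrightarrow> vanish_mat (j + k) (A * B)"
  by (simp add: vanish_mat_def ent_mult vanish_sum vanish_mult)

lemma vanish_mat_mult_left: "vanish_mat m A \<Longrightarrow> vanish_mat m (B * A)"
  using vanish_mat_mult[of 0 B m A] by simp

lemma vanish_mat_mult_right: "vanish_mat m A \<Longrightarrow> vanish_mat m (A * B)"
  using vanish_mat_mult[of m A 0 B] by simp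

lemma vanish_tr: "vanish_mat m A \<Longrightarrow> vanish m (tr A)"
  by (simp add: vanish_mat_def tr_def vanish_sum)

abbreviation ricci_of :: "'r \<Rightarrow> ('r, 'n) sqmat \<Rightarrow> ('r, 'n) sqmat \<Rightarrow> ('r, 'n) sqmat" where
  "ricci_of h H Hi \<equiv> ricci_mat (\<lambda>i. d (Some i)) (\<lambda>i. smul h (Hi * koszul (\<lambda>i. d (Some i)) H i))"

definition congruent_mod :: "nat \<Rightarrow> 'r \<Rightarrow> 'r \<Rightarrow> bool" where
  "congruent_mod m a b \<longleftrightarrow> vanish m (a - b)"

lemma congruent_mod_intros:
  "congruent_mod m a a"
  "congruent_mod m a b \<Longrightarrow> congruent_mod m a' b' \<Longrightarrow> congruent_mod m (a + a') (b + b')"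
  "congruent_mod m a b \<Longrightarrow> congruent_mod m a' b' \<Longrightarrow> congruent_mod m (a - a') (b - b')"
  "congruent_mod m a b \<Longrightarrow> congruent_mod m a' b' \<Longrightarrow> congruent_mod m (a * a') (b * b')"
  "congruent_mod m a b \<Longrightarrow> congruent_mod m (d (Some i) a) (d (Some i) b)"
proof -
  assume ab: "congruent_mod m a b"
  show "congruent_mod m (d (Some i) a) (d (Some i) b)"
    using vanish_d[of m "a - b" i] ab by (simp add: congruent_mod_def d_diff)
  assume ab': "congruent_mod m a' b'"
  have "a + a' - (b + b') = (a - b) + (a' - b')" "a - a' - (b - b') = (a - b) - (a' - b')"
    "a * a' - b * b' = (a - b) * a' + b * (a' - b')" by (simp_all add: algebra_simps)
  then show "congruent_mod m (a + a') (b + b')" "congruent_mod m (a - a') (b - b')" "congruent_mod m (a * a') (b * b')"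
    using ab ab' unfolding congruent_mod_def
    by (simp_all only: vanish_add vanish_diff vanish_mult_left vanish_mult_right)
qed (simp add: congruent_mod_def)

lemma congruent_mod_sum:
  "(\<And>i. congruent_mod m (f i) (g i)) \<Longrightarrow> congruent_mod m (\<Sum>i\<in>S. f i) (\<Sum>i\<in>S. g i)"
  unfolding congruent_mod_def sum_subtractf[symmetric] by (rule vanish_sum)

lemma vanish_ricci:
  assumes "vanish_mat m (H - K)" "vanish_mat m (Hi - Ki)"
  shows "vanish_mat m (ricci_of h H Hi - ricci_of h K Ki)"
proof -
  have H: "congruent_mod m (ent H i j) (ent K i j)" and Hi: "congruent_mod m (ent Hi i j) (ent Ki i j)" for i j
    using assms by (simp_all add: vanish_mat_def congruent_mod_def)
  have "congruent_mod m (ent (smul h (Hi * koszul (\<lambda>i. d (Some i)) H i)) k j)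
      (ent (smul h (Ki * koszul (\<lambda>i. d (Some i)) K i)) k j)" for i j k
    unfolding ent_smul ent_mult koszul_def ent_Mat
    by (intro congruent_mod_intros congruent_mod_sum H Hi)
  then have "congruent_mod m (ent (ricci_of h H Hi) i j) (ent (ricci_of h K Ki) i j)" for i j
    unfolding ricci_mat_def curvature_def ent_Mat ent_simps ent_map_mat ent_mult[of "smul _ _" "smul _ _"]
    by (intro congruent_mod_intros congruent_mod_sum)
  then show ?thesis
    by (simp add: vanish_mat_def congruent_mod_def)
qed

context
  fixes G Gi H Hi K Ki :: "('r, 'n) sqmat" and h :: 'r
  assumes G: "G * Gi = 1" "Gi * G = 1" "D None G = 0"
    and H: "H * Hi = 1" "Hi * H = 1" and K: "K * Ki = 1" "Ki * K = 1"
    and initial: "vanish_mat 1 (H - G)" "vanish_mat 1 (K - G)"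
begin

abbreviation (input) "H1 \<equiv> D None H"
abbreviation (input) "H2 \<equiv> D None (D None H)"
abbreviation (input) "K1 \<equiv> D None K"
abbreviation (input) "K2 \<equiv> D None (D None K)"
abbreviation (input) "E \<equiv> H - K"
abbreviation (input) "E1 \<equiv> D None (H - K)"

lemma inverse_diff:
  assumes "A * Ai = 1" "Ai * A = 1" "B * Bi = 1" "Bi * B = (1 :: ('r, 'n) sqmat)"
  shows "Ai - Bi = - (Ai * (A - B) * Bi)"
  using assms by (simp add: algebra_simps)

lemma inverse_close:
  shows "vanish_mat m E \<Longrightarrow> vanish_mat m (Hi - Ki)" "vanish_mat 1 (Ki - Gi)" "vanish_mat 1 (Hi - Gi)"
  unfolding inverse_diff[OF H K] inverse_diff[OF K G(1,2)] inverse_diff[OF H G(1,2)]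
  by (intro vanish_mat_uminus vanish_mat_mult_left vanish_mat_mult_right initial; assumption)+

lemma DE: "E1 = H1 - K1" "D None E1 = H2 - K2"
  by (simp_all add: D_simps)

context
  fixes m :: nat
  assumes m: "m \<ge> 1" and E: "vanish_mat m E"
begin

lemma E1: "vanish_mat (m - 1) E1"
  using vanish_mat_D_None[OF E] .

lemma trace_close: "vanish m (tr (Hi * H1) - tr (Ki * K1) - tr (Gi * E1))"
proof -
  have "tr (Hi * H1) - tr (Ki * K1) - tr (Gi * E1) = tr ((Hi - Ki) * H1) + tr ((Ki - Gi) * E1)"
    by (simp add: DE(1) algebra_simps tr_simps)
  moreover have "vanish_mat m ((Ki - Gi) * E1)"
    using vanish_mat_mult[OF inverse_close(2) E1] m by simp
  ultimately show ?thesis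
    by (auto intro!: vanish_add vanish_tr vanish_mat_mult_right inverse_close E)
qed

lemma Hi_x: "vanish_mat (m - 1) (Hi - Ki)"
  by (rule vanish_mat_mono[OF inverse_close(1)[OF E]]) simp

lemma E2: "vanish_mat m (smul x (H2 - K2) - smul (of_nat (m - 1)) E1)"
  unfolding DE(2)[symmetric] using E1 vanish_euler[of "m - 1"] m by (simp add: vanish_mat_def)

text \<open>The Ricci tensors of the slices do not contribute, since derivatives along the hypersurface
  preserve the order of vanishing. The second derivative is
  eliminated by the Euler operator: \<open>x (H2 - K2)\<close> agrees with \<open>(m - 1) E1\<close> to order \<open>m\<close>.\<close>

lemma slice_linearised:
  "vanish_mat m (slice_equation x H H1 H2 Hi (ricci_of h H Hi) - slice_equation x K K1 K2 Ki (ricci_of h K Ki)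
     - (smul (2 * (of_nat CARD('n) - of_nat m)) E1 + smul (2 * tr (Gi * E1)) G))"
proof -
  define tH where "tH = tr (Hi * H1)"
  define tK where "tK = tr (Ki * K1)"
  define tE where "tE = tr (Gi * E1)"
  define RH where "RH = ricci_of h H Hi"
  define RK where "RK = ricci_of h K Ki"
  have of_m: "of_nat (m - 1) = (of_nat m :: 'r) - 1"
    using m by (simp add: of_nat_diff)
  have eq: "slice_equation x H H1 H2 Hi RH - slice_equation x K K1 K2 Ki RK
     - (smul (2 * (of_nat CARD('n) - of_nat m)) E1 + smul (2 * tE) G) =
     smul 2 (smul x (E1 * Hi * H1 + K1 * (Hi - Ki) * H1 + K1 * Ki * E1))
     - smul 2 (smul x (H2 - K2) - smul (of_nat (m - 1)) E1)
     - smul x (smul tH E1 + smul (tH - tK) K1)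
     + smul 2 (smul tH E + smul (tH - tK - tE) K + smul tE (K - G))
     + smul 4 (smul x (RH - RK))"
    unfolding slice_equation_def tH_def[symmetric] tK_def[symmetric] of_m DE(1)
    by (rule sqmat_eqI) (simp add: algebra_simps)
  have 1: "vanish_mat m (smul x (E1 * Hi * H1 + K1 * (Hi - Ki) * H1 + K1 * Ki * E1))"
    by (intro vanish_mat_x vanish_mat_add vanish_mat_mult_right[OF vanish_mat_mult_right[OF E1]]
        vanish_mat_mult_right[OF vanish_mat_mult_left[OF Hi_x]] vanish_mat_mult_left[OF E1])
  have tHK: "vanish (m - 1) (tH - tK)"
  proof -
    have "vanish (m - 1) ((tH - tK - tE) + tE)"
      unfolding tE_def tH_def tK_def
      by (intro vanish_add vanish_mono[OF trace_close] vanish_tr vanish_mat_mult_left E1) simp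
    then show ?thesis by simp
  qed
  have 2: "vanish_mat m (smul x (smul tH E1 + smul (tH - tK) K1))"
    by (intro vanish_mat_x vanish_mat_add vanish_mat_smul[OF E1] vanish_mat_smul'[OF tHK])
  have "vanish_mat m (smul tE (K - G))"
    using vanish_mat_smul_mult[OF vanish_tr[OF vanish_mat_mult_left[OF E1]] initial(2), of Gi] m by (simp add: tE_def)
  then have 3: "vanish_mat m (smul tH E + smul (tH - tK - tE) K + smul tE (K - G))"
    by (intro vanish_mat_add vanish_mat_smul[OF E] vanish_mat_smul'[OF trace_close[folded tH_def tK_def tE_def]])
  have 4: "vanish_mat m (smul x (RH - RK))"
    unfolding RH_def RK_def
    by (intro vanish_mat_x vanish_mat_mono[OF vanish_ricci[OF E inverse_close(1)[OF E]]]) simp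
  show ?thesis
    unfolding RH_def[symmetric] RK_def[symmetric] tE_def[symmetric] eq
    by (rule vanish_mat_add[OF vanish_mat_add[OF vanish_mat_diff[OF vanish_mat_diff[OF
          vanish_mat_smul[OF 1] vanish_mat_smul[OF E2]] 2] vanish_mat_smul[OF 3]] vanish_mat_smul[OF 4]])
qed

lemma normal_linearised:
  "vanish m (normal_equation x H1 H2 Hi - normal_equation x K1 K2 Ki - 2 * (2 - of_nat m) * tr (Gi * E1))"
proof -
  have of_m: "of_nat (m - 1) = (of_nat m :: 'r) - 1"
    using m by (simp add: of_nat_diff)
  have "tr (Hi * H1 * Hi * H1) - tr (Ki * K1 * Ki * K1) =
      tr ((Hi - Ki) * (H1 * Hi * H1)) + tr (Ki * E1 * (Hi * H1)) + tr (Ki * K1 * ((Hi - Ki) * H1)) + tr (Ki * K1 * Ki * E1)"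
    by (simp add: DE(1) algebra_simps tr_simps)
  moreover have "vanish (m - 1) (tr ((Hi - Ki) * (H1 * Hi * H1)) + tr (Ki * E1 * (Hi * H1))
      + tr (Ki * K1 * ((Hi - Ki) * H1)) + tr (Ki * K1 * Ki * E1))"
    by (intro vanish_add vanish_tr[OF vanish_mat_mult_right[OF Hi_x]]
        vanish_tr[OF vanish_mat_mult_right[OF vanish_mat_mult_left[OF E1]]]
        vanish_tr[OF vanish_mat_mult_left[OF vanish_mat_mult_right[OF Hi_x]]]
        vanish_tr[OF vanish_mat_mult_left[OF E1]])
  ultimately have 1: "vanish m (x * (tr (Hi * H1 * Hi * H1) - tr (Ki * K1 * Ki * K1)))"
    by (intro vanish_x_mult) (simp only:)
  have "x * (tr (Hi * H2) - tr (Ki * K2)) - of_nat (m - 1) * tr (Gi * E1) =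
      x * tr ((Hi - Ki) * H2) + tr (Ki * (smul x (H2 - K2) - smul (of_nat (m - 1)) E1)) + of_nat (m - 1) * tr ((Ki - Gi) * E1)"
    by (simp add: tr_simps smul_mult algebra_simps)
  moreover have "vanish_mat m ((Ki - Gi) * E1)"
    using vanish_mat_mult[OF inverse_close(2) E1] m by simp
  ultimately have 2: "vanish m (x * (tr (Hi * H2) - tr (Ki * K2)) - of_nat (m - 1) * tr (Gi * E1))"
    by (simp only:) (intro vanish_add vanish_x_mult vanish_tr[OF vanish_mat_mult_right[OF Hi_x]]
        vanish_tr[OF vanish_mat_mult_left[OF E2]] vanish_mult_left vanish_tr)
  have "normal_equation x H1 H2 Hi - normal_equation x K1 K2 Ki - 2 * (2 - of_nat m) * tr (Gi * E1) =
     x * (tr (Hi * H1 * Hi * H1) - tr (Ki * K1 * Ki * K1))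
     - 2 * (x * (tr (Hi * H2) - tr (Ki * K2)) - of_nat (m - 1) * tr (Gi * E1))
     + 2 * (tr (Hi * H1) - tr (Ki * K1) - tr (Gi * E1))"
    unfolding normal_equation_def of_m by (simp add: algebra_simps)
  then show ?thesis
    by (simp only:) (intro vanish_add vanish_diff 1 vanish_mult_left[OF 2] vanish_mult_left[OF trace_close])
qed

end

lemma trace_step: "tr (Gi * (smul a E1 + smul (b * tr (Gi * E1)) G)) = (a + b * of_nat CARD('n)) * tr (Gi * E1)"
  by (simp add: distrib_left distrib_right smul_mult tr_simps G tr_one algebra_simps)

lemma vanish_mat_integrate:
  assumes "vanish_mat 1 A" "vanish_mat m (D None A)" shows "vanish_mat (Suc m) A"
  using assms by (simp add: vanish_mat_def)

text \<open>The indicial argument: as long as two solutions agree to order \<open>m\<close>, the linearised slice equation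
  says that \<open>(n - m) E1 + tr(E1) G\<close> vanishes to order \<open>m\<close>. Taking the trace first, one finds
  that so does \<open>E1\<close> as long as \<open>m < n\<close>, since neither \<open>2n - m\<close> nor \<open>n - m\<close> is zero. At \<open>m = n\<close>
  only the trace is left; there the trace of the slice equation plus the normal equation
  is \<open>4 tr(E1)\<close>, which gives the trace one order more.\<close>

lemma expansion_unique:
  assumes H_eq: "vanish_mat (CARD('n) - 1) (slice_equation x H H1 H2 Hi (ricci_of h H Hi))"
      "vanish CARD('n) (tr (Hi * slice_equation x H H1 H2 Hi (ricci_of h H Hi)) + normal_equation x H1 H2 Hi)"
    and K_eq: "slice_equation x K K1 K2 Ki (ricci_of h K Ki) = 0" "normal_equation x K1 K2 Ki = 0"
  shows "vanish_mat CARD('n) E" "vanish (Suc CARD('n)) (tr (Gi * E))"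
proof -
  let ?n = "CARD('n)"
  have E_1: "vanish_mat 1 E"
    using vanish_mat_diff[OF initial] by simp
  have n: "?n \<ge> 1" by (simp add: Suc_leI)
  have "vanish_mat m E" if "1 \<le> m" "m \<le> ?n" for m
    using that
  proof (induction m rule: nat_induct_at_least)
    case base
    then show ?case using E_1 by simp
  next
    case (Suc m)
    then have m: "1 \<le> m" "m < ?n" and Em: "vanish_mat m E" by simp_all
    define T where "T = smul (2 * (of_nat ?n - of_nat m)) E1 + smul (2 * tr (Gi * E1)) G"
    define S where "S = slice_equation x H H1 H2 Hi (ricci_of h H Hi)"
    have "vanish_mat m (S - T)"
      unfolding S_def using slice_linearised[OF m(1) Em] by (simp add: K_eq T_def)
    moreover have "vanish_mat m S"
      unfolding S_def by (rule vanish_mat_mono[OF H_eq(1)]) (use m in simp)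
    ultimately have "vanish_mat m (S - (S - T))"
      by (rule vanish_mat_diff[rotated])
    then have T: "vanish_mat m T" by simp
    have "tr (Gi * T) = of_nat (2 * (?n - m) + 2 * ?n) * tr (Gi * E1)"
      unfolding T_def trace_step using m by (simp add: of_nat_diff)
    then have trE: "vanish m (tr (Gi * E1))"
      using vanish_tr[OF vanish_mat_mult_left[OF T], of Gi] m vanish_divide[of m "2 * (?n - m) + 2 * ?n"] by simp
    have "smul (of_nat (2 * (?n - m))) E1 = T - smul (2 * tr (Gi * E1)) G"
      unfolding T_def using m by (simp add: of_nat_diff)
    moreover have "vanish_mat m (T - smul (2 * tr (Gi * E1)) G)"
      by (intro vanish_mat_diff T vanish_mat_smul' vanish_mult_left trE)
    ultimately have "vanish_mat m (smul (of_nat (2 * (?n - m))) E1)" by simp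
    then have "vanish_mat m E1"
      using vanish_divide[of m "2 * (?n - m)"] m unfolding vanish_mat_def by (simp only: ent_smul) simp
    then show ?case
      by (rule vanish_mat_integrate[OF E_1])
  qed
  then show En: "vanish_mat ?n E" using n by simp
  define T where "T = smul (2 * (of_nat ?n - of_nat ?n)) E1 + smul (2 * tr (Gi * E1)) G"
  have ST: "vanish_mat ?n (slice_equation x H H1 H2 Hi (ricci_of h H Hi) - T)"
    using slice_linearised[OF n En] by (simp add: K_eq T_def)
  have E1n: "vanish_mat (?n - 1) E1" using vanish_mat_D_None[OF En] .
  have Tn: "vanish_mat (?n - 1) T"
    unfolding T_def
    by (intro vanish_mat_add vanish_mat_smul E1n vanish_mat_smul' vanish_mult_left vanish_tr vanish_mat_mult_left)
  define S where "S = slice_equation x H H1 H2 Hi (ricci_of h H Hi)"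
  define Z where "Z = normal_equation x H1 H2 Hi"
  have 1: "vanish ?n (tr (Hi * (S - T)))"
    unfolding S_def by (intro vanish_tr vanish_mat_mult_left ST)
  have "vanish_mat ?n ((Hi - Gi) * T)"
    using vanish_mat_mult[OF inverse_close(3) Tn] by simp
  then have 2: "vanish ?n (tr ((Hi - Gi) * T))"
    by (rule vanish_tr)
  have T: "tr (Gi * T) = 2 * of_nat ?n * tr (Gi * E1)"
    unfolding T_def trace_step by simp
  have 3: "vanish ?n (Z - 2 * (2 - of_nat ?n) * tr (Gi * E1))"
    using normal_linearised[OF n En] by (simp add: K_eq Z_def)
  have "of_nat 4 * tr (Gi * E1) = (tr (Hi * S) + Z) - tr (Hi * (S - T)) - tr ((Hi - Gi) * T)
     - (tr (Gi * T) - 2 * of_nat ?n * tr (Gi * E1)) - (Z - 2 * (2 - of_nat ?n) * tr (Gi * E1))"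
    by (simp add: algebra_simps tr_simps)
  moreover have "vanish ?n \<dots>"
    unfolding T
    by (rule vanish_diff[OF vanish_diff[OF vanish_diff[OF vanish_diff[OF H_eq(2)[folded S_def Z_def] 1] 2]] 3]) simp
  ultimately have "vanish ?n (of_nat 4 * tr (Gi * E1))"
    by (simp only:)
  then have trE: "vanish ?n (tr (Gi * E1))"
    by (rule vanish_divide) simp
  have "D None Gi = 0"
    using D_inverse[OF G(1,2), of None] G(3) by simp
  then have "d None (tr (Gi * E)) = tr (Gi * E1)"
    by (simp add: d_tr D_simps)
  moreover have "vanish 1 (tr (Gi * E))"
    by (intro vanish_tr vanish_mat_mult_left E_1)
  ultimately show "vanish (Suc ?n) (tr (Gi * E))"
    using trE by simp
qed

end

definition detm :: "('r, 'm::finite) sqmat \<Rightarrow> 'r" where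
  "detm A = (\<Sum>p | p permutes (UNIV :: 'm set). of_int (sign p) * (\<Prod>i\<in>UNIV. ent A i (p i)))"

lemma vanish_prod_one_plus:
  assumes "finite S" "\<And>i. i \<in> S \<Longrightarrow> vanish k (f i)"
  shows "vanish (2 * k) ((\<Prod>i\<in>S. 1 + f i) - 1 - (\<Sum>i\<in>S. f i))"
  using assms
proof (induction S)
  case (insert j S)
  define p where "p = (\<Prod>i\<in>S. 1 + f i)"
  define s where "s = (\<Sum>i\<in>S. f i)"
  have ps: "vanish (2 * k) (p - 1 - s)" using insert by (simp add: p_def s_def)
  have fj: "vanish k (f j)" using insert.prems by simp
  have s: "vanish k s"
    unfolding s_def by (rule vanish_sum) (use insert.prems in simp)
  have "vanish (2 * k) (f j * s)"
    using vanish_mult[OF fj s] by (simp add: mult_2)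
  then have "vanish (2 * k) ((1 + f j) * (p - 1 - s) + f j * s)"
    by (rule vanish_add[OF vanish_mult_left[OF ps]])
  moreover have "(1 + f j) * (p - 1 - s) + f j * s = (\<Prod>i\<in>insert j S. 1 + f i) - 1 - (\<Sum>i\<in>insert j S. f i)"
    using insert.hyps by (simp add: p_def s_def algebra_simps)
  ultimately show ?case by simp
qed simp

text \<open>To first order the determinant is the trace, and the error is quadratic. This is where the
  additional order of the trace in the uniqueness statement is used.\<close>

lemma vanish_det:
  fixes N :: "('r, 'm::finite) sqmat"
  assumes N: "vanish_mat k N" "vanish l (tr N)" "l \<le> 2 * k"
  shows "vanish l (detm (1 + N) - 1)"
proof -
  let ?t = "\<lambda>p. of_int (sign p) * (\<Prod>i\<in>UNIV. ent (1 + N) i (p i))"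
  let ?P = "{p. p permutes (UNIV :: 'm set)}"
  have Nk: "vanish k (ent N i j)" for i j
    using N(1) by (simp add: vanish_mat_def)
  have fin: "finite ?P" by (simp add: finite_permutations)
  have "detm (1 + N) = ?t id + (\<Sum>p\<in>?P - {id}. ?t p)"
    unfolding detm_def by (rule sum.remove[OF fin]) (simp add: permutes_id)
  moreover have "vanish l (?t p)" if p: "p \<in> ?P - {id}" for p
  proof -
    obtain i where i: "p i \<noteq> i" using p by (auto simp: fun_eq_iff)
    have inj: "inj p" using p permutes_inj by blast
    have pi: "p (p i) \<noteq> p i" using i inj by (simp add: inj_eq)
    have "(\<Prod>j\<in>UNIV. ent (1 + N) j (p j)) =
        ent (1 + N) i (p i) * (ent (1 + N) (p i) (p (p i)) * (\<Prod>j\<in>UNIV - {i} - {p i}. ent (1 + N) j (p j)))"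
      using i by (simp add: prod.remove[of UNIV i] prod.remove[of "UNIV - {i}" "p i"])
    also have "\<dots> = ent N i (p i) * ent N (p i) (p (p i)) * (\<Prod>j\<in>UNIV - {i} - {p i}. ent (1 + N) j (p j))"
      using i pi by (simp add: ent_one mult.assoc)
    finally have "?t p = of_int (sign p) * (ent N i (p i) * ent N (p i) (p (p i)) * (\<Prod>j\<in>UNIV - {i} - {p i}. ent (1 + N) j (p j)))"
      by simp
    moreover have "vanish (2 * k) (ent N i (p i) * ent N (p i) (p (p i)))"
      using vanish_mult[OF Nk Nk] by (simp add: mult_2)
    ultimately have "vanish (2 * k) (?t p)"
      by (simp only: vanish_mult_left vanish_mult_right)
    then show ?thesis using N(3) by (rule vanish_mono)
  qed
  then have "vanish l (\<Sum>p\<in>?P - {id}. ?t p)" by (rule vanish_sum)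
  moreover have "vanish l (?t id - 1 - tr N)"
    using vanish_prod_one_plus[of UNIV k "\<lambda>i. ent N i i"] Nk N(3)
    by (auto simp: tr_def ent_one intro: vanish_mono)
  ultimately have "vanish l ((?t id - 1 - tr N) + tr N + (\<Sum>p\<in>?P - {id}. ?t p))"
    using N(2) by (intro vanish_add)
  then show ?thesis
    using \<open>detm (1 + N) = _\<close> by (simp add: algebra_simps)
qed

end

section \<open>Taylor expansion in one variable\<close>

text \<open>A bound by \<open>t\<^sup>N\<close> on one side of 0 forces all derivatives of order less than \<open>N\<close> to vanish
  at 0.\<close>

lemma derivatives_vanish_of_bound:
  fixes u :: "nat \<Rightarrow> real \<Rightarrow> real"
  assumes r: "r > 0" and der: "\<And>j t. j \<le> N \<Longrightarrow> 0 \<le> t \<Longrightarrow> t < r \<Longrightarrow> (u j has_real_derivative u (Suc j) t) (at t)"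
    and bound: "\<forall>\<^sub>F t in at_right 0. \<bar>u 0 t\<bar> \<le> C * t ^ N"
    and j: "j < N"
  shows "u j 0 = 0"
  using j
proof (induction j rule: less_induct)
  case (less j)
  show ?case
  proof (rule ccontr)
    assume nz: "u j 0 \<noteq> 0"
    have "isCont (u j) 0"
      using der[of j 0] less.prems r by (auto intro: DERIV_isCont)
    then obtain \<eta> where \<eta>: "\<eta> > 0" "\<And>t. \<bar>t\<bar> < \<eta> \<Longrightarrow> \<bar>u j t - u j 0\<bar> < \<bar>u j 0\<bar> / 2"
      using nz unfolding continuous_at_eps_delta by (metis diff_zero dist_real_def half_gt_zero zero_less_abs_iff)
    obtain b where b: "b > 0" "\<And>t. 0 < t \<Longrightarrow> t < b \<Longrightarrow> \<bar>u 0 t\<bar> \<le> C * t ^ N"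
      using bound unfolding eventually_at_right_field by auto
    define c where "c = \<bar>u j 0\<bar> / 2 / (fact j * (\<bar>C\<bar> + 1))"
    have c: "c > 0" using nz by (simp add: c_def)
    define t where "t = Min {r / 2, \<eta> / 2, b / 2, 1, c}"
    have t: "0 < t" "t < r" "t < \<eta>" "t < b" "t \<le> 1" "t \<le> c"
      using r \<eta>(1) b(1) c by (simp_all add: t_def)
    obtain s where s: "0 < s" "s \<le> t" "u 0 t = (\<Sum>m<j. u m 0 / fact m * t ^ m) + u j s / fact j * t ^ j"
      using Maclaurin2[of t u "u 0" j] der less.prems t by auto
    have "(\<Sum>m<j. u m 0 / fact m * t ^ m) = 0"
      using less by (intro sum.neutral) auto
    then have "\<bar>u j s\<bar> * t ^ j = fact j * \<bar>u 0 t\<bar>"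
      using t s by (simp add: abs_mult)
    also have "\<dots> \<le> fact j * (\<bar>C\<bar> * t ^ N)"
      using b(2)[OF t(1,4)] t(1) by (intro mult_left_mono) (auto intro: order_trans[OF _ mult_right_mono])
    also have "N = (N - j - 1) + 1 + j"
      using less.prems by simp
    also have "t ^ ((N - j - 1) + 1 + j) = t ^ (N - j - 1) * t * t ^ j"
      unfolding power_add by simp
    also have "fact j * (\<bar>C\<bar> * (t ^ (N - j - 1) * t * t ^ j)) \<le> fact j * (\<bar>C\<bar> * (1 * t * t ^ j))"
      using t by (intro mult_left_mono mult_right_mono power_le_one) auto
    finally have "\<bar>u j s\<bar> * t ^ j \<le> (fact j * \<bar>C\<bar> * t) * t ^ j" by (simp add: mult.assoc)
    then have "\<bar>u j s\<bar> \<le> fact j * \<bar>C\<bar> * t"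
      using t(1) by (simp add: mult_le_cancel_right)
    also have "\<dots> \<le> fact j * \<bar>C\<bar> * c"
      using t(6) by (intro mult_left_mono) auto
    also have "\<dots> \<le> (fact j * (\<bar>C\<bar> + 1)) * c"
      using c by (intro mult_right_mono) (auto simp: distrib_left)
    also have "\<dots> = \<bar>u j 0\<bar> / 2"
    proof -
      have "\<bar>C\<bar> + 1 \<noteq> 0" by linarith
      then show ?thesis by (simp add: c_def)
    qed
    finally have "\<bar>u j s\<bar> \<le> \<bar>u j 0\<bar> / 2" .
    moreover have "\<bar>u j s - u j 0\<bar> < \<bar>u j 0\<bar> / 2"
      using \<eta>(2)[of s] s t by simp
    ultimately show False by linarith
  qed
qed

text \<open>The converse direction: Taylor's formula with all derivatives up to order \<open>N\<close> equal to zero.\<close>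

lemma small_of_derivatives_vanish:
  fixes u :: "nat \<Rightarrow> real \<Rightarrow> real"
  assumes r: "r > 0" and der: "\<And>j t. j \<le> N \<Longrightarrow> 0 \<le> t \<Longrightarrow> t < r \<Longrightarrow> (u j has_real_derivative u (Suc j) t) (at t)"
    and zero: "\<And>j. j \<le> N \<Longrightarrow> u j 0 = 0"
  shows "((\<lambda>t. u 0 t / t ^ N) \<longlongrightarrow> 0) (at_right 0)"
proof (rule tendstoI)
  fix e :: real assume e: "e > 0"
  have "isCont (u N) 0"
    using der[of N 0] r by (auto intro: DERIV_isCont)
  then obtain \<eta> where \<eta>: "\<eta> > 0" "\<And>t. \<bar>t\<bar> < \<eta> \<Longrightarrow> \<bar>u N t\<bar> < e"
    using e zero[of N] unfolding continuous_at_eps_delta by (metis diff_zero dist_real_def order_refl)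
  show "\<forall>\<^sub>F t in at_right 0. dist (u 0 t / t ^ N) 0 < e"
    unfolding eventually_at_right_field
  proof (intro exI[of _ "min r \<eta>"] conjI allI impI)
    fix t assume t: "0 < t" "t < min r \<eta>"
    obtain s where s: "0 < s" "s \<le> t" "u 0 t = (\<Sum>m<N. u m 0 / fact m * t ^ m) + u N s / fact N * t ^ N"
      using Maclaurin2[of t u "u 0" N] der t by auto
    have "(\<Sum>m<N. u m 0 / fact m * t ^ m) = 0"
      using zero by (intro sum.neutral) auto
    then have "u 0 t / t ^ N = u N s / fact N" using s t by simp
    moreover have "\<bar>u N s\<bar> / fact N \<le> \<bar>u N s\<bar>"
      by (simp add: divide_le_eq mult_le_cancel_left1 fact_ge_1)
    moreover have "\<bar>u N s\<bar> < e" using \<eta>(2)[of s] s t by simp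
    ultimately show "dist (u 0 t / t ^ N) 0 < e" by simp
  qed (use r \<eta>(1) in auto)
qed

section \<open>Germs along a coordinate hyperplane\<close>

definition coord_deriv :: "'k \<Rightarrow> (real ^ 'k::finite) germ \<Rightarrow> (real ^ 'k) germ" where
  "coord_deriv i = germ_deriv (axis i 1)"

lemma represents_partial: "represents z f \<gamma> \<Longrightarrow> represents z (partial i f) (coord_deriv i \<gamma>)"
  unfolding partial_def[abs_def] coord_deriv_def by (rule represents_deriv)

global_interpretation germ_ring: diff_ring "coord_deriv :: 'k::finite \<Rightarrow> (real ^ 'k) germ \<Rightarrow> _"
  by unfold_locales
    (simp_all add: coord_deriv_def germ_deriv_add germ_deriv_mult germ_deriv_commute germ_double_eq_0)

definition zero_on_slice :: "(real ^ 'n::finite option) germ \<Rightarrow> bool" where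
  "zero_on_slice \<gamma> \<longleftrightarrow> (\<exists>f. represents 0 f \<gamma> \<and> (\<forall>\<^sub>F z in nhds 0. z $ None = 0 \<longrightarrow> f z = 0))"

lemma represents_translate:
  assumes "represents z f \<gamma>" shows "represents 0 (\<lambda>w. f (z + w)) \<gamma>"
  using smooth_near_translate[OF represents_smooth[OF assms]] assms by (simp add: represents_def)

lemma zero_on_slice_iff:
  assumes "represents z f \<gamma>" "z $ None = 0"
  shows "zero_on_slice \<gamma> \<longleftrightarrow> (\<forall>\<^sub>F w in nhds z. w $ None = 0 \<longrightarrow> f w = 0)"
proof -
  have "zero_on_slice \<gamma> \<longleftrightarrow> (\<forall>\<^sub>F w in nhds 0. w $ None = 0 \<longrightarrow> f (z + w) = 0)"
  proof
    assume "zero_on_slice \<gamma>"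
    then obtain g where g: "represents 0 g \<gamma>" "\<forall>\<^sub>F w in nhds 0. w $ None = 0 \<longrightarrow> g w = 0"
      by (auto simp: zero_on_slice_def)
    have "\<forall>\<^sub>F w in nhds 0. g w = f (z + w)"
      using represents_eq_iff[OF g(1) represents_translate[OF assms(1)]] by simp
    with g(2) show "\<forall>\<^sub>F w in nhds 0. w $ None = 0 \<longrightarrow> f (z + w) = 0"
      by eventually_elim simp
  next
    assume "\<forall>\<^sub>F w in nhds 0. w $ None = 0 \<longrightarrow> f (z + w) = 0"
    then show "zero_on_slice \<gamma>"
      unfolding zero_on_slice_def using represents_translate[OF assms(1)] by blast
  qed
  also have "\<dots> \<longleftrightarrow> (\<forall>\<^sub>F w in nhds 0. (z + w) $ None = 0 \<longrightarrow> f (z + w) = 0)"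
    using assms(2) by simp
  also have "\<dots> \<longleftrightarrow> (\<forall>\<^sub>F w in nhds z. w $ None = 0 \<longrightarrow> f w = 0)"
    by (rule eventually_translate_iff)
  finally show ?thesis .
qed

lemma line_derivative:
  assumes "f differentiable at (z + t *\<^sub>R v)"
  shows "((\<lambda>s. f (z + s *\<^sub>R v)) has_real_derivative frechet_derivative f (at (z + t *\<^sub>R v)) v) (at t)"
proof -
  have "((\<lambda>s. z + s *\<^sub>R v) has_derivative (\<lambda>s. s *\<^sub>R v)) (at t)"
    by (auto intro!: derivative_eq_intros)
  from has_derivative_compose[OF this, of f "frechet_derivative f (at (z + t *\<^sub>R v))"] assms
  have "((\<lambda>s. f (z + s *\<^sub>R v)) has_derivative (\<lambda>s. frechet_derivative f (at (z + t *\<^sub>R v)) (s *\<^sub>R v))) (at t)"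
    by (simp add: frechet_derivative_works)
  moreover have "frechet_derivative f (at (z + t *\<^sub>R v)) (s *\<^sub>R v) = frechet_derivative f (at (z + t *\<^sub>R v)) v * s" for s
    using linear_frechet_derivative[OF assms] by (simp add: linear_scale mult.commute)
  ultimately show ?thesis by (simp add: has_field_derivative_def)
qed

definition normal_coord :: "(real ^ 'n::finite option) germ" where
  "normal_coord = abs_germ (\<lambda>z. z $ None)"

lemma Ck_on_linear_fun:
  assumes "bounded_linear L" "open V" shows "Ck_on k V L"
proof (cases k)
  case 0
  then show ?thesis using bounded_linear.continuous_on[OF assms(1) continuous_on_id, of V] by simp
next
  case (Suc m)
  show ?thesis
    unfolding Suc
    by (rule Ck_on_Suc_I[OF assms(2) bounded_linear_imp_has_derivative[OF assms(1)] Ck_on_const[OF assms(2)]])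
qed

lemma smooth_near_linear: "bounded_linear f \<Longrightarrow> smooth_near z f"
  unfolding smooth_near_def by (intro exI[of _ UNIV]) (simp add: Ck_on_linear_fun)

lemma represents_normal_coord: "z $ None = 0 \<Longrightarrow> represents z (\<lambda>z. z $ None) normal_coord"
  unfolding represents_def normal_coord_def
  by (simp add: smooth_near_linear bounded_linear_vec_nth)

lemma deriv_coordinate:
  assumes "represents z (\<lambda>z. z $ J) \<gamma>"
  shows "coord_deriv I \<gamma> = (if I = J then 1 else 0)"
proof -
  have "frechet_derivative (\<lambda>z. z $ J) (at w) = (\<lambda>z. z $ J)" for w :: "real ^ 'a"
    using frechet_derivative_at[OF bounded_linear_imp_has_derivative[OF bounded_linear_vec_nth]] by metis
  then have p: "partial I (\<lambda>z. z $ J) = (\<lambda>_. if I = J then 1 else 0)"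
    by (simp add: partial_def[abs_def] axis_def)
  have "represents z (\<lambda>_. if I = J then 1 else 0) (coord_deriv I \<gamma>)"
    using represents_partial[OF assms, of I] unfolding p .
  moreover have "represents z (\<lambda>_. if I = J then 1 else 0) (if I = J then 1 else 0)"
    by (simp add: represents_0 represents_1)
  ultimately show ?thesis by (rule represents_unique)
qed

lemma zero_on_slice_add:
  assumes "zero_on_slice a" "zero_on_slice b" shows "zero_on_slice (a + b)"
proof -
  obtain f g where f: "represents 0 f a" "\<forall>\<^sub>F z in nhds 0. z $ None = 0 \<longrightarrow> f z = 0"
    and g: "represents 0 g b" "\<forall>\<^sub>F z in nhds 0. z $ None = 0 \<longrightarrow> g z = 0"
    using assms by (auto simp: zero_on_slice_def)
  have "\<forall>\<^sub>F z in nhds 0. z $ None = 0 \<longrightarrow> f z + g z = 0"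
    using f(2) g(2) by eventually_elim simp
  then show ?thesis
    unfolding zero_on_slice_def by (intro exI[of _ "\<lambda>z. f z + g z"] conjI represents_add f(1) g(1))
qed

lemma zero_on_slice_mult:
  assumes "zero_on_slice a" shows "zero_on_slice (b * a)"
proof -
  obtain f where f: "represents 0 f a" "\<forall>\<^sub>F z in nhds 0. z $ None = 0 \<longrightarrow> f z = 0"
    using assms by (auto simp: zero_on_slice_def)
  obtain g where g: "represents 0 g b"
    using germ_represented by blast
  have "\<forall>\<^sub>F z in nhds 0. z $ None = 0 \<longrightarrow> g z * f z = 0"
    using f(2) by eventually_elim simp
  then show ?thesis
    unfolding zero_on_slice_def by (intro exI[of _ "\<lambda>z. g z * f z"] conjI represents_mult f(1) g)
qed

text \<open>Tangential derivatives at points of the hyperplane only see values on the hyperplane.\<close>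

lemma zero_on_slice_deriv:
  fixes a :: "(real ^ 'n::finite option) germ"
  assumes "zero_on_slice a" shows "zero_on_slice (coord_deriv (Some i) a)"
proof -
  obtain f where f: "represents 0 f a" "\<forall>\<^sub>F z in nhds 0. z $ None = 0 \<longrightarrow> f z = 0"
    using assms by (auto simp: zero_on_slice_def)
  obtain U where U: "open U" "0 \<in> U" "\<forall>w\<in>U. w $ None = 0 \<longrightarrow> f w = 0"
    using f(2) unfolding eventually_nhds by (elim exE conjE) (rule that)
  have p: "partial (Some i) f w = 0" if w: "w \<in> U" "w $ None = 0" "f differentiable at w" for w
  proof -
    let ?e = "axis (Some i) 1 :: real ^ 'n option"
    have e: "((\<lambda>s. f (w + s *\<^sub>R ?e)) has_real_derivative partial (Some i) f w) (at 0)"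
      using line_derivative[of f w 0 ?e] w(3) by (simp add: partial_def)
    have "((\<lambda>s. w + s *\<^sub>R ?e) \<longlongrightarrow> w + 0 *\<^sub>R ?e) (nhds 0)"
      by (intro tendsto_add tendsto_scaleR tendsto_const filterlim_ident)
    then have "\<forall>\<^sub>F s in nhds 0. w + s *\<^sub>R ?e \<in> U"
      using U(1) w(1) by (simp add: tendsto_def)
    then have "\<forall>\<^sub>F s in nhds 0. f (w + s *\<^sub>R ?e) = 0"
    proof (rule eventually_mono)
      fix s assume "w + s *\<^sub>R ?e \<in> U"
      then show "f (w + s *\<^sub>R ?e) = 0"
        using U(3) w(2) by (simp add: axis_def)
    qed
    then have "((\<lambda>s. 0) has_real_derivative partial (Some i) f w) (at 0)"
      using DERIV_cong_ev[of 0 0 "\<lambda>s. f (w + s *\<^sub>R ?e)" "\<lambda>_. 0"] e by simp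
    then show ?thesis
      using DERIV_unique[of "\<lambda>s. 0 :: real" "partial (Some i) f w" 0 0] by simp
  qed
  have "\<forall>\<^sub>F w in nhds 0. w \<in> U \<and> f differentiable at w"
    using smooth_near_eventually[OF represents_smooth[OF f(1)]] eventually_nhds_in_open[OF U(1,2)]
    by eventually_elim simp
  then have "\<forall>\<^sub>F w in nhds 0. w $ None = 0 \<longrightarrow> partial (Some i) f w = 0"
    by (rule eventually_mono) (use p in simp)
  then show ?thesis
    unfolding zero_on_slice_def by (intro exI[of _ "partial (Some i) f"] conjI represents_partial f(1))
qed

lemma germ_const_of_nat: "germ_const (real k) = (of_nat k :: 'v::real_normed_vector germ)"
proof (induction k)
  case (Suc k)
  have "germ_const (1 + real k) = germ_const 1 + (germ_const (real k) :: 'v germ)"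
    by (rule germ_const_arith)
  with Suc show ?case by (simp add: germ_const_arith(3))
qed (simp add: germ_const_arith(4))

lemma germ_of_nat_invertible:
  assumes "k > 0" shows "germ_const (1 / real k) * of_nat k = 1"
proof -
  have "germ_const (1 / real k) * germ_const (real k) = germ_const 1"
    unfolding germ_const_arith(2)[symmetric] using assms by simp
  then show ?thesis by (simp add: germ_const_of_nat germ_const_arith(3))
qed

global_interpretation germ_filtration:
  filtered_ring "coord_deriv :: 'n::finite option \<Rightarrow> (real ^ 'n option) germ \<Rightarrow> _" zero_on_slice normal_coord
proof unfold_locales
  have z0: "(0 :: real ^ 'n option) $ None = 0" by simp
  show "zero_on_slice (0 :: (real ^ 'n option) germ)"
    unfolding zero_on_slice_def by (rule exI[of _ "\<lambda>_. 0"]) (simp add: represents_0)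
  show "zero_on_slice (normal_coord :: (real ^ 'n option) germ)"
    unfolding zero_on_slice_def by (rule exI[of _ "\<lambda>z. z $ None"]) (simp add: represents_normal_coord)
  show "coord_deriv None (normal_coord :: (real ^ 'n option) germ) = 1"
    using deriv_coordinate[OF represents_normal_coord[OF z0], of None] by simp
  show "\<exists>r. r * of_nat k = (1 :: (real ^ 'n option) germ)" if "k > 0" for k
    using germ_of_nat_invertible[OF that] ..
qed (fact zero_on_slice_add zero_on_slice_mult zero_on_slice_deriv)+

abbreviation "vanish \<equiv> germ_filtration.vanish"
abbreviation "vanish_mat \<equiv> germ_filtration.vanish_mat"

lemma vanish_iff: "vanish N \<gamma> \<longleftrightarrow> (\<forall>j<N. zero_on_slice ((coord_deriv None ^^ j) \<gamma>))"
proof (induction N arbitrary: \<gamma>)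
  case (Suc N)
  have "(\<forall>j<Suc N. zero_on_slice ((coord_deriv None ^^ j) \<gamma>)) \<longleftrightarrow>
      zero_on_slice ((coord_deriv None ^^ 0) \<gamma>) \<and> (\<forall>j<N. zero_on_slice ((coord_deriv None ^^ Suc j) \<gamma>))"
    by (rule All_less_Suc2)
  then show ?case
    unfolding germ_filtration.vanish.simps(2) Suc funpow_Suc_right by simp
qed simp

definition normal_derivs :: "(real ^ 'n::finite option \<Rightarrow> real) \<Rightarrow> nat \<Rightarrow> real ^ 'n option \<Rightarrow> real" where
  "normal_derivs f j = (partial None ^^ j) f"

lemma represents_normal_derivs:
  "represents z f \<gamma> \<Longrightarrow> represents z (normal_derivs f j) ((coord_deriv None ^^ j) \<gamma>)"
  unfolding normal_derivs_def by (induction j) (simp_all add: represents_partial)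

lemma normal_derivs_line:
  assumes "represents z f \<gamma>"
  obtains r where "r > 0"
    "\<And>w j t. w \<in> ball z r \<Longrightarrow> j \<le> N \<Longrightarrow> 0 \<le> t \<Longrightarrow> t < r \<Longrightarrow>
       ((\<lambda>t. normal_derivs f j (w + t *\<^sub>R axis None 1)) has_real_derivative
         normal_derivs f (Suc j) (w + t *\<^sub>R axis None 1)) (at t)"
proof -
  have "\<forall>\<^sub>F w in nhds z. \<forall>j\<in>{..N}. normal_derivs f j differentiable at w"
  proof (intro eventually_ball_finite ballI)
    fix j
    show "\<forall>\<^sub>F w in nhds z. normal_derivs f j differentiable at w"
      by (rule eventually_mono[OF smooth_near_eventually[OF represents_smooth[OF represents_normal_derivs[OF assms, of j]]]]) simp
  qed simp
  then obtain r where r: "r > 0" "\<And>w j. dist w z < r \<Longrightarrow> j \<le> N \<Longrightarrow> normal_derivs f j differentiable at w"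
    unfolding eventually_nhds_metric by auto
  show thesis
  proof (rule that[of "r / 2"])
    fix w :: "real ^ 'a option" and j t assume w: "w \<in> ball z (r / 2)" "j \<le> N" "0 \<le> t" "t < r / 2"
    have "dist (w + t *\<^sub>R axis None 1) z \<le> dist w z + norm (t *\<^sub>R axis None 1 :: real ^ 'a option)"
      by (metis add_diff_eq add.commute dist_norm norm_triangle_ineq)
    also have "\<dots> < r"
      using w by (simp add: dist_commute)
    finally have "normal_derivs f j differentiable at (w + t *\<^sub>R axis None 1)"
      using r(2) w(2) by blast
    from line_derivative[OF this]
    show "((\<lambda>t. normal_derivs f j (w + t *\<^sub>R axis None 1)) has_real_derivative
         normal_derivs f (Suc j) (w + t *\<^sub>R axis None 1)) (at t)"
      by (simp add: normal_derivs_def partial_def)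
  qed (use r in simp)
qed

text \<open>Vanishing of a germ refers to all points of the hyperplane near \<open>z\<close>, therefore the bound is
  needed at all of them. The constant may depend on the point.\<close>

lemma vanish_of_bound:
  assumes rep: "represents z f \<gamma>" "z $ None = 0"
    and bound: "\<forall>\<^sub>F w in nhds z. w $ None = 0 \<longrightarrow>
      (\<exists>C. \<forall>\<^sub>F t in at_right 0. \<bar>f (w + t *\<^sub>R axis None 1)\<bar> \<le> C * t ^ N)"
  shows "vanish N \<gamma>"
proof -
  obtain r where r: "r > 0"
    "\<And>w j t. w \<in> ball z r \<Longrightarrow> j \<le> N \<Longrightarrow> 0 \<le> t \<Longrightarrow> t < r \<Longrightarrow>
       ((\<lambda>t. normal_derivs f j (w + t *\<^sub>R axis None 1)) has_real_derivative
         normal_derivs f (Suc j) (w + t *\<^sub>R axis None 1)) (at t)"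
    using normal_derivs_line[OF rep(1)] by metis
  have "\<forall>\<^sub>F w in nhds z. w \<in> ball z r"
    using r(1) by (intro eventually_nhds_in_open) auto
  then have "\<forall>\<^sub>F w in nhds z. w $ None = 0 \<longrightarrow> normal_derivs f j w = 0" if j: "j < N" for j
    using bound
  proof eventually_elim
    case (elim w)
    show ?case
    proof
      assume "w $ None = 0"
      then obtain C where C: "\<forall>\<^sub>F t in at_right 0. \<bar>f (w + t *\<^sub>R axis None 1)\<bar> \<le> C * t ^ N"
        using elim(2) by blast
      show "normal_derivs f j w = 0"
        using derivatives_vanish_of_bound[of r N "\<lambda>j t. normal_derivs f j (w + t *\<^sub>R axis None 1)" C j]
          r elim(1) C j by (simp add: normal_derivs_def)
    qed
  qed
  then show ?thesis
    unfolding vanish_iff zero_on_slice_iff[OF represents_normal_derivs[OF rep(1)] rep(2)] by blast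
qed

lemma small_of_vanish:
  assumes rep: "represents z f \<gamma>" "z $ None = 0" and v: "vanish (Suc N) \<gamma>"
  shows "((\<lambda>t. f (z + t *\<^sub>R axis None 1) / t ^ N) \<longlongrightarrow> 0) (at_right 0)"
proof -
  obtain r where r: "r > 0"
    "\<And>w j t. w \<in> ball z r \<Longrightarrow> j \<le> N \<Longrightarrow> 0 \<le> t \<Longrightarrow> t < r \<Longrightarrow>
       ((\<lambda>t. normal_derivs f j (w + t *\<^sub>R axis None 1)) has_real_derivative
         normal_derivs f (Suc j) (w + t *\<^sub>R axis None 1)) (at t)"
    using normal_derivs_line[OF rep(1)] by metis
  have "normal_derivs f j z = 0" if "j \<le> N" for j
  proof -
    have "zero_on_slice ((coord_deriv None ^^ j) \<gamma>)"
      using v that unfolding vanish_iff by simp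
    then have "\<forall>\<^sub>F w in nhds z. w $ None = 0 \<longrightarrow> normal_derivs f j w = 0"
      unfolding zero_on_slice_iff[OF represents_normal_derivs[OF rep(1)] rep(2)] .
    then show ?thesis
      using eventually_nhds_x_imp_x rep(2) by blast
  qed
  then show ?thesis
    using small_of_derivatives_vanish[of r N "\<lambda>j t. normal_derivs f j (z + t *\<^sub>R axis None 1)"] r
    by (simp add: normal_derivs_def)
qed

section \<open>Determinants and the Pfaffian\<close>

lemma position_function_permutes:
  fixes s :: "nat \<Rightarrow> 'n::finite"
  assumes "bij_betw s {..<CARD('n)} UNIV"
  shows "(\<lambda>r. if r < CARD('n) then inv_into {..<CARD('n)} index_enum (s r) else r) permutes {..<CARD('n)}"
proof -
  have "\<exists>e :: nat \<Rightarrow> 'n. bij_betw e {..<CARD('n)} UNIV"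
    using ex_bij_betw_nat_finite[of "UNIV :: 'n set"] by (simp add: lessThan_atLeast0)
  then have e: "bij_betw (index_enum :: nat \<Rightarrow> 'n) {..<CARD('n)} UNIV"
    unfolding index_enum_def by (rule someI_ex)
  have "bij_betw (inv_into {..<CARD('n)} index_enum \<circ> s) {..<CARD('n)} {..<CARD('n)}"
    using bij_betw_trans[OF assms bij_betw_inv_into[OF e]] .
  then have "bij_betw (\<lambda>r. if r < CARD('n) then inv_into {..<CARD('n)} index_enum (s r) else r) {..<CARD('n)} {..<CARD('n)}"
    by (rule iffD1[OF bij_betw_cong, rotated]) simp
  then show ?thesis
    by (rule bij_imp_permutes) simp
qed

lemma levi_civita_compose:
  fixes s :: "nat \<Rightarrow> 'n::finite"
  assumes p: "\<pi> permutes {..<CARD('n)}"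
  shows "levi_civita (s \<circ> \<pi>) = of_int (sign \<pi>) * levi_civita s"
proof (cases "bij_betw s {..<CARD('n)} UNIV")
  case True
  let ?f = "\<lambda>s r. if r < CARD('n) then inv_into {..<CARD('n)} index_enum (s r) else r"
  have b: "bij_betw (s \<circ> \<pi>) {..<CARD('n)} UNIV"
    using bij_betw_trans[OF permutes_imp_bij[OF p] True] .
  have "\<pi> r < CARD('n) \<longleftrightarrow> r < CARD('n)" for r
    using permutes_in_image[OF p, of r] by simp
  moreover have "\<pi> r = r" if "\<not> r < CARD('n)" for r
    using permutes_not_in[OF p, of r] that by simp
  ultimately have "?f (s \<circ> \<pi>) = ?f s \<circ> \<pi>"
    by (auto simp: fun_eq_iff)
  moreover have "sign (?f s \<circ> \<pi>) = sign (?f s) * sign \<pi>"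
    using position_function_permutes[OF True] p
    by (intro sign_compose) (auto simp: permutation_permutes)
  ultimately have "sign (?f (s \<circ> \<pi>)) = sign (?f s) * sign \<pi>" by simp
  then show ?thesis
    using True b unfolding levi_civita_def by simp
next
  case False
  have "\<not> bij_betw (s \<circ> \<pi>) {..<CARD('n)} UNIV"
    using bij_betw_comp_iff[OF permutes_imp_bij[OF p], of s UNIV] False by simp
  then show ?thesis
    using False by (simp add: levi_civita_def)
qed

lemma sum_multi_indices_permute:
  assumes p: "\<pi> permutes {..<CARD('n)}"
  shows "(\<Sum>s\<in>multi_indices. f (s \<circ> \<pi>)) = (\<Sum>s\<in>(multi_indices :: (nat \<Rightarrow> 'n::finite) set). f s)"
proof -
  have c: "s \<circ> q \<in> multi_indices" if "s \<in> multi_indices" "q permutes {..<CARD('n)}" for s :: "nat \<Rightarrow> 'n" and q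
    using that permutes_not_in[OF that(2)] by (auto simp: multi_indices_def PiE_def extensional_def)
  show ?thesis
  proof (rule sum.reindex_bij_witness[of _ "\<lambda>s. s \<circ> inv \<pi>" "\<lambda>s. s \<circ> \<pi>"])
    fix s :: "nat \<Rightarrow> 'n" assume s: "s \<in> multi_indices"
    show "s \<circ> \<pi> \<circ> inv \<pi> = s" "s \<circ> inv \<pi> \<circ> \<pi> = s"
      using permutes_inv_o[OF p] by (simp_all add: comp_assoc)
    show "s \<circ> \<pi> \<in> multi_indices" "s \<circ> inv \<pi> \<in> multi_indices"
      using c[OF s] p permutes_inv[OF p] by simp_all
  qed simp
qed

lemma finite_multi_indices: "finite (multi_indices :: (nat \<Rightarrow> 'n::finite) set)"
  unfolding multi_indices_def by (intro finite_PiE) auto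

lemma levi_civita_bij:
  fixes s :: "nat \<Rightarrow> 'n::finite"
  assumes "bij_betw s {..<CARD('n)} UNIV" shows "levi_civita s * levi_civita s = 1"
  unfolding levi_civita_def using assms by (simp flip: of_int_mult)

lemma levi_civita_restrict:
  fixes s :: "nat \<Rightarrow> 'n::finite"
  shows "levi_civita (restrict s {..<CARD('n)}) = levi_civita s"
proof -
  have "bij_betw (restrict s {..<CARD('n)}) {..<CARD('n)} UNIV \<longleftrightarrow> bij_betw s {..<CARD('n)} UNIV"
    by (rule bij_betw_cong) simp
  moreover have "(\<lambda>r. if r < CARD('n) then inv_into {..<CARD('n)} index_enum (restrict s {..<CARD('n)} r) else r)
    = (\<lambda>r. if r < CARD('n) then inv_into {..<CARD('n)} index_enum (s r) else r)"
    by (simp add: fun_eq_iff)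
  ultimately show ?thesis by (simp only: levi_civita_def)
qed

lemma levi_civita_permute_values:
  fixes s :: "nat \<Rightarrow> 'n::finite"
  assumes s: "bij_betw s {..<CARD('n)} UNIV" and p: "p permutes (UNIV :: 'n set)"
  shows "levi_civita (p \<circ> s) = of_int (sign p) * levi_civita s"
  using p finite_class.finite_UNIV
proof (induction rule: permutes_induct)
  case id
  then show ?case by simp
next
  case (swap a b p)
  define t where "t = p \<circ> s"
  have t: "bij_betw t {..<CARD('n)} UNIV"
    unfolding t_def by (rule bij_betw_trans[OF s permutes_imp_bij[OF \<open>p permutes UNIV\<close>]])
  have "a \<in> t ` {..<CARD('n)}" "b \<in> t ` {..<CARD('n)}"
    using t by (simp_all add: bij_betw_def)
  then obtain i j where ij: "i < CARD('n)" "j < CARD('n)" "t i = a" "t j = b"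
    by auto
  have inj: "inj_on t {..<CARD('n)}" using t by (simp add: bij_betw_def)
  have ne: "i \<noteq> j" using ij \<open>a \<noteq> b\<close> by auto
  have tr: "Transposition.transpose i j permutes {..<CARD('n)}"
    using ij by (intro permutes_swap_id) auto
  have "restrict (Transposition.transpose a b \<circ> t) {..<CARD('n)} = restrict (t \<circ> Transposition.transpose i j) {..<CARD('n)}"
  proof (rule restrict_ext)
    fix r assume "r \<in> {..<CARD('n)}"
    then have "t r = a \<longleftrightarrow> r = i" "t r = b \<longleftrightarrow> r = j"
      using ij inj_on_eq_iff[OF inj, of r i] inj_on_eq_iff[OF inj, of r j] by simp_all
    then show "(Transposition.transpose a b \<circ> t) r = (t \<circ> Transposition.transpose i j) r"
      unfolding Transposition.transpose_def comp_apply using ij(3,4) by simp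
  qed
  then have "levi_civita (Transposition.transpose a b \<circ> t) = levi_civita (t \<circ> Transposition.transpose i j)"
    using levi_civita_restrict[of "Transposition.transpose a b \<circ> t"]
      levi_civita_restrict[of "t \<circ> Transposition.transpose i j"] by (simp only:)
  also have "\<dots> = - levi_civita t"
    unfolding levi_civita_compose[OF tr] using ne by (simp add: sign_swap_id)
  finally have 1: "levi_civita (Transposition.transpose a b \<circ> t) = - levi_civita t" .
  have 2: "sign (Transposition.transpose a b \<circ> p) = - sign p"
    using sign_compose[OF permutation_swap_id permutes_imp_permutation[OF finite_class.finite_UNIV \<open>p permutes UNIV\<close>], of a b]
      \<open>a \<noteq> b\<close> by (simp add: sign_swap_id)
  then show ?case
    unfolding comp_assoc 2 1[unfolded t_def] swap.IH by simp
qed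

lemma bij_multi_indices:
  fixes s :: "nat \<Rightarrow> 'n::finite"
  assumes s: "bij_betw s {..<CARD('n)} UNIV"
  shows "bij_betw (\<lambda>p. restrict (p \<circ> s) {..<CARD('n)}) {p. p permutes (UNIV :: 'n set)}
    {t\<in>multi_indices. bij_betw t {..<CARD('n)} UNIV}"
proof (rule bij_betw_byWitness[where f' = "\<lambda>t. t \<circ> inv_into {..<CARD('n)} s"])
  have si: "s (inv_into {..<CARD('n)} s i) = i" "inv_into {..<CARD('n)} s i < CARD('n)" for i
    using s bij_betw_inv_into_right[OF s, of i] bij_betwE[OF bij_betw_inv_into[OF s]] by auto
  show "\<forall>p\<in>{p. p permutes UNIV}. restrict (p \<circ> s) {..<CARD('n)} \<circ> inv_into {..<CARD('n)} s = p"
    by (auto simp: fun_eq_iff si)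
  show "\<forall>t\<in>{t\<in>(multi_indices :: (nat \<Rightarrow> 'n) set). bij_betw t {..<CARD('n)} UNIV}.
      restrict (t \<circ> inv_into {..<CARD('n)} s \<circ> s) {..<CARD('n)} = t"
  proof
    fix t assume "t \<in> {t \<in> (multi_indices :: (nat \<Rightarrow> 'n) set). bij_betw t {..<CARD('n)} UNIV}"
    then have "t \<in> extensional {..<CARD('n)}" by (simp add: multi_indices_def PiE_def)
    then show "restrict (t \<circ> inv_into {..<CARD('n)} s \<circ> s) {..<CARD('n)} = t"
      using s by (auto simp: fun_eq_iff restrict_def bij_betw_def extensional_def)
  qed
  show "(\<lambda>p. restrict (p \<circ> s) {..<CARD('n)}) ` {p. p permutes (UNIV :: 'n set)}
    \<subseteq> {t\<in>multi_indices. bij_betw t {..<CARD('n)} UNIV}"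
  proof (rule image_subsetI)
    fix p :: "'n \<Rightarrow> 'n" assume "p \<in> {p. p permutes UNIV}"
    then have "bij_betw (p \<circ> s) {..<CARD('n)} UNIV"
      using bij_betw_trans[OF s permutes_imp_bij] by blast
    then have "bij_betw (restrict (p \<circ> s) {..<CARD('n)}) {..<CARD('n)} UNIV"
      by (rule iffD1[OF bij_betw_cong, rotated]) simp
    then show "restrict (p \<circ> s) {..<CARD('n)} \<in> {t\<in>multi_indices. bij_betw t {..<CARD('n)} UNIV}"
      by (simp add: multi_indices_def)
  qed
  show "(\<lambda>t. t \<circ> inv_into {..<CARD('n)} s) ` {t\<in>multi_indices. bij_betw t {..<CARD('n)} UNIV} \<subseteq> {p. p permutes UNIV}"
  proof (rule image_subsetI)
    fix t assume "t \<in> {t\<in>(multi_indices :: (nat \<Rightarrow> 'n) set). bij_betw t {..<CARD('n)} UNIV}"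
    then have "bij_betw (t \<circ> inv_into {..<CARD('n)} s) UNIV UNIV"
      using bij_betw_trans[OF bij_betw_inv_into[OF s]] by blast
    then show "t \<circ> inv_into {..<CARD('n)} s \<in> {p. p permutes UNIV}"
      by (auto intro: bij_imp_permutes)
  qed
qed

text \<open>The Leibniz formula for the determinant, in the form that is used with multi-indices.\<close>

lemma sum_levi_civita_det:
  fixes M :: "real ^ 'n::finite ^ 'n"
  shows "(\<Sum>t\<in>multi_indices. (\<Prod>r<CARD('n). M $ s r $ t r) * levi_civita t) = levi_civita s * det M"
proof (cases "bij_betw s {..<CARD('n)} UNIV")
  case True
  have "(\<Sum>t\<in>multi_indices. (\<Prod>r<CARD('n). M $ s r $ t r) * levi_civita t) =
      (\<Sum>t\<in>{t\<in>multi_indices. bij_betw t {..<CARD('n)} UNIV}. (\<Prod>r<CARD('n). M $ s r $ t r) * levi_civita t)"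
    by (rule sum.mono_neutral_right) (auto simp: finite_multi_indices levi_civita_def)
  also have "\<dots> = (\<Sum>p | p permutes (UNIV :: 'n set).
      (\<Prod>r<CARD('n). M $ s r $ (restrict (p \<circ> s) {..<CARD('n)} r)) * levi_civita (restrict (p \<circ> s) {..<CARD('n)}))"
    by (rule sum.reindex_bij_betw[OF bij_multi_indices[OF True], symmetric])
  also have "\<dots> = (\<Sum>p | p permutes (UNIV :: 'n set). levi_civita s * (of_int (sign p) * (\<Prod>i\<in>UNIV. M $ i $ p i)))"
  proof (rule sum.cong[OF refl])
    fix p assume p: "p \<in> {p. p permutes (UNIV :: 'n set)}"
    have "(\<Prod>r<CARD('n). M $ s r $ (restrict (p \<circ> s) {..<CARD('n)} r)) = (\<Prod>r<CARD('n). M $ s r $ p (s r))"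
      by (rule prod.cong) auto
    also have "\<dots> = (\<Prod>i\<in>UNIV. M $ i $ p i)"
      by (rule prod.reindex_bij_betw[OF True])
    finally show "(\<Prod>r<CARD('n). M $ s r $ (restrict (p \<circ> s) {..<CARD('n)} r)) * levi_civita (restrict (p \<circ> s) {..<CARD('n)}) =
        levi_civita s * (of_int (sign p) * (\<Prod>i\<in>UNIV. M $ i $ p i))"
      using p by (simp add: levi_civita_restrict levi_civita_permute_values[OF True])
  qed
  also have "\<dots> = levi_civita s * det M"
    by (simp add: det_def sum_distrib_left)
  finally show ?thesis .
next
  case False
  have "\<not> inj_on s {..<CARD('n)}"
  proof
    assume inj: "inj_on s {..<CARD('n)}"
    have "card (s ` {..<CARD('n)}) = CARD('n)" using card_image[OF inj] by simp
    then have "s ` {..<CARD('n)} = UNIV" by (intro card_subset_eq) auto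
    with inj False show False by (simp add: bij_betw_def)
  qed
  then obtain i j where ij: "i < CARD('n)" "j < CARD('n)" "i \<noteq> j" "s i = s j"
    by (auto simp: inj_on_def)
  have tr: "Transposition.transpose i j permutes {..<CARD('n)}"
    using ij by (intro permutes_swap_id) auto
  define S where "S = (\<Sum>t\<in>multi_indices. (\<Prod>r<CARD('n). M $ s r $ t r) * levi_civita t)"
  have prod: "(\<Prod>r<CARD('n). M $ s r $ t (Transposition.transpose i j r)) = (\<Prod>r<CARD('n). M $ s r $ t r)" for t
  proof -
    have "s (Transposition.transpose i j r) = s r" for r
      using ij(4) by (auto simp: Transposition.transpose_def)
    then have "(\<Prod>r<CARD('n). M $ s r $ t (Transposition.transpose i j r)) =
        (\<Prod>r<CARD('n). M $ s (Transposition.transpose i j r) $ t (Transposition.transpose i j r))" by simp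
    also have "\<dots> = (\<Prod>r<CARD('n). M $ s r $ t r)"
      by (rule prod.reindex_bij_betw[OF permutes_imp_bij[OF tr]])
    finally show ?thesis .
  qed
  have "S = (\<Sum>t\<in>multi_indices. (\<Prod>r<CARD('n). M $ s r $ (t \<circ> Transposition.transpose i j) r) * levi_civita (t \<circ> Transposition.transpose i j))"
    unfolding S_def by (rule sum_multi_indices_permute[OF tr, symmetric])
  also have "\<dots> = - S"
    unfolding S_def levi_civita_compose[OF tr] using ij(3) by (simp add: prod sign_swap_id sum_negf)
  finally have "S = 0" by simp
  then show ?thesis
    using False unfolding S_def by (simp add: levi_civita_def)
qed

text \<open>Each permutation of the rows contributes one copy of the determinant.\<close>

lemma double_sum_levi_civita_det:
  fixes M :: "real ^ 'n::finite ^ 'n"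
  shows "(\<Sum>s\<in>multi_indices. \<Sum>t\<in>multi_indices. levi_civita s * levi_civita t * (\<Prod>r<CARD('n). M $ s r $ t r)) =
    fact CARD('n) * det M"
proof -
  obtain e :: "nat \<Rightarrow> 'n" where e: "bij_betw e {..<CARD('n)} UNIV"
    using ex_bij_betw_nat_finite[of "UNIV :: 'n set"] by (auto simp: lessThan_atLeast0)
  have "(\<Sum>s\<in>multi_indices. \<Sum>t\<in>multi_indices. levi_civita s * levi_civita t * (\<Prod>r<CARD('n). M $ s r $ t r)) =
      (\<Sum>(s :: nat \<Rightarrow> 'n)\<in>multi_indices. levi_civita s * (\<Sum>t\<in>multi_indices. (\<Prod>r<CARD('n). M $ s r $ t r) * levi_civita t))"
    by (simp add: sum_distrib_left mult_ac)
  also have "\<dots> = (\<Sum>(s :: nat \<Rightarrow> 'n)\<in>multi_indices. levi_civita s * levi_civita s * det M)"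
    by (simp add: sum_levi_civita_det mult.assoc)
  also have "\<dots> = (\<Sum>s\<in>{s\<in>multi_indices. bij_betw s {..<CARD('n)} (UNIV :: 'n set)}. det M)"
  proof -
    have "levi_civita s * levi_civita s * det M = (if bij_betw s {..<CARD('n)} UNIV then det M else 0)"
      for s :: "nat \<Rightarrow> 'n"
      using levi_civita_bij[of s] by (auto simp: levi_civita_def)
    then show ?thesis
      by (simp only: sum.inter_filter[OF finite_multi_indices])
  qed
  also have "\<dots> = real (card {p. p permutes (UNIV :: 'n set)}) * det M"
    using bij_betw_same_card[OF bij_multi_indices[OF e]] by simp
  finally show ?thesis
    by (simp add: card_permutations[OF refl])
qed

text \<open>The polarisation of the determinant of \<open>G + tL\<close>: the factors with position in \<open>A\<close> are
  entries of \<open>L\<close>, the other ones entries of \<open>G\<close>.\<close>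

definition mixed_sum :: "real ^ 'n::finite ^ 'n \<Rightarrow> real ^ 'n ^ 'n \<Rightarrow> nat set \<Rightarrow> real" where
  "mixed_sum G L A = (\<Sum>s\<in>multi_indices. \<Sum>t\<in>multi_indices. levi_civita s * levi_civita t *
     (\<Prod>r<CARD('n). if r \<in> A then L $ s r $ t r else G $ s r $ t r))"

lemma mixed_sum_permute:
  fixes G L :: "real ^ 'n::finite ^ 'n"
  assumes p: "\<pi> permutes {..<CARD('n)}"
  shows "mixed_sum G L {r. \<pi> r \<in> A} = mixed_sum G L A"
proof -
  have "mixed_sum G L {r. \<pi> r \<in> A} = (\<Sum>s\<in>multi_indices. \<Sum>t\<in>multi_indices. levi_civita (s \<circ> \<pi>) * levi_civita (t \<circ> \<pi>) *
     (\<Prod>r<CARD('n). if \<pi> r \<in> A then L $ (s \<circ> \<pi>) r $ (t \<circ> \<pi>) r else G $ (s \<circ> \<pi>) r $ (t \<circ> \<pi>) r))"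
    unfolding mixed_sum_def
    by (subst sum_multi_indices_permute[OF p, symmetric], rule sum.cong[OF refl],
        subst sum_multi_indices_permute[OF p, symmetric]) simp
  also have "\<dots> = (\<Sum>s\<in>multi_indices. \<Sum>t\<in>multi_indices. levi_civita s * levi_civita t *
     (\<Prod>r<CARD('n). if \<pi> r \<in> A then L $ s (\<pi> r) $ t (\<pi> r) else G $ s (\<pi> r) $ t (\<pi> r)))"
  proof (intro sum.cong refl)
    fix s t :: "nat \<Rightarrow> 'n"
    have "levi_civita (s \<circ> \<pi>) * levi_civita (t \<circ> \<pi>) = of_int (sign \<pi> * sign \<pi>) * (levi_civita s * levi_civita t)"
      unfolding levi_civita_compose[OF p] of_int_mult by (simp add: ac_simps)
    then have e: "levi_civita (s \<circ> \<pi>) * levi_civita (t \<circ> \<pi>) = levi_civita s * levi_civita t"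
      by simp
    then show "levi_civita (s \<circ> \<pi>) * levi_civita (t \<circ> \<pi>) *
       (\<Prod>r<CARD('n). if \<pi> r \<in> A then L $ (s \<circ> \<pi>) r $ (t \<circ> \<pi>) r else G $ (s \<circ> \<pi>) r $ (t \<circ> \<pi>) r) =
      levi_civita s * levi_civita t *
       (\<Prod>r<CARD('n). if \<pi> r \<in> A then L $ s (\<pi> r) $ t (\<pi> r) else G $ s (\<pi> r) $ t (\<pi> r))"
      by (simp only: e comp_apply)
  qed
  also have "\<dots> = mixed_sum G L A"
    unfolding mixed_sum_def
    by (intro sum.cong refl arg_cong[of _ _ "\<lambda>z. _ * z"] prod.reindex_bij_betw[OF permutes_imp_bij[OF p]])
  finally show ?thesis .
qed

lemma mixed_sum_card:
  fixes G L :: "real ^ 'n::finite ^ 'n"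
  assumes "A \<subseteq> {..<CARD('n)}" "B \<subseteq> {..<CARD('n)}" "card A = card B"
  shows "mixed_sum G L A = mixed_sum G L B"
proof -
  have fin: "finite A" "finite B" using assms finite_subset by blast+
  obtain f where f: "bij_betw f A B"
    using finite_same_card_bij[OF fin assms(3)] by blast
  have "card ({..<CARD('n)} - A) = card ({..<CARD('n)} - B)"
    using assms fin by (simp add: card_Diff_subset)
  then obtain f' where f': "bij_betw f' ({..<CARD('n)} - A) ({..<CARD('n)} - B)"
    using finite_same_card_bij[of "{..<CARD('n)} - A" "{..<CARD('n)} - B"] by auto
  define \<pi> where "\<pi> r = (if r \<in> A then f r else if r < CARD('n) then f' r else r)" for r
  have "bij_betw \<pi> A B"
    by (rule iffD1[OF bij_betw_cong f]) (simp add: \<pi>_def)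
  moreover have "bij_betw \<pi> ({..<CARD('n)} - A) ({..<CARD('n)} - B)"
    by (rule iffD1[OF bij_betw_cong f']) (simp add: \<pi>_def)
  ultimately have "bij_betw \<pi> (A \<union> ({..<CARD('n)} - A)) (B \<union> ({..<CARD('n)} - B))"
    by (rule bij_betw_combine) auto
  moreover have "A \<union> ({..<CARD('n)} - A) = {..<CARD('n)}" "B \<union> ({..<CARD('n)} - B) = {..<CARD('n)}"
    using assms by auto
  ultimately have "bij_betw \<pi> {..<CARD('n)} {..<CARD('n)}" by simp
  then have p: "\<pi> permutes {..<CARD('n)}"
    by (rule bij_imp_permutes) (use assms(1) in \<open>auto simp: \<pi>_def\<close>)
  have "r \<in> A \<longleftrightarrow> \<pi> r \<in> B" if "r < CARD('n)" for r
    using that bij_betwE[OF f] bij_betwE[OF f'] by (auto simp: \<pi>_def)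
  then have "mixed_sum G L A = mixed_sum G L {r. \<pi> r \<in> B}"
    unfolding mixed_sum_def by (intro sum.cong refl arg_cong[of _ _ "\<lambda>z. _ * z"] prod.cong) auto
  then show ?thesis
    using mixed_sum_permute[OF p] by simp
qed

text \<open>Expanding the product of the entries of \<open>G + tL\<close> in the double sum, the term of a set of
  positions depends on the number of its elements only.\<close>

lemma det_pencil:
  fixes G L :: "real ^ 'n::finite ^ 'n"
  shows "fact CARD('n) * det (G + t *\<^sub>R L) =
    (\<Sum>k\<le>CARD('n). of_nat (CARD('n) choose k) * mixed_sum G L {..<k} * t ^ k)"
proof -
  let ?n = "CARD('n)"
  have expand: "(\<Prod>r<?n. (G + t *\<^sub>R L) $ s r $ u r) =
      (\<Sum>A\<in>Pow {..<?n}. t ^ card A * (\<Prod>r<?n. if r \<in> A then L $ s r $ u r else G $ s r $ u r))" for s u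
  proof -
    have "(\<Prod>r<?n. (G + t *\<^sub>R L) $ s r $ u r) = (\<Prod>r<?n. t * L $ s r $ u r + G $ s r $ u r)"
      by (simp add: add.commute)
    also have "\<dots> = (\<Sum>A\<in>Pow {..<?n}. (\<Prod>r\<in>A. t * L $ s r $ u r) * (\<Prod>r\<in>{..<?n} - A. G $ s r $ u r))"
      by (rule prod_add) simp
    also have "\<dots> = (\<Sum>A\<in>Pow {..<?n}. t ^ card A * (\<Prod>r<?n. if r \<in> A then L $ s r $ u r else G $ s r $ u r))"
    proof (rule sum.cong[OF refl])
      fix A assume A: "A \<in> Pow {..<?n}"
      then have "{..<?n} \<inter> A = A" "{..<?n} \<inter> - A = {..<?n} - A" by auto
      then show "(\<Prod>r\<in>A. t * L $ s r $ u r) * (\<Prod>r\<in>{..<?n} - A. G $ s r $ u r) =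
          t ^ card A * (\<Prod>r<?n. if r \<in> A then L $ s r $ u r else G $ s r $ u r)"
        by (simp add: prod.distrib prod.If_cases)
    qed
    finally show ?thesis .
  qed
  have "fact ?n * det (G + t *\<^sub>R L) = (\<Sum>s\<in>multi_indices. \<Sum>u\<in>multi_indices. \<Sum>A\<in>Pow {..<?n}.
      t ^ card A * (levi_civita s * levi_civita u * (\<Prod>r<?n. if r \<in> A then L $ s r $ u r else G $ s r $ u r)))"
    unfolding double_sum_levi_civita_det[symmetric] expand by (simp add: sum_distrib_left mult_ac)
  also have "\<dots> = (\<Sum>A\<in>Pow {..<?n}. \<Sum>s\<in>multi_indices. \<Sum>u\<in>multi_indices.
      t ^ card A * (levi_civita s * levi_civita u * (\<Prod>r<?n. if r \<in> A then L $ s r $ u r else G $ s r $ u r)))"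
    by (subst sum.swap[of _ "Pow {..<?n}"], subst sum.swap[of _ "Pow {..<?n}"]) (rule refl)
  also have "\<dots> = (\<Sum>A\<in>Pow {..<?n}. t ^ card A * mixed_sum G L A)"
    by (simp add: mixed_sum_def sum_distrib_left)
  also have "\<dots> = (\<Sum>k\<le>?n. \<Sum>A\<in>{A\<in>Pow {..<?n}. card A = k}. t ^ card A * mixed_sum G L A)"
    by (rule sum.group[symmetric]) (use card_mono[of "{..<?n}"] in auto)
  also have "\<dots> = (\<Sum>k\<le>?n. of_nat (?n choose k) * mixed_sum G L {..<k} * t ^ k)"
  proof (rule sum.cong[OF refl])
    fix k assume k: "k \<in> {..?n}"
    have "(\<Sum>A\<in>{A\<in>Pow {..<?n}. card A = k}. t ^ card A * mixed_sum G L A) =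
        (\<Sum>A\<in>{A\<in>Pow {..<?n}. card A = k}. t ^ k * mixed_sum G L {..<k})"
      using k by (intro sum.cong refl) (auto intro!: mixed_sum_card)
    also have "\<dots> = of_nat (card {A. A \<subseteq> {..<?n} \<and> card A = k}) * (t ^ k * mixed_sum G L {..<k})"
      by simp
    also have "card {A. A \<subseteq> {..<?n} \<and> card A = k} = ?n choose k"
      using n_subsets[of "{..<?n}" k] by simp
    finally show "(\<Sum>A\<in>{A\<in>Pow {..<?n}. card A = k}. t ^ card A * mixed_sum G L A) =
        of_nat (?n choose k) * mixed_sum G L {..<k} * t ^ k" by simp
  qed
  finally show ?thesis .
qed

text \<open>The tensor may depend on the position \<open>r\<close> of its factor, so that the factors of the Pfaffian
  can be replaced one at a time.\<close>

definition pair_sum :: "(nat \<Rightarrow> 'n::finite \<Rightarrow> 'n \<Rightarrow> 'n \<Rightarrow> 'n \<Rightarrow> real) \<Rightarrow> real" where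
  "pair_sum X = (\<Sum>s\<in>multi_indices. \<Sum>t\<in>multi_indices. levi_civita s * levi_civita t *
     (\<Prod>r<CARD('n) div 2. X r (s (2 * r)) (s (2 * r + 1)) (t (2 * r)) (t (2 * r + 1))))"

lemma prod_update:
  assumes "finite S" "k \<in> S"
  shows "(\<Prod>r\<in>S. (Y(k := c)) r) = c * (\<Prod>r\<in>S - {k}. Y r :: 'b::comm_monoid_mult)"
proof -
  have "(\<Prod>r\<in>S. (Y(k := c)) r) = c * (\<Prod>r\<in>S - {k}. (Y(k := c)) r)"
    using prod.remove[OF assms, of "Y(k := c)"] by simp
  also have "(\<Prod>r\<in>S - {k}. (Y(k := c)) r) = (\<Prod>r\<in>S - {k}. Y r)"
    by (rule prod.cong) auto
  finally show ?thesis .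
qed

lemma pair_sum_update:
  fixes X :: "nat \<Rightarrow> 'n::finite \<Rightarrow> 'n \<Rightarrow> 'n \<Rightarrow> 'n \<Rightarrow> real"
  assumes "k < CARD('n) div 2"
  shows "pair_sum (X(k := Z)) = (\<Sum>s\<in>multi_indices. \<Sum>t\<in>multi_indices. levi_civita s * levi_civita t *
     (Z (s (2 * k)) (s (2 * k + 1)) (t (2 * k)) (t (2 * k + 1)) *
      (\<Prod>r\<in>{..<CARD('n) div 2} - {k}. X r (s (2 * r)) (s (2 * r + 1)) (t (2 * r)) (t (2 * r + 1)))))"
proof -
  have "(\<Prod>r<CARD('n) div 2. (X(k := Z)) r (s (2 * r)) (s (2 * r + 1)) (t (2 * r)) (t (2 * r + 1))) =
     Z (s (2 * k)) (s (2 * k + 1)) (t (2 * k)) (t (2 * k + 1)) *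
      (\<Prod>r\<in>{..<CARD('n) div 2} - {k}. X r (s (2 * r)) (s (2 * r + 1)) (t (2 * r)) (t (2 * r + 1)))"
    for s t :: "nat \<Rightarrow> 'n"
  proof -
    have "(\<Prod>r<CARD('n) div 2. (X(k := Z)) r (s (2 * r)) (s (2 * r + 1)) (t (2 * r)) (t (2 * r + 1))) =
       (\<Prod>r<CARD('n) div 2. ((\<lambda>r. X r (s (2 * r)) (s (2 * r + 1)) (t (2 * r)) (t (2 * r + 1)))
         (k := Z (s (2 * k)) (s (2 * k + 1)) (t (2 * k)) (t (2 * k + 1)))) r)"
      by (rule prod.cong) auto
    then show ?thesis
      using assms by (simp only: prod_update finite_lessThan lessThan_iff)
  qed
  then show ?thesis unfolding pair_sum_def by simp
qed

lemma pair_sum_linear: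
  fixes X :: "nat \<Rightarrow> 'n::finite \<Rightarrow> 'n \<Rightarrow> 'n \<Rightarrow> 'n \<Rightarrow> real"
  assumes "k < CARD('n) div 2"
  shows "pair_sum (X(k := (\<lambda>a b c d. Z a b c d + Z' a b c d))) = pair_sum (X(k := Z)) + pair_sum (X(k := Z'))"
    and "pair_sum (X(k := (\<lambda>a b c d. x * Z a b c d))) = x * pair_sum (X(k := Z))"
  unfolding pair_sum_update[OF assms]
  by (simp_all add: algebra_simps sum.distrib sum_distrib_left)

text \<open>The Levi-Civita symbol changes its sign when two positions of the multi-index are exchanged.\<close>

lemma pair_sum_swap:
  fixes X :: "nat \<Rightarrow> 'n::finite \<Rightarrow> 'n \<Rightarrow> 'n \<Rightarrow> 'n \<Rightarrow> real"
  assumes k: "k < CARD('n) div 2"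
  shows "pair_sum (X(k := (\<lambda>a b c d. Z b a c d))) = - pair_sum (X(k := Z))"
    and "pair_sum (X(k := (\<lambda>a b c d. Z a b d c))) = - pair_sum (X(k := Z))"
proof -
  let ?\<tau> = "Transposition.transpose (2 * k) (2 * k + 1)"
  have "2 * k + 1 < CARD('n)" using k by linarith
  then have tr: "?\<tau> permutes {..<CARD('n)}"
    by (intro permutes_swap_id) auto
  have eps: "levi_civita (s \<circ> ?\<tau>) = - levi_civita s" for s :: "nat \<Rightarrow> 'n"
    unfolding levi_civita_compose[OF tr] by (simp add: sign_swap_id)
  have val: "(s \<circ> ?\<tau>) (2 * k) = s (2 * k + 1)" "(s \<circ> ?\<tau>) (2 * k + 1) = s (2 * k)"
    "r \<noteq> k \<Longrightarrow> (s \<circ> ?\<tau>) (2 * r) = s (2 * r)" "r \<noteq> k \<Longrightarrow> (s \<circ> ?\<tau>) (2 * r + 1) = s (2 * r + 1)"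
    for s :: "nat \<Rightarrow> 'n" and r
  proof -
    assume "r \<noteq> k"
    then have "2 * r \<noteq> 2 * k" "2 * r \<noteq> 2 * k + 1" "2 * r + 1 \<noteq> 2 * k" "2 * r + 1 \<noteq> 2 * k + 1"
      by presburger+
    then show "(s \<circ> ?\<tau>) (2 * r) = s (2 * r)" "(s \<circ> ?\<tau>) (2 * r + 1) = s (2 * r + 1)"
      by (simp_all only: comp_apply transpose_apply_other simp_thms)
  qed (simp_all add: comp_def)
  have rest: "(\<Prod>r\<in>{..<CARD('n) div 2} - {k}. X r ((s \<circ> ?\<tau>) (2 * r)) ((s \<circ> ?\<tau>) (2 * r + 1)) (t (2 * r)) (t (2 * r + 1))) =
      (\<Prod>r\<in>{..<CARD('n) div 2} - {k}. X r (s (2 * r)) (s (2 * r + 1)) (t (2 * r)) (t (2 * r + 1)))"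
    "(\<Prod>r\<in>{..<CARD('n) div 2} - {k}. X r (t (2 * r)) (t (2 * r + 1)) ((s \<circ> ?\<tau>) (2 * r)) ((s \<circ> ?\<tau>) (2 * r + 1))) =
      (\<Prod>r\<in>{..<CARD('n) div 2} - {k}. X r (t (2 * r)) (t (2 * r + 1)) (s (2 * r)) (s (2 * r + 1)))"
    for s t :: "nat \<Rightarrow> 'n"
    by (rule prod.cong[OF refl], simp only: val Diff_iff singleton_iff simp_thms)+
  show "pair_sum (X(k := (\<lambda>a b c d. Z b a c d))) = - pair_sum (X(k := Z))"
    unfolding pair_sum_update[OF k]
    by (subst sum_multi_indices_permute[OF tr, symmetric])
      (simp only: val(1,2) rest eps mult_minus_left sum_negf)
  show "pair_sum (X(k := (\<lambda>a b c d. Z a b d c))) = - pair_sum (X(k := Z))"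
    unfolding pair_sum_update[OF k] sum_negf[symmetric]
    by (rule sum.cong[OF refl], subst sum_multi_indices_permute[OF tr, symmetric])
      (simp only: val(1,2) rest eps mult_minus_left mult_minus_right sum_negf)
qed

text \<open>By the antisymmetry in both pairs, the four terms of a curvature tensor of conformally flat type
  contribute equally to each factor of the Pfaffian.\<close>

lemma pair_sum_curvature:
  fixes L G :: "real ^ 'n::finite ^ 'n"
  defines "R \<equiv> \<lambda>a b c d. L $ a $ c * G $ b $ d - L $ a $ d * G $ b $ c - L $ b $ c * G $ a $ d + L $ b $ d * G $ a $ c"
    and "Q \<equiv> \<lambda>a b c d. L $ a $ c * G $ b $ d"
  shows "pair_sum (\<lambda>_. R) = 4 ^ (CARD('n) div 2) * pair_sum (\<lambda>_. Q)"
proof -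
  have step: "pair_sum (X(k := R)) = 4 * pair_sum (X(k := Q))" if k: "k < CARD('n) div 2" for X k
  proof -
    have R: "R = (\<lambda>a b c d. (Q a b c d + - 1 * Q a b d c) + (- 1 * Q b a c d + Q b a d c))"
      by (simp add: R_def Q_def fun_eq_iff)
    have 1: "pair_sum (X(k := (\<lambda>a b c d. Q b a d c))) = pair_sum (X(k := Q))"
      using pair_sum_swap(1)[OF k, of X "\<lambda>a b c d. Q a b d c"] pair_sum_swap(2)[OF k, of X Q] by simp
    show ?thesis
      unfolding R pair_sum_linear[OF k] pair_sum_swap[OF k, of X Q] 1 by simp
  qed
  have "pair_sum (\<lambda>_. R) = 4 ^ k * pair_sum (\<lambda>r. if r < k then Q else R)" if "k \<le> CARD('n) div 2" for k
    using that
  proof (induction k)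
    case (Suc k)
    let ?X = "\<lambda>r. if r < k then Q else R"
    have "pair_sum ?X = pair_sum (?X(k := R))"
      by (rule arg_cong[of _ _ pair_sum]) (simp add: fun_eq_iff)
    also have "\<dots> = 4 * pair_sum (?X(k := Q))"
      using Suc.prems by (intro step) simp
    also have "?X(k := Q) = (\<lambda>r. if r < Suc k then Q else R)"
      by (auto simp: fun_eq_iff less_Suc_eq)
    finally show ?case using Suc by simp
  qed simp
  from this[OF order_refl] have "pair_sum (\<lambda>_. R) = 4 ^ (CARD('n) div 2) * pair_sum (\<lambda>r. if r < CARD('n) div 2 then Q else R)" .
  also have "pair_sum (\<lambda>r. if r < CARD('n) div 2 then Q else R) = pair_sum (\<lambda>_. Q)"
    unfolding pair_sum_def by (intro sum.cong refl arg_cong[of _ _ "\<lambda>z. _ * z"] prod.cong) simp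
  finally show ?thesis .
qed

lemma prod_pairs: "(\<Prod>r<2 * m. f r) = (\<Prod>r<m. f (2 * r) * f (2 * r + 1))" for f :: "nat \<Rightarrow> real"
  by (induction m) (simp_all add: mult.assoc)

text \<open>The product of the tensors has one factor \<open>L\<close> and one factor \<open>G\<close> for every pair of positions; it
  is a permutation of the product in which the first half of the positions carries \<open>L\<close>.\<close>

lemma pair_sum_mixed:
  fixes L G :: "real ^ 'n::finite ^ 'n"
  assumes "even CARD('n)"
  shows "pair_sum (\<lambda>_ a b c d. L $ a $ c * G $ b $ d) = mixed_sum G L {..<CARD('n) div 2}"
proof -
  let ?N = "CARD('n) div 2"
  have n: "CARD('n) = 2 * ?N" using assms by simp
  have "pair_sum (\<lambda>_ a b c d. L $ a $ c * G $ b $ d) = mixed_sum G L ((\<lambda>r. 2 * r) ` {..<?N})"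
    unfolding pair_sum_def mixed_sum_def
  proof (intro sum.cong refl arg_cong[of _ _ "\<lambda>z. _ * z"])
    fix s t :: "nat \<Rightarrow> 'n"
    let ?f = "\<lambda>r. if r \<in> (\<lambda>r. 2 * r) ` {..<?N} then L $ s r $ t r else G $ s r $ t r"
    have "(\<Prod>r<CARD('n). ?f r) = (\<Prod>r<2 * ?N. ?f r)"
      using n by simp
    also have "\<dots> = (\<Prod>r<?N. ?f (2 * r) * ?f (2 * r + 1))"
      by (rule prod_pairs)
    also have "\<dots> = (\<Prod>r<?N. L $ s (2 * r) $ t (2 * r) * G $ s (2 * r + 1) $ t (2 * r + 1))"
    proof (rule prod.cong[OF refl])
      fix r assume r: "r \<in> {..<?N}"
      have "2 * r + 1 \<notin> (\<lambda>r. 2 * r) ` {..<?N}" by (auto, presburger)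
      with r show "?f (2 * r) * ?f (2 * r + 1) = L $ s (2 * r) $ t (2 * r) * G $ s (2 * r + 1) $ t (2 * r + 1)"
        by simp
    qed
    finally show "(\<Prod>r<?N. L $ s (2 * r) $ t (2 * r) * G $ s (2 * r + 1) $ t (2 * r + 1)) = (\<Prod>r<CARD('n). ?f r)" ..
  qed
  also have "\<dots> = mixed_sum G L {..<?N}"
  proof (rule mixed_sum_card)
    show "(\<lambda>r. 2 * r) ` {..<?N} \<subseteq> {..<CARD('n)}" by auto
    show "card ((\<lambda>r. 2 * r) ` {..<?N}) = card {..<?N}" by (rule card_image) (simp add: inj_on_def)
  qed simp
  finally show ?thesis .
qed

text \<open>The sign \<open>(-1)\<^sup>q\<close> in the Pfaffian is the sign of \<open>det G\<close>.\<close>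

lemma form_signature_det:
  fixes G :: "real ^ 'n::finite ^ 'n"
  assumes "form_signature p q G"
  shows "(-1) ^ q * \<bar>det G\<bar> = det G" "det G \<noteq> 0"
proof -
  obtain B :: "real ^ 'n ^ 'n" and \<sigma> where B: "invertible B"
    "Finite_Cartesian_Product.transpose B ** G ** B = (\<chi> i j. if i = j then \<sigma> i else 0)"
    and \<sigma>: "\<And>i. \<sigma> i = 1 \<or> \<sigma> i = -1" "card {i. \<sigma> i = -1} = q"
    using assms unfolding form_signature_def by blast
  have "det B * det G * det B = det (Finite_Cartesian_Product.transpose B ** G ** B)"
    by (simp add: det_mul)
  also have "\<dots> = (\<Prod>i\<in>UNIV. \<sigma> i)"
    unfolding B(2) by (subst det_diagonal) auto
  also have "\<dots> = (\<Prod>i\<in>UNIV. if \<sigma> i = -1 then -1 else 1)"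
    using \<sigma>(1) by (intro prod.cong) auto
  also have "\<dots> = (-1) ^ q"
    by (simp add: prod.If_cases \<sigma>(2))
  finally have e: "(det B)\<^sup>2 * det G = (-1) ^ q" by (simp add: power2_eq_square mult_ac)
  have b: "(det B)\<^sup>2 > 0"
    using B(1) by (simp add: invertible_det_nz)
  show "det G \<noteq> 0" using e by auto
  have "(-1) ^ q = (1 :: real) \<or> (-1) ^ q = (-1 :: real)"
    by (metis neg_one_even_power neg_one_odd_power)
  then show "(-1) ^ q * \<bar>det G\<bar> = det G"
  proof
    assume "(-1) ^ q = (1 :: real)"
    then have "det G > 0" using e b by (metis zero_less_mult_pos zero_less_one)
    then show ?thesis using \<open>(-1) ^ q = (1 :: real)\<close> by simp
  next
    assume q: "(-1) ^ q = (-1 :: real)"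
    then have "det G < 0" using e b by (metis mult_pos_pos neg_less_0_iff_less not_less_iff_gr_or_eq zero_less_one mult_zero_right \<open>det G \<noteq> 0\<close>)
    then show ?thesis using q by simp
  qed
qed

lemma matrix_inv_inverse:
  fixes G :: "real ^ 'n::finite ^ 'n"
  assumes "invertible G" shows "G ** matrix_inv G = mat 1" "matrix_inv G ** G = mat 1"
  using someI_ex[OF assms[unfolded invertible_def]] by (simp_all add: matrix_inv_def)

lemma det_matrix_inv:
  fixes G :: "real ^ 'n::finite ^ 'n"
  assumes "invertible G" shows "det (matrix_inv G) = 1 / det G"
proof -
  have "det G * det (matrix_inv G) = 1"
    using matrix_inv_inverse(1)[OF assms] by (metis det_I det_mul)
  then show ?thesis by (metis divide_eq_eq mult.commute mult_zero_left zero_neq_one)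
qed

text \<open>The Pfaffian of a curvature tensor of conformally flat type is the middle coefficient of
  the characteristic pencil.\<close>

lemma pfaffian_pencil:
  fixes G L :: "real ^ 'n::finite ^ 'n"
  assumes n: "even CARD('n)" and G: "form_signature p q G"
    and R: "\<And>a b c d. R a b c d = L $ a $ c * G $ b $ d - L $ a $ d * G $ b $ c - L $ b $ c * G $ a $ d + L $ b $ d * G $ a $ c"
  shows "(-1) ^ q / (2 ^ CARD('n) * fact (CARD('n) div 2)) *
     (\<Sum>s\<in>multi_indices. \<Sum>t\<in>multi_indices. vol_form_up G s * vol_form_up G t *
        (\<Prod>r<CARD('n) div 2. R (s (2 * r)) (s (2 * r + 1)) (t (2 * r)) (t (2 * r + 1)))) =
     mixed_sum G L {..<CARD('n) div 2} / (fact (CARD('n) div 2) * det G)"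
proof -
  let ?N = "CARD('n) div 2"
  have nz: "det G \<noteq> 0" and sgn: "(-1) ^ q * \<bar>det G\<bar> = det G"
    using form_signature_det[OF G] by auto
  have inv: "invertible G" using nz by (simp add: invertible_det_nz)
  have Req: "R = (\<lambda>a b c d. L $ a $ c * G $ b $ d - L $ a $ d * G $ b $ c - L $ b $ c * G $ a $ d + L $ b $ d * G $ a $ c)"
    by (simp add: fun_eq_iff R)
  have up: "vol_form_up G s = sqrt \<bar>det G\<bar> / det G * levi_civita s" for s
  proof -
    have "vol_form_up G s = sqrt \<bar>det G\<bar> *
        (\<Sum>t\<in>multi_indices. (\<Prod>r<CARD('n). matrix_inv G $ s r $ t r) * levi_civita t)"
      by (simp add: vol_form_up_def vol_form_def sum_distrib_left mult_ac)
    then show ?thesis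
      unfolding sum_levi_civita_det det_matrix_inv[OF inv] by simp
  qed
  have "vol_form_up G s * vol_form_up G t = \<bar>det G\<bar> / (det G * det G) * (levi_civita s * levi_civita t)" for s t
    unfolding up by simp
  then have "(\<Sum>s\<in>multi_indices. \<Sum>t\<in>multi_indices. vol_form_up G s * vol_form_up G t *
        (\<Prod>r<?N. R (s (2 * r)) (s (2 * r + 1)) (t (2 * r)) (t (2 * r + 1)))) =
      \<bar>det G\<bar> / (det G * det G) * pair_sum (\<lambda>_. R)"
    by (simp add: pair_sum_def sum_distrib_left mult.assoc)
  also have "pair_sum (\<lambda>_. R) = 4 ^ ?N * mixed_sum G L {..<?N}"
    unfolding Req pair_sum_curvature pair_sum_mixed[OF n] ..
  also have "(4 :: real) ^ ?N = 2 ^ CARD('n)"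
  proof -
    have "(4 :: real) ^ ?N = (2 ^ 2) ^ ?N" by simp
    also have "\<dots> = 2 ^ (2 * ?N)" by (rule power_mult[symmetric])
    finally show ?thesis using n by simp
  qed
  finally have *: "(\<Sum>s\<in>multi_indices. \<Sum>t\<in>multi_indices. vol_form_up G s * vol_form_up G t *
        (\<Prod>r<?N. R (s (2 * r)) (s (2 * r + 1)) (t (2 * r)) (t (2 * r + 1)))) =
      \<bar>det G\<bar> / (det G * det G) * (2 ^ CARD('n) * mixed_sum G L {..<?N})" .
  show ?thesis
    unfolding * using sgn nz by (simp add: field_simps)
qed

section \<open>Curvature of metrics through germs\<close>

definition represents_mat :: "'v::real_normed_vector \<Rightarrow> ('v \<Rightarrow> real ^ 'n ^ 'n) \<Rightarrow> ('v germ, 'n) sqmat \<Rightarrow> bool" where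
  "represents_mat z M \<Gamma> \<longleftrightarrow> (\<forall>i j. represents z (\<lambda>w. M w $ i $ j) (ent \<Gamma> i j))"

lemma represents_matD: "represents_mat z M \<Gamma> \<Longrightarrow> represents z (\<lambda>w. M w $ i $ j) (ent \<Gamma> i j)"
  by (simp add: represents_mat_def)

lemma represents_mat_cong:
  assumes "represents_mat z M \<Gamma>" "\<forall>\<^sub>F w in nhds z. M w = N w"
  shows "represents_mat z N \<Gamma>"
  unfolding represents_mat_def
proof (intro allI)
  fix i j
  have "\<forall>\<^sub>F w in nhds z. M w $ i $ j = N w $ i $ j"
    using assms(2) by eventually_elim simp
  then show "represents z (\<lambda>w. N w $ i $ j) (ent \<Gamma> i j)"
    by (rule represents_cong[OF represents_matD[OF assms(1)]])
qed

lemma represents_mat_exists: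
  assumes "\<And>i j. smooth_near z (\<lambda>w. M w $ i $ j)" shows "\<exists>\<Gamma>. represents_mat z M \<Gamma>"
  by (intro exI[of _ "Mat (\<lambda>i j. abs_germ (\<lambda>w. M (z + w) $ i $ j))"])
    (simp add: represents_mat_def represents_def assms)

lemma represents_mat_one: "represents_mat z (\<lambda>_. mat 1) 1"
  by (simp add: represents_mat_def mat_def ent_one represents_0 represents_1)

lemma represents_mat_mult:
  fixes M :: "'v::real_normed_vector \<Rightarrow> real ^ 'n::finite ^ 'n"
  assumes "represents_mat z M \<Gamma>" "represents_mat z N \<Delta>"
  shows "represents_mat z (\<lambda>w. M w ** N w) (\<Gamma> * \<Delta>)"
  unfolding represents_mat_def matrix_matrix_mult_def ent_mult
  by (simp, intro allI represents_sum represents_mult represents_matD[OF assms(1)] represents_matD[OF assms(2)])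

lemma represents_mat_unique:
  assumes "represents_mat z M \<Gamma>" "represents_mat z M \<Delta>" shows "\<Gamma> = \<Delta>"
  by (rule sqmat_eqI) (rule represents_unique[OF represents_matD[OF assms(1)] represents_matD[OF assms(2)]])

lemma represents_mat_eventually_eq:
  fixes M :: "'v::real_normed_vector \<Rightarrow> real ^ 'n::finite ^ 'n"
  assumes "represents_mat z M \<Gamma>" "represents_mat z N \<Gamma>"
  shows "M z = N z"
  using represents_value[OF represents_matD[OF assms(1)]] represents_value[OF represents_matD[OF assms(2)]]
  by (simp add: vec_eq_iff)

lemma represents_det:
  fixes M :: "real ^ 'k::finite option \<Rightarrow> real ^ 'n::finite ^ 'n"
  assumes "represents_mat z M \<Gamma>"
  shows "represents z (\<lambda>w. det (M w)) (germ_filtration.detm \<Gamma>)"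
proof -
  have c: "represents z (\<lambda>_. of_int k) (of_int k)" for k
    using represents_const[of z "of_int k"]
    by (cases k rule: int_diff_cases) (simp add: represents_diff germ_const_of_nat[symmetric] represents_const)
  show ?thesis
    unfolding det_def germ_filtration.detm_def
    by (intro represents_sum represents_mult represents_prod c represents_matD[OF assms])
qed

lemma smooth_near_sum: "(\<And>i. i \<in> S \<Longrightarrow> smooth_near z (f i)) \<Longrightarrow> smooth_near z (\<lambda>x. \<Sum>i\<in>S. f i x)"
  by (induction S rule: infinite_finite_induct) (simp_all add: smooth_near_const smooth_near_add)

lemma smooth_near_prod: "(\<And>i. i \<in> S \<Longrightarrow> smooth_near z (f i)) \<Longrightarrow> smooth_near z (\<lambda>x. \<Prod>i\<in>S. f i x)"
  by (induction S rule: infinite_finite_induct) (simp_all add: smooth_near_const smooth_near_mult)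

lemma smooth_near_det:
  fixes M :: "'v::real_normed_vector \<Rightarrow> real ^ 'n::finite ^ 'n"
  assumes "\<And>i j. smooth_near z (\<lambda>w. M w $ i $ j)" shows "smooth_near z (\<lambda>w. det (M w))"
  unfolding det_def by (intro smooth_near_sum smooth_near_mult smooth_near_prod smooth_near_const assms)

text \<open>With Cramer's rule, smoothness of the inverse is a consequence of that of determinants.\<close>

lemma matrix_inv_cramer:
  fixes A :: "real ^ 'n::finite ^ 'n"
  assumes "det A \<noteq> 0"
  shows "matrix_inv A $ i $ j = det (\<chi> a b. if b = i then axis j 1 $ a else A $ a $ b) * inverse (det A)"
proof -
  have inv: "invertible A" using assms by (simp add: invertible_det_nz)
  have "A *v (matrix_inv A *v axis j 1) = axis j 1"
    by (simp add: matrix_vector_mul_assoc matrix_inv_inverse(1)[OF inv])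
  then have "matrix_inv A *v axis j 1 = (\<chi> k. det (\<chi> a b. if b = k then axis j 1 $ a else A $ a $ b) / det A)"
    using cramer[OF assms] by blast
  moreover have "(matrix_inv A *v axis j 1) $ i = matrix_inv A $ i $ j"
    by (simp add: matrix_vector_mult_def axis_def if_distrib cong: if_cong)
  ultimately show ?thesis by (simp add: divide_inverse)
qed

lemma smooth_near_matrix_inv:
  fixes M :: "'v::real_normed_vector \<Rightarrow> real ^ 'n::finite ^ 'n"
  assumes s: "\<And>i j. smooth_near z (\<lambda>w. M w $ i $ j)" and nz: "det (M z) \<noteq> 0"
  shows "\<forall>\<^sub>F w in nhds z. det (M w) \<noteq> 0" "smooth_near z (\<lambda>w. matrix_inv (M w) $ i $ j)"
proof -
  have sd: "smooth_near z (\<lambda>w. det (M w))" by (rule smooth_near_det[OF s])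
  have "\<forall>\<^sub>F w in at z. det (M w) \<noteq> 0"
    using tendsto_imp_eventually_ne[OF smooth_near_isCont[OF sd, unfolded isCont_def] nz] .
  then show ev: "\<forall>\<^sub>F w in nhds z. det (M w) \<noteq> 0"
    unfolding eventually_at_filter by (rule eventually_mono) (use nz in auto)
  have "smooth_near z (\<lambda>w. det (\<chi> a b. if b = i then axis j 1 $ a else M w $ a $ b) * inverse (det (M w)))"
  proof (intro smooth_near_mult smooth_near_det smooth_near_inverse[OF sd nz])
    fix a b
    show "smooth_near z (\<lambda>w. (\<chi> a b. if b = i then axis j 1 $ a else M w $ a $ b) $ a $ b)"
      by (cases "b = i") (simp_all add: smooth_near_const s)
  qed
  moreover have "\<forall>\<^sub>F w in nhds z. det (\<chi> a b. if b = i then axis j 1 $ a else M w $ a $ b) * inverse (det (M w)) = matrix_inv (M w) $ i $ j"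
    using ev by eventually_elim (simp add: matrix_inv_cramer)
  ultimately show "smooth_near z (\<lambda>w. matrix_inv (M w) $ i $ j)"
    by (rule smooth_near_transform)
qed

lemma represents_matrix_inv:
  fixes M :: "'v::real_normed_vector \<Rightarrow> real ^ 'n::finite ^ 'n"
  assumes r: "represents_mat z M \<Gamma>" and nz: "det (M z) \<noteq> 0"
  obtains \<Gamma>i where "represents_mat z (\<lambda>w. matrix_inv (M w)) \<Gamma>i" "\<Gamma> * \<Gamma>i = 1" "\<Gamma>i * \<Gamma> = 1"
proof -
  have s: "smooth_near z (\<lambda>w. M w $ i $ j)" for i j
    using represents_smooth[OF represents_matD[OF r]] .
  obtain \<Gamma>i where \<Gamma>i: "represents_mat z (\<lambda>w. matrix_inv (M w)) \<Gamma>i"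
    using represents_mat_exists[of z "\<lambda>w. matrix_inv (M w)"] smooth_near_matrix_inv(2)[OF s nz] by blast
  have ev: "\<forall>\<^sub>F w in nhds z. M w ** matrix_inv (M w) = mat 1" "\<forall>\<^sub>F w in nhds z. matrix_inv (M w) ** M w = mat 1"
    by (rule eventually_mono[OF smooth_near_matrix_inv(1)[OF s nz]],
        simp add: matrix_inv_inverse invertible_det_nz)+
  have "represents_mat z (\<lambda>_. mat 1) (\<Gamma> * \<Gamma>i)" "represents_mat z (\<lambda>_. mat 1) (\<Gamma>i * \<Gamma>)"
    by (rule represents_mat_cong[OF represents_mat_mult[OF r \<Gamma>i] ev(1)],
        rule represents_mat_cong[OF represents_mat_mult[OF \<Gamma>i r] ev(2)])
  then show thesis
    using that[OF \<Gamma>i] represents_mat_unique[OF _ represents_mat_one] by blast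
qed

text \<open>A derivative \<open>pd i\<close> of functions on the range of \<open>T\<close> that corresponds to the derivation
  \<open>e i\<close> of germs. The instances are the partial derivatives themselves and the pullback to the
  product with an interval.\<close>

definition compatible :: "real ^ 'k::finite \<Rightarrow> (real ^ 'k \<Rightarrow> 'x) \<Rightarrow> ('m \<Rightarrow> ('x \<Rightarrow> real) \<Rightarrow> 'x \<Rightarrow> real) \<Rightarrow> ('m \<Rightarrow> 'k) \<Rightarrow> bool" where
  "compatible z T pd e \<longleftrightarrow>
     (\<forall>f \<gamma> i. represents z (\<lambda>w. f (T w)) \<gamma> \<longrightarrow> represents z (\<lambda>w. pd i f (T w)) (coord_deriv (e i) \<gamma>))"

lemma compatibleD:
  "compatible z T pd e \<Longrightarrow> represents z (\<lambda>w. f (T w)) \<gamma> \<Longrightarrow> represents z (\<lambda>w. pd i f (T w)) (coord_deriv (e i) \<gamma>)"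
  by (simp add: compatible_def)

definition half :: "'v::real_normed_vector germ" where
  "half = germ_const (1 / 2)"

lemma half_half: "half + half = 1"
  by (simp add: half_def germ_const_arith(1)[symmetric] germ_const_arith(3))

lemma represents_half: "represents z (\<lambda>_. 1 / 2) half"
  unfolding half_def by (rule represents_const)

abbreviation christoffel_germ ::
  "('m \<Rightarrow> 'k) \<Rightarrow> ((real ^ 'k::finite) germ, 'm::finite) sqmat \<Rightarrow> ((real ^ 'k) germ, 'm) sqmat \<Rightarrow> 'm \<Rightarrow> ((real ^ 'k) germ, 'm) sqmat" where
  "christoffel_germ e \<Gamma> \<Gamma>i i \<equiv> smul half (\<Gamma>i * koszul (\<lambda>i. coord_deriv (e i)) \<Gamma> i)"

lemma represents_christoffel:
  fixes G :: "real ^ 'm::finite \<Rightarrow> real ^ 'm ^ 'm" and z :: "real ^ 'k::finite"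
  assumes c: "compatible z T partial e"
    and G: "represents_mat z (\<lambda>w. G (T w)) \<Gamma>" "represents_mat z (\<lambda>w. matrix_inv (G (T w))) \<Gamma>i"
  shows "represents z (\<lambda>w. christoffel G k i j (T w)) (ent (christoffel_germ e \<Gamma> \<Gamma>i i) k j)"
  unfolding christoffel_def ent_smul ent_mult koszul_def ent_Mat
  by (intro represents_mult represents_sum represents_add represents_diff represents_half
      represents_matD[OF G(2)] compatibleD[OF c] represents_matD[OF G(1)])

lemma represents_riemann_up:
  fixes G :: "real ^ 'm::finite \<Rightarrow> real ^ 'm ^ 'm" and z :: "real ^ 'k::finite"
  assumes c: "compatible z T partial e"
    and G: "represents_mat z (\<lambda>w. G (T w)) \<Gamma>" "represents_mat z (\<lambda>w. matrix_inv (G (T w))) \<Gamma>i"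
    and sym: "\<And>i j k. ent (christoffel_germ e \<Gamma> \<Gamma>i i) k j = ent (christoffel_germ e \<Gamma> \<Gamma>i j) k i"
  shows "represents z (\<lambda>w. riemann_up G i j k l (T w))
    (ent (curvature (\<lambda>i. coord_deriv (e i)) (christoffel_germ e \<Gamma> \<Gamma>i) k l) i j)"
proof -
  define C where "C = christoffel_germ e \<Gamma> \<Gamma>i"
  have ch: "represents z (\<lambda>w. christoffel G k i j (T w)) (ent (C i) k j)" for i j k
    unfolding C_def by (rule represents_christoffel[OF c G])
  have ch': "represents z (\<lambda>w. christoffel G k i j (T w)) (ent (C j) k i)" for i j k
    using ch[of k i j] sym[of i k j] unfolding C_def by simp
  have "represents z (\<lambda>w. riemann_up G i j k l (T w))
      (coord_deriv (e k) (ent (C l) i j) - coord_deriv (e l) (ent (C k) i j)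
       + (\<Sum>r\<in>UNIV. ent (C k) i r * ent (C l) r j - ent (C l) i r * ent (C k) r j))"
    unfolding riemann_up_def
    by (intro represents_mult represents_sum represents_add represents_diff compatibleD[OF c] ch' ch[of _ k] ch[of _ l])
  then show ?thesis
    unfolding C_def[symmetric] by (simp add: curvature_def ent_mult sum_subtractf add_diff_eq)
qed

lemma represents_ricci:
  fixes G :: "real ^ 'm::finite \<Rightarrow> real ^ 'm ^ 'm" and z :: "real ^ 'k::finite"
  assumes c: "compatible z T partial e"
    and G: "represents_mat z (\<lambda>w. G (T w)) \<Gamma>" "represents_mat z (\<lambda>w. matrix_inv (G (T w))) \<Gamma>i"
    and sym: "\<And>i j k. ent (christoffel_germ e \<Gamma> \<Gamma>i i) k j = ent (christoffel_germ e \<Gamma> \<Gamma>i j) k i"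
  shows "represents_mat z (\<lambda>w. ricci G (T w)) (ricci_mat (\<lambda>i. coord_deriv (e i)) (christoffel_germ e \<Gamma> \<Gamma>i))"
  unfolding represents_mat_def ricci_def ricci_mat_def
  by (simp, intro allI represents_sum represents_riemann_up[OF c G sym])

lemma compatible_id: "compatible z (\<lambda>w. w) partial (\<lambda>i. i)"
  unfolding compatible_def using represents_partial by blast

definition base_point :: "real ^ 'n::finite option \<Rightarrow> real ^ 'n" where
  "base_point z = (\<chi> i. z $ Some i)"

lemma bounded_linear_base_point: "bounded_linear base_point"
  unfolding base_point_def[abs_def]
  by (intro linear_conv_bounded_linear[THEN iffD1] linearI) (simp_all add: vec_eq_iff)

definition slice_embedding :: "real ^ 'n::finite \<Rightarrow> real ^ 'n option" where
  "slice_embedding y = (\<chi> I. case I of None \<Rightarrow> 0 | Some i \<Rightarrow> y $ i)"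

lemma bounded_linear_slice_embedding: "bounded_linear slice_embedding"
  unfolding slice_embedding_def[abs_def]
  by (intro linear_conv_bounded_linear[THEN iffD1] linearI) (simp_all add: vec_eq_iff split: option.split)

lemma base_point_slice [simp]: "base_point (slice_embedding y) = y"
  by (simp add: base_point_def slice_embedding_def vec_eq_iff)

lemma base_point_cyl [simp]: "base_point (cyl_point y x) = y" "cyl_point y x $ None = x"
  by (simp_all add: base_point_def cyl_point_def vec_eq_iff)

lemma cyl_point_base [simp]: "cyl_point (base_point z) (z $ None) = z"
  by (simp add: base_point_def cyl_point_def vec_eq_iff split: option.split)

lemma cyl_point_shift: "w $ None = 0 \<Longrightarrow> w + t *\<^sub>R axis None 1 = cyl_point (base_point w) t"
  by (simp add: base_point_def cyl_point_def vec_eq_iff axis_def split: option.split)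

lemma base_point_axis: "base_point (axis (Some i) 1) = axis i 1" "base_point (axis None 1) = 0"
  by (simp_all add: base_point_def vec_eq_iff axis_def)

lemma smooth_near_base_point: "smooth_near (base_point z) f \<Longrightarrow> smooth_near z (\<lambda>w. f (base_point w))"
  using smooth_near_affine[OF bounded_linear_base_point, of 0 z f] by simp

lemma partial_base_point:
  fixes z :: "real ^ 'a::finite option"
  assumes "(\<lambda>w. f (base_point w)) differentiable at z"
  shows "f differentiable at (base_point z)"
    and "partial (Some i) (\<lambda>w. f (base_point w)) z = partial i f (base_point z)"
    and "partial None (\<lambda>w. f (base_point w)) z = 0"
proof -
  define c where "c = z - slice_embedding (base_point z)"
  have lin: "linear (base_point :: real ^ 'a option \<Rightarrow> real ^ 'a)"
    using bounded_linear.linear[OF bounded_linear_base_point] .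
  have b: "base_point (c + slice_embedding y) = y" for y
    unfolding c_def by (simp add: linear_add[OF lin] linear_diff[OF lin])
  have "((\<lambda>y. c + slice_embedding y) has_derivative slice_embedding) (at (base_point z))"
    using has_derivative_add[OF has_derivative_const bounded_linear_imp_has_derivative[OF bounded_linear_slice_embedding]] by simp
  then have "(\<lambda>y. c + slice_embedding y) differentiable at (base_point z)"
    by (auto simp: differentiable_def)
  moreover have "(\<lambda>w. f (base_point w)) differentiable at (c + slice_embedding (base_point z))"
    using assms by (simp add: c_def)
  ultimately have "(\<lambda>y. f (base_point (c + slice_embedding y))) differentiable at (base_point z)"
    using differentiable_chain_at[of "\<lambda>y. c + slice_embedding y" "base_point z" "\<lambda>w. f (base_point w)"]
    by (simp add: o_def)
  then show d: "f differentiable at (base_point z)"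
    by (simp add: b)
  have "frechet_derivative (\<lambda>w. f (base_point w)) (at z) v = frechet_derivative f (at (base_point z)) (base_point v)" for v
    using frechet_derivative_affine[OF bounded_linear_base_point, of f 0 z v] d by simp
  then show "partial (Some i) (\<lambda>w. f (base_point w)) z = partial i f (base_point z)"
    "partial None (\<lambda>w. f (base_point w)) z = 0"
    using linear_0[OF linear_frechet_derivative[OF d]] by (simp_all add: partial_def base_point_axis)
qed

lemma compatible_base_point: "compatible z base_point partial Some"
  unfolding compatible_def
proof (intro allI impI)
  fix f :: "real ^ 'a \<Rightarrow> real" and \<gamma> i assume r: "represents z (\<lambda>w. f (base_point w)) \<gamma>"
  have "\<forall>\<^sub>F w in nhds z. partial (Some i) (\<lambda>w. f (base_point w)) w = partial i f (base_point w)"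
    by (rule eventually_mono[OF smooth_near_eventually[OF represents_smooth[OF r]]]) (simp add: partial_base_point(2))
  then show "represents z (\<lambda>w. partial i f (base_point w)) (coord_deriv (Some i) \<gamma>)"
    by (rule represents_cong[OF represents_partial[OF r]])
qed

lemma deriv_None_base_point:
  assumes r: "represents z (\<lambda>w. f (base_point w)) \<gamma>" shows "coord_deriv None \<gamma> = 0"
proof -
  have "\<forall>\<^sub>F w in nhds z. partial None (\<lambda>w. f (base_point w)) w = 0"
    by (rule eventually_mono[OF smooth_near_eventually[OF represents_smooth[OF r]]]) (simp add: partial_base_point(3))
  then have "represents z (\<lambda>_. 0) (coord_deriv None \<gamma>)"
    by (rule represents_cong[OF represents_partial[OF r]])
  then show ?thesis using represents_unique represents_0 by blast
qed

lemma represents_numeral: "represents z (\<lambda>_. numeral k) (numeral k)"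
  using represents_const[of z "numeral k"] germ_const_of_nat[of "numeral k", where 'v = 'a] by simp

lemma represents_of_nat: "represents z (\<lambda>_. of_nat k) (of_nat k)"
  using represents_const[of z "real k"] unfolding germ_const_of_nat .

text \<open>The left-hand sides of the Einstein equation are represented, at all points at once, by
  functions that are composed from the components of \<open>H\<close> and their partial derivatives.\<close>

definition represents_family ::
  "(real ^ 'n::finite option \<Rightarrow> real ^ 'n ^ 'n) \<Rightarrow> real ^ 'n option \<Rightarrow> ((real ^ 'n option) germ, 'n) sqmat \<Rightarrow>
    ((real ^ 'n option) germ, 'n) sqmat \<Rightarrow> (real ^ 'n option) germ \<Rightarrow> bool" where
  "represents_family H z \<Gamma> \<Gamma>i x \<longleftrightarrow>
     represents_mat z H \<Gamma> \<and> represents_mat z (\<lambda>w. matrix_inv (H w)) \<Gamma>i \<and> represents z (\<lambda>w. w $ None) x"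

abbreviation slice_germ ::
  "(real ^ 'n::finite option) germ \<Rightarrow> ((real ^ 'n option) germ, 'n) sqmat \<Rightarrow> ((real ^ 'n option) germ, 'n) sqmat \<Rightarrow>
    ((real ^ 'n option) germ, 'n) sqmat" where
  "slice_germ x \<Gamma> \<Gamma>i \<equiv> slice_equation x \<Gamma> (map_mat (coord_deriv None) \<Gamma>)
     (map_mat (coord_deriv None) (map_mat (coord_deriv None) \<Gamma>)) \<Gamma>i
     (ricci_mat (\<lambda>i. coord_deriv (Some i)) (christoffel_germ Some \<Gamma> \<Gamma>i))"

abbreviation normal_germ ::
  "(real ^ 'n::finite option) germ \<Rightarrow> ((real ^ 'n option) germ, 'n) sqmat \<Rightarrow> ((real ^ 'n option) germ, 'n) sqmat \<Rightarrow>
    (real ^ 'n option) germ" where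
  "normal_germ x \<Gamma> \<Gamma>i \<equiv> normal_equation x (map_mat (coord_deriv None) \<Gamma>)
     (map_mat (coord_deriv None) (map_mat (coord_deriv None) \<Gamma>)) \<Gamma>i"

lemma slice_function_exists:
  "\<exists>S. \<forall>z \<Gamma> \<Gamma>i x. represents_family H z \<Gamma> \<Gamma>i x \<longrightarrow> represents z S (ent (slice_germ x \<Gamma> \<Gamma>i) i j)"
  unfolding slice_equation_def ricci_mat_def curvature_def koszul_def tr_def ent_mult ent_simps ent_smul ent_map_mat ent_Mat
    represents_family_def
  by (rule exI, intro allI impI, elim conjE)
    (rule represents_add represents_diff represents_mult represents_sum represents_partial represents_numeral
      represents_of_nat represents_half represents_1 | assumption | erule represents_matD)+

lemma normal_function_exists:
  "\<exists>S. \<forall>z \<Gamma> \<Gamma>i x. represents_family H z \<Gamma> \<Gamma>i x \<longrightarrow> represents z S (normal_germ x \<Gamma> \<Gamma>i)"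
  unfolding normal_equation_def tr_def ent_mult ent_map_mat represents_family_def
  by (rule exI, intro allI impI, elim conjE)
    (rule represents_add represents_diff represents_mult represents_sum represents_partial represents_numeral
      | assumption | erule represents_matD)+

section \<open>The Einstein equation at interior points\<close>

lemma represents_surj: "\<exists>f. represents z f \<gamma>"
proof -
  obtain f where f: "represents 0 f \<gamma>" using germ_represented by blast
  have "smooth_near z (\<lambda>w. f (- z + w))"
    using smooth_near_affine[OF bounded_linear_ident, of "- z" z f] represents_smooth[OF f] by simp
  then have "represents z (\<lambda>w. f (- z + w)) \<gamma>"
    using f by (simp add: represents_def)
  then show ?thesis by (intro exI[of _ "\<lambda>w. f (- z + w)"])
qed

lemma represents_mat_surj:
  fixes \<Gamma> :: "('v::real_normed_vector germ, 'n::finite) sqmat"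
  shows "\<exists>M. represents_mat z M \<Gamma>"
proof -
  have "\<exists>f. \<forall>i j. represents z (f i j) (ent \<Gamma> i j)"
    by (intro choice allI represents_surj)
  then obtain f where "\<forall>i j. represents z (f i j) (ent \<Gamma> i j)" ..
  then show ?thesis
    by (intro exI[of _ "\<lambda>w. \<chi> i j. f i j w"]) (simp add: represents_mat_def)
qed

lemma germ_value_hom:
  fixes a b :: "'v::real_normed_vector germ"
  shows "germ_value (a + b) = germ_value a + germ_value b" "germ_value (a * b) = germ_value a * germ_value b"
    "germ_value (a - b) = germ_value a - germ_value b"
    "germ_value (of_nat k :: 'v germ) = of_nat k" "germ_value (numeral m :: 'v germ) = numeral m"
    "germ_value (0 :: 'v germ) = 0" "germ_value (1 :: 'v germ) = 1"
proof -
  obtain f g where fg: "represents 0 f a" "represents 0 g b"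
    using represents_surj[of 0 a] represents_surj[of 0 b] by blast
  show "germ_value (a + b) = germ_value a + germ_value b" "germ_value (a * b) = germ_value a * germ_value b"
    "germ_value (a - b) = germ_value a - germ_value b"
    using represents_value[OF represents_add[OF fg]] represents_value[OF represents_mult[OF fg]]
      represents_value[OF represents_diff[OF fg]] by (simp_all add: fg[THEN represents_value])
  have nat: "germ_value (of_nat k :: 'v germ) = of_nat k" for k
    using represents_value[OF represents_const[of "0 :: 'v" "real k"]] by (simp add: germ_const_of_nat)
  show "germ_value (of_nat k :: 'v germ) = of_nat k" "germ_value (numeral m :: 'v germ) = numeral m"
    "germ_value (0 :: 'v germ) = 0" "germ_value (1 :: 'v germ) = 1"
    using nat[of k] nat[of "numeral m"] nat[of 0] nat[of 1] by simp_all
qed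

lemma germ_value_uminus: "germ_value (- a) = - germ_value a"
  using germ_value_hom(3)[of 0 a] by (simp add: germ_value_hom)

lemma germ_value_sum: "germ_value (\<Sum>i\<in>S. f i) = (\<Sum>i\<in>S. germ_value (f i))"
  by (induction S rule: infinite_finite_induct) (simp_all add: germ_value_hom)

lemma represents_mat_inverse_value:
  fixes M :: "'v::real_normed_vector \<Rightarrow> real ^ 'n::finite ^ 'n"
  assumes "represents_mat z M \<Gamma>" "\<Gamma> * \<Delta> = 1"
  shows "det (M z) \<noteq> 0"
proof -
  obtain N where N: "represents_mat z N \<Delta>" using represents_mat_surj by blast
  have "M z ** N z = mat 1"
    using represents_mat_eventually_eq[OF represents_mat_mult[OF assms(1) N], of "\<lambda>_. mat 1"]
    by (simp add: assms(2) represents_mat_one)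
  then show ?thesis
    using invertible_right_inverse invertible_det_nz by blast
qed

lemma represents_mat_symmetric:
  assumes "represents_mat z M \<Gamma>" "\<forall>\<^sub>F w in nhds z. transpose (M w) = M w"
  shows "flip \<Gamma> = \<Gamma>"
proof (rule sqmat_eqI)
  fix i j
  have "\<forall>\<^sub>F w in nhds z. M w $ j $ i = M w $ i $ j"
    using assms(2) by eventually_elim (metis transpose_def vec_lambda_beta)
  then show "ent (flip \<Gamma>) i j = ent \<Gamma> i j"
    using represents_eq_iff[OF represents_matD[OF assms(1)] represents_matD[OF assms(1)]] by simp
qed

lemma inverse_unique:
  fixes a :: "'b::ring_1"
  assumes "b * a = 1" "a * c = 1" shows "b = c"
  using assms by (metis mult.assoc mult_1_left mult_1_right)

lemma cone_metric_inverse: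
  fixes x y :: "'r::comm_ring_1"
  assumes "x * y = 1" "H * Hi = 1"
  shows "cone_metric y H * block (x * x) (\<lambda>_. 0) (\<lambda>_. 0) (smul (x * x) Hi) = 1"
proof -
  have xy: "y * y * (x * x) = 1"
    using assms(1) by (metis mult.assoc mult.commute mult_1_left)
  have s: "(\<Sum>k\<in>UNIV. ent H i k * ent Hi k j) = ent 1 i j" for i j
    unfolding assms(2)[symmetric] ent_mult ..
  have "(\<Sum>k\<in>UNIV. y * y * ent H i k * (x * x * ent Hi k j)) = ent 1 i j" for i j
  proof -
    have "(\<Sum>k\<in>UNIV. y * y * ent H i k * (x * x * ent Hi k j)) = (y * y * (x * x)) * (\<Sum>k\<in>UNIV. ent H i k * ent Hi k j)"
      unfolding sum_distrib_left by (intro sum.cong refl) (simp only: ac_simps)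
    then show ?thesis by (simp add: xy s)
  qed
  then show ?thesis
    by (intro sqmat_option_eqI) (simp_all add: cone_metric_def ent_mult sum_UNIV_option xy, simp_all add: ent_one)
qed

text \<open>The factors \<open>4x\<close> clear the denominators of the Einstein tensor; the trace with respect to \<open>g\<^sub>+\<close>
  contributes another \<open>x\<^sup>2\<close>.\<close>

lemma einstein_at_point:
  fixes c :: "('a, 'n::finite) chart" and z1 :: "real ^ 'n option"
  assumes fam: "represents_family Hf z1 \<Gamma> \<Gamma>i x" and pos: "z1 $ None > 0"
    and eq: "\<forall>\<^sub>F z in nhds z1. Hf z = in_coords c (h (z $ None) c) (base_point z)"
    and sym: "\<forall>\<^sub>F z in nhds z1. transpose (Hf z) = Hf z"
    and nz: "det (Hf z1) \<noteq> 0"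
  shows "4 * z1 $ None * einstein_defect h c z1 $ Some i $ Some j = germ_value (ent (slice_germ x \<Gamma> \<Gamma>i) i j)"
    and "4 * z1 $ None * metric_trace (gplus h c z1) (einstein_defect h c z1) =
      (z1 $ None)\<^sup>2 * germ_value (tr (\<Gamma>i * slice_germ x \<Gamma> \<Gamma>i) + normal_germ x \<Gamma> \<Gamma>i)"
proof -
  have H: "represents_mat z1 Hf \<Gamma>" and Hi: "represents_mat z1 (\<lambda>w. matrix_inv (Hf w)) \<Gamma>i"
    and x: "represents z1 (\<lambda>w. w $ None) x"
    using fam by (simp_all add: represents_family_def)
  have inv: "\<Gamma> * \<Gamma>i = 1" "\<Gamma>i * \<Gamma> = 1"
    using represents_matrix_inv[OF H nz] represents_mat_unique[OF Hi] by metis+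
  have flipH: "flip \<Gamma> = \<Gamma>" by (rule represents_mat_symmetric[OF H sym])
  have dx: "coord_deriv None x = 1" "coord_deriv (Some i) x = 0" for i
    using deriv_coordinate[OF x] by simp_all
  obtain y where y: "represents z1 (\<lambda>w. inverse (w $ None)) y"
    using represents_exists[OF smooth_near_inverse[OF represents_smooth[OF x]]] pos by auto
  have "open {z :: real ^ 'n option. z $ None > 0}"
    by (intro open_Collect_less continuous_intros)
  then have ev_pos: "\<forall>\<^sub>F z in nhds z1. z $ None > 0"
    using pos by (auto simp: eventually_nhds)
  have "represents z1 (\<lambda>_. 1) (x * y)"
    by (rule represents_cong[OF represents_mult[OF x y]], rule eventually_mono[OF ev_pos]) simp
  then have xy: "x * y = 1" using represents_unique represents_1 by blast
  define CM where "CM = cone_metric y \<Gamma>"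
  define CMi where "CMi = block (x * x) (\<lambda>_. 0) (\<lambda>_. 0) (smul (x * x) \<Gamma>i)"
  have gp: "represents_mat z1 (gplus h c) CM"
    unfolding represents_mat_def
  proof (intro allI)
    fix I J
    have yy: "represents z1 (\<lambda>w. inverse (w $ None) * inverse (w $ None)) (y * y)"
      by (rule represents_mult[OF y y])
    show "represents z1 (\<lambda>w. gplus h c w $ I $ J) (ent CM I J)"
    proof (cases I)
      case None
      then show ?thesis
      proof (cases J)
        case None
        have "represents z1 (\<lambda>w. gplus h c w $ None $ None) (y * y)"
          by (rule represents_cong[OF yy])
            (simp add: gplus_def Let_def power2_eq_square divide_inverse)
        then show ?thesis using \<open>I = None\<close> None by (simp add: CM_def cone_metric_def)
      qed (simp add: CM_def cone_metric_def gplus_def Let_def represents_0)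
    next
      case (Some i)
      then show ?thesis
      proof (cases J)
        case (Some j)
        have "represents z1 (\<lambda>w. gplus h c w $ Option.Some i $ Option.Some j) (y * y * ent \<Gamma> i j)"
        proof (rule represents_cong[OF represents_mult[OF yy represents_matD[OF H]]])
          show "\<forall>\<^sub>F w in nhds z1. inverse (w $ None) * inverse (w $ None) * Hf w $ i $ j = gplus h c w $ Option.Some i $ Option.Some j"
            using eq by eventually_elim
              (simp add: gplus_def Let_def power2_eq_square divide_inverse base_point_def)
        qed
        then show ?thesis using \<open>I = Option.Some i\<close> Some by (simp add: CM_def cone_metric_def)
      qed (simp add: CM_def cone_metric_def gplus_def Let_def represents_0)
    qed
  qed
  have CM: "CM * CMi = 1"
    unfolding CM_def CMi_def by (rule cone_metric_inverse[OF xy inv(1)])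
  have nzg: "det (gplus h c z1) \<noteq> 0"
    by (rule represents_mat_inverse_value[OF gp CM])
  obtain \<Delta> where \<Delta>: "represents_mat z1 (\<lambda>w. matrix_inv (gplus h c w)) \<Delta>" "CM * \<Delta> = 1" "\<Delta> * CM = 1"
    using represents_matrix_inv[OF gp nzg] by blast
  have "\<Delta> = CMi" by (rule inverse_unique[OF \<Delta>(3) CM])
  with \<Delta> have gpi: "represents_mat z1 (\<lambda>w. matrix_inv (gplus h c w)) CMi" and CM': "CMi * CM = 1" by simp_all
  have flipCM: "flip CM = CM"
    unfolding CM_def cone_metric_def
    using arg_cong[OF flipH, of "\<lambda>M. ent M _ _"]
    by (intro sqmat_option_eqI) (simp_all add: flipH[THEN arg_cong, of "\<lambda>M. ent M _ _", simplified])
  have lc: "levi_civita_connection (\<lambda>i. coord_deriv (Some i)) \<Gamma> (christoffel_germ Some \<Gamma> \<Gamma>i)"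
    by (rule levi_civita_exists[OF flipH inv(1) half_half])
  define N where "N = smul y \<Gamma> - smul half (map_mat (coord_deriv None) \<Gamma>)"
  define CC where "CC = cone_connection y N (\<Gamma>i * N) (christoffel_germ Some \<Gamma> \<Gamma>i)"
  have lcC: "levi_civita_connection coord_deriv CM CC"
    unfolding CM_def CC_def
    by (rule cone_levi_civita[OF germ_ring.diff_ring_axioms dx xy half_half flipH inv(1) lc N_def])
  have lcM: "levi_civita_connection coord_deriv CM (christoffel_germ (\<lambda>I. I) CM CMi)"
    by (rule levi_civita_exists[OF flipCM CM half_half])
  have conn: "christoffel_germ (\<lambda>I. I) CM CMi = CC"
    by (rule ext) (rule germ_ring.levi_civita_unique[OF lcM lcC CM'])
  define Ric where "Ric = ricci_mat coord_deriv CC"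
  have ric: "represents_mat z1 (ricci (gplus h c)) Ric"
  proof -
    have "ent (christoffel_germ (\<lambda>I. I) CM CMi i) k j = ent (christoffel_germ (\<lambda>I. I) CM CMi j) k i" for i j k
      using lcM unfolding levi_civita_connection_def by blast
    from represents_ricci[OF compatible_id gp gpi this] show ?thesis
      unfolding conn Ric_def .
  qed
  have Ricv: "ricci (gplus h c) z1 $ I $ J = germ_value (ent Ric I J)" for I J
    using represents_value[OF represents_matD[OF ric]] by simp
  have xv: "germ_value x = z1 $ None" by (rule represents_value[OF x])
  have CMv: "gplus h c z1 $ I $ J = germ_value (ent CM I J)" for I J
    using represents_value[OF represents_matD[OF gp]] by simp
  have CMiv: "matrix_inv (gplus h c z1) $ I $ J = germ_value (ent CMi I J)" for I J
    using represents_value[OF represents_matD[OF gpi]] by simp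
  define E where "E I J = ent Ric I J + of_nat CARD('n) * ent CM I J" for I J
  have Ev: "einstein_defect h c z1 $ I $ J = germ_value (E I J)" for I J
    by (simp add: einstein_defect_def Ricv CMv E_def germ_value_hom)
  note ce = cone_einstein[OF germ_ring.diff_ring_axioms dx(1) xy half_half flipH inv N_def refl refl Ric_def[unfolded CC_def] refl]
  have S: "4 * x * E (Some i) (Some j) = ent (slice_germ x \<Gamma> \<Gamma>i) i j" for i j
    using ce(1)[of i j] by (simp add: E_def CM_def cone_metric_def)
  have N: "4 * x * E None None = normal_germ x \<Gamma> \<Gamma>i"
    using ce(2) by (simp add: E_def CM_def cone_metric_def)
  show "4 * z1 $ None * einstein_defect h c z1 $ Some i $ Some j = germ_value (ent (slice_germ x \<Gamma> \<Gamma>i) i j)"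
    unfolding S[symmetric] by (simp add: germ_value_hom xv Ev)
  have flipHi: "flip \<Gamma>i = \<Gamma>i"
  proof (rule inverse_unique)
    show "flip \<Gamma>i * \<Gamma> = 1"
      using arg_cong[OF inv(1), of flip] by (simp add: flip_simps flipH)
  qed (fact inv(1))
  have symHi: "ent \<Gamma>i i j = ent \<Gamma>i j i" for i j
    using arg_cong[OF flipHi, of "\<lambda>M. ent M j i"] by simp
  define T where "T = (\<Sum>i\<in>UNIV. \<Sum>j\<in>UNIV. ent CMi i j * E i j)"
  have "metric_trace (gplus h c z1) (einstein_defect h c z1) = germ_value T"
    by (simp add: metric_trace_def T_def germ_value_sum germ_value_hom CMiv Ev)
  moreover have "4 * x * T = x * x * (tr (\<Gamma>i * slice_germ x \<Gamma> \<Gamma>i) + normal_germ x \<Gamma> \<Gamma>i)"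
  proof -
    have T: "T = x * x * E None None + (\<Sum>i\<in>UNIV. \<Sum>j\<in>UNIV. x * x * ent \<Gamma>i i j * E (Some i) (Some j))"
      by (simp add: T_def sum_UNIV_option CMi_def)
    have "tr (\<Gamma>i * slice_germ x \<Gamma> \<Gamma>i) = (\<Sum>j\<in>UNIV. \<Sum>i\<in>UNIV. ent \<Gamma>i j i * ent (slice_germ x \<Gamma> \<Gamma>i) i j)"
      by (simp only: tr_def ent_mult)
    also have "\<dots> = (\<Sum>i\<in>UNIV. \<Sum>j\<in>UNIV. ent \<Gamma>i j i * ent (slice_germ x \<Gamma> \<Gamma>i) i j)"
      by (rule sum.swap)
    also have "\<dots> = (\<Sum>i\<in>UNIV. \<Sum>j\<in>UNIV. ent \<Gamma>i i j * (4 * x * E (Some i) (Some j)))"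
      by (simp only: S symHi)
    finally have tr: "tr (\<Gamma>i * slice_germ x \<Gamma> \<Gamma>i) = (\<Sum>i\<in>UNIV. \<Sum>j\<in>UNIV. ent \<Gamma>i i j * (4 * x * E (Some i) (Some j)))" .
    show ?thesis
      unfolding T tr N[symmetric] by (simp add: distrib_left sum_distrib_left mult_ac)
  qed
  from arg_cong[OF this, of germ_value]
  have "4 * z1 $ None * germ_value T = (z1 $ None)\<^sup>2 * germ_value (tr (\<Gamma>i * slice_germ x \<Gamma> \<Gamma>i) + normal_germ x \<Gamma> \<Gamma>i)"
    by (simp add: germ_value_hom xv power2_eq_square)
  ultimately show "4 * z1 $ None * metric_trace (gplus h c z1) (einstein_defect h c z1) =
      (z1 $ None)\<^sup>2 * germ_value (tr (\<Gamma>i * slice_germ x \<Gamma> \<Gamma>i) + normal_germ x \<Gamma> \<Gamma>i)"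
    by simp
qed

section \<open>The conformally flat metric and its model solution\<close>

text \<open>The metric on \<open>M\<close>, pulled back to the product with the interval, so that its germs are constant in
  the normal direction. The flatness hypothesis enters only here, by the tensor \<open>P\<close>.\<close>

lemma conformal_germs:
  fixes G :: "real ^ 'n::finite \<Rightarrow> real ^ 'n ^ 'n" and z0 :: "real ^ 'n option"
  assumes O: "open S" "base_point z0 \<in> S"
    and smooth: "\<And>i j. smooth_near (base_point z0) (\<lambda>y. G y $ i $ j)" "smooth_near (base_point z0) \<omega>"
    and G: "\<And>y. y \<in> S \<Longrightarrow> transpose (G y) = G y" "\<And>y. y \<in> S \<Longrightarrow> invertible (G y)"
    and flat: "\<And>y i j k l. y \<in> S \<Longrightarrow> riemann (\<lambda>y. exp (2 * \<omega> y) *\<^sub>R G y) i j k l y = 0"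
  obtains g gi P where "represents_mat z0 (\<lambda>z. G (base_point z)) g"
    "represents_mat z0 (\<lambda>z. matrix_inv (G (base_point z))) gi"
    "g * gi = 1" "gi * g = 1" "flip g = g" "map_mat (coord_deriv None) g = 0"
    "flip (g * P) = g * P" "map_mat (coord_deriv None) P = 0"
    "\<And>k l a b. ent (curvature (\<lambda>i. coord_deriv (Some i)) (christoffel_germ Some g gi) k l) a b =
      ent P a k * ent g b l - ent P a l * ent g b k - ent 1 a l * ent (g * P) b k + ent 1 a k * ent (g * P) b l"
    "\<And>i k l. ent (map_mat (coord_deriv (Some k)) P + christoffel_germ Some g gi k * P) i l =
      ent (map_mat (coord_deriv (Some l)) P + christoffel_germ Some g gi l * P) i k"
proof -
  have "open (base_point -` S)"
    by (intro open_vimage O(1) bounded_linear.continuous_on[OF bounded_linear_base_point] continuous_on_id)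
  then have ev: "\<forall>\<^sub>F z in nhds z0. base_point z \<in> S"
    using O(2) eventually_nhds_in_open[of "base_point -` S" z0] by simp
  obtain g where g: "represents_mat z0 (\<lambda>z. G (base_point z)) g"
    using represents_mat_exists[of z0 "\<lambda>z. G (base_point z)"] smooth_near_base_point[OF smooth(1)] by blast
  have "det (G (base_point z0)) \<noteq> 0"
    using G(2)[OF O(2)] by (simp add: invertible_det_nz)
  then obtain gi where gi: "represents_mat z0 (\<lambda>z. matrix_inv (G (base_point z))) gi" "g * gi = 1" "gi * g = 1"
    using represents_matrix_inv[OF g] by blast
  have flipg: "flip g = g"
    by (rule represents_mat_symmetric[OF g eventually_mono[OF ev G(1)]])
  have dg: "map_mat (coord_deriv None) g = 0"
    by (rule sqmat_eqI) (simp add: deriv_None_base_point[OF represents_matD[OF g]])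
  obtain w where w: "represents z0 (\<lambda>z. \<omega> (base_point z)) w"
    using represents_exists[OF smooth_near_base_point[OF smooth(2)]] by blast
  have sE: "smooth_near z0 (\<lambda>z. exp (r * \<omega> (base_point z)))" for r
    by (intro smooth_near_exp smooth_near_mult smooth_near_const smooth_near_base_point smooth(2))
  obtain E Ei where E: "represents z0 (\<lambda>z. exp (2 * \<omega> (base_point z))) E"
    and Ei: "represents z0 (\<lambda>z. exp (- 2 * \<omega> (base_point z))) Ei"
    using represents_exists[OF sE] by blast
  have "represents z0 (\<lambda>_. 1) (E * Ei)"
    using represents_mult[OF E Ei] by (simp add: exp_add[symmetric])
  then have EEi: "E * Ei = 1" using represents_unique represents_1 by blast
  define \<Upsilon> where "\<Upsilon> i = coord_deriv (Some i) w" for i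
  have dE: "coord_deriv (Some i) E = (\<Upsilon> i + \<Upsilon> i) * E" for i
  proof -
    have r: "represents z0 (\<lambda>z. (partial (Some i) (\<lambda>z. \<omega> (base_point z)) z + partial (Some i) (\<lambda>z. \<omega> (base_point z)) z)
        * exp (2 * \<omega> (base_point z))) ((\<Upsilon> i + \<Upsilon> i) * E)"
      unfolding \<Upsilon>_def by (intro represents_mult represents_add represents_partial w E)
    have "\<forall>\<^sub>F z in nhds z0. partial (Some i) (\<lambda>z. exp (2 * \<omega> (base_point z))) z =
        (partial (Some i) (\<lambda>z. \<omega> (base_point z)) z + partial (Some i) (\<lambda>z. \<omega> (base_point z)) z) * exp (2 * \<omega> (base_point z))"
      using smooth_near_eventually[OF represents_smooth[OF w]]
    proof eventually_elim
      case (elim z)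
      let ?f = "\<lambda>z. \<omega> (base_point z)"
      have "(?f has_derivative frechet_derivative ?f (at z)) (at z)"
        using elim by (simp add: frechet_derivative_works)
      from has_derivative_exp[OF has_derivative_mult_right[OF this, of 2]]
      have "((\<lambda>z. exp (2 * ?f z)) has_derivative (\<lambda>v. exp (2 * ?f z) * (2 * frechet_derivative ?f (at z) v))) (at z)"
        by (simp add: mult.commute)
      from frechet_derivative_at[OF this] show ?case
        by (metis (no_types, lifting) mult.commute mult_2 partial_def)
    qed
    then show ?thesis
      using represents_eq_iff[OF represents_partial[OF E] r] by blast
  qed
  have "map_mat (coord_deriv None) P = 0" if "\<And>m. map_mat (coord_deriv m) g = 0 \<Longrightarrow>
     (\<And>i. coord_deriv m (\<Upsilon> i) = 0) \<Longrightarrow> map_mat (coord_deriv m) P = 0" for P :: "((real ^ 'n option) germ, 'n) sqmat"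
    using that[OF dg] deriv_None_base_point[OF w] germ_ring.d_commute[of None _ w]
    by (simp add: \<Upsilon>_def)
  note dP = this
  define Gh where "Gh y = exp (2 * \<omega> y) *\<^sub>R G y" for y
  have gh: "represents_mat z0 (\<lambda>z. Gh (base_point z)) (smul E g)"
    unfolding represents_mat_def Gh_def
    by (simp, intro allI represents_mult E represents_matD[OF g])
  have invh: "smul E g * smul Ei gi = 1" "smul Ei gi * smul E g = 1"
    using EEi by (simp_all add: smul_mult smul_smul gi mult.commute) (simp_all add: smul_def one_sqmat_def)
  have nzh: "det (Gh (base_point z0)) \<noteq> 0"
    by (rule represents_mat_inverse_value[OF gh invh(1)])
  obtain \<Delta> where \<Delta>: "represents_mat z0 (\<lambda>z. matrix_inv (Gh (base_point z))) \<Delta>" "smul E g * \<Delta> = 1" "\<Delta> * smul E g = 1"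
    using represents_matrix_inv[OF gh nzh] by blast
  have fliph: "flip (smul E g) = smul E g" by (simp add: flip_simps flipg)
  have lch: "levi_civita_connection (\<lambda>i. coord_deriv (Some i)) (smul E g) (christoffel_germ Some (smul E g) \<Delta>)"
    by (rule levi_civita_exists[OF fliph \<Delta>(2) half_half])
  have sh: "smooth_near z0 (\<lambda>z. det (Gh (base_point z)))"
    by (rule smooth_near_det) (rule represents_smooth[OF represents_matD[OF gh]])
  have flath: "curvature (\<lambda>i. coord_deriv (Some i)) (christoffel_germ Some (smul E g) \<Delta>) k l = 0" for k l
  proof (rule sqmat_eqI)
    fix i j
    have r: "represents z0 (\<lambda>z. riemann_up Gh i j k l (base_point z))
       (ent (curvature (\<lambda>i. coord_deriv (Some i)) (christoffel_germ Some (smul E g) \<Delta>) k l) i j)"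
      by (rule represents_riemann_up[OF compatible_base_point gh \<Delta>(1)]) (use lch in \<open>simp add: levi_civita_connection_def\<close>)
    have "riemann_up Gh i j k l y = 0" if y: "y \<in> S" for y
    proof -
      have one: "matrix_inv (G y) ** G y = mat 1" by (rule matrix_inv_inverse(2)[OF G(2)[OF y]])
      define v where "v = (\<chi> r. riemann_up Gh r j k l y)"
      have "(\<Sum>r\<in>UNIV. G y $ i $ r * v $ r) = 0" for i
      proof -
        have "0 = exp (2 * \<omega> y) * (\<Sum>r\<in>UNIV. G y $ i $ r * v $ r)"
          using flat[OF y, of i j k l, folded Gh_def] unfolding riemann_def
          by (simp add: Gh_def[of y] v_def sum_distrib_left mult.assoc)
        then show ?thesis by simp
      qed
      then have "G y *v v = 0"
        by (simp add: matrix_vector_mult_def vec_eq_iff)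
      then have "matrix_inv (G y) *v (G y *v v) = 0" by simp
      then have "v = 0" by (simp add: matrix_vector_mul_assoc one)
      then show ?thesis by (simp add: v_def vec_eq_iff)
    qed
    then have "\<forall>\<^sub>F z in nhds z0. riemann_up Gh i j k l (base_point z) = 0"
      using ev by (auto elim: eventually_mono)
    then have "represents z0 (\<lambda>_. 0) (ent (curvature (\<lambda>i. coord_deriv (Some i)) (christoffel_germ Some (smul E g) \<Delta>) k l) i j)"
      by (rule represents_cong[OF r])
    then show "ent (curvature (\<lambda>i. coord_deriv (Some i)) (christoffel_germ Some (smul E g) \<Delta>) k l) i j = ent 0 i j"
      using represents_unique represents_0 by (metis ent_simps(1))
  qed
  have flat': "curvature (\<lambda>i. coord_deriv (Some i)) \<Gamma>' k l = 0"
    if "levi_civita_connection (\<lambda>i. coord_deriv (Some i)) (smul E g) \<Gamma>'" for \<Gamma>' k l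
  proof -
    have "\<Gamma>' = christoffel_germ Some (smul E g) \<Delta>"
      by (rule ext) (rule germ_ring.levi_civita_unique[OF that lch \<Delta>(3)])
    then show ?thesis using flath by simp
  qed
  have lc: "levi_civita_connection (\<lambda>i. coord_deriv (Some i)) g (christoffel_germ Some g gi)"
    by (rule levi_civita_exists[OF flipg gi(2) half_half])
  have closed: "coord_deriv (Some i) (\<Upsilon> j) = coord_deriv (Some j) (\<Upsilon> i)" for i j
    unfolding \<Upsilon>_def by (rule germ_ring.d_commute)
  show thesis
  proof (rule germ_ring.conformally_flat[where e = Some, OF lc flipg gi(2,3) closed dE flat' half_half], assumption, goal_cases)
    case (1 P)
    show ?case
      by (rule that[OF g gi flipg dg 1(1) dP[OF 1(4)] 1(2) 1(3)])
  qed
qed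

text \<open>The matrix \<open>A\<close> is invertible as a germ since it is the identity on the hyperplane.\<close>

lemma model_germs:
  fixes g gi P :: "((real ^ 'n::finite option) germ, 'n) sqmat" and z0 :: "real ^ 'n option"
  assumes g: "g * gi = 1" "gi * g = 1" "flip g = g" "map_mat (coord_deriv None) g = 0"
    "flip (g * P) = g * P" "map_mat (coord_deriv None) P = 0"
    and curv: "\<And>k l a b. ent (curvature (\<lambda>i. coord_deriv (Some i)) (christoffel_germ Some g gi) k l) a b =
      ent P a k * ent g b l - ent P a l * ent g b k - ent 1 a l * ent (g * P) b k + ent 1 a k * ent (g * P) b l"
    and cod: "\<And>i k l. ent (map_mat (coord_deriv (Some k)) P + christoffel_germ Some g gi k * P) i l =
      ent (map_mat (coord_deriv (Some l)) P + christoffel_germ Some g gi l * P) i k"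
    and z0: "z0 $ None = 0"
  obtains A Ai where "A = 1 - smul (half * normal_coord * normal_coord) P" "A * Ai = 1" "Ai * A = 1"
    "slice_germ normal_coord (g * A * A) (Ai * Ai * gi) = 0" "normal_germ normal_coord (g * A * A) (Ai * Ai * gi) = 0"
    "vanish_mat 1 (A - 1)" "vanish_mat 1 (Ai - 1)"
proof -
  let ?x = "normal_coord :: (real ^ 'n option) germ"
  define y where "y = half * ?x * ?x"
  have x: "coord_deriv None ?x = 1" "coord_deriv (Some i) ?x = 0" for i
    using deriv_coordinate[OF represents_normal_coord[OF z0]] by simp_all
  have dh: "coord_deriv I half = (0 :: (real ^ 'n option) germ)" for I
    by (rule germ_ring.d_half[OF half_half])
  have yy: "y + y = ?x * ?x"
    by (simp add: y_def distrib_right[symmetric] half_half)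
  have dy: "coord_deriv None y = ?x" "coord_deriv (Some i) y = 0" for i
  proof -
    have "half * ?x + half * ?x = ?x"
      by (simp only: distrib_right[symmetric] half_half mult_1_left)
    then show "coord_deriv None y = ?x" "coord_deriv (Some i) y = 0" for i
      by (simp_all add: y_def germ_ring.d_mult x dh)
  qed
  define A where "A = 1 - smul y P"
  obtain Af where Af: "represents_mat z0 Af A" using represents_mat_surj by blast
  have "germ_value ?x = 0" using represents_value[OF represents_normal_coord[OF z0]] z0 by simp
  then have "Af z0 $ i $ j = (if i = j then 1 else 0)" for i j
    using represents_value[OF represents_matD[OF Af], of i j]
    by (cases "i = j") (simp_all add: A_def y_def germ_value_hom germ_value_uminus ent_one)
  then have "Af z0 = mat 1"
    by (simp add: vec_eq_iff mat_def)
  then have "det (Af z0) \<noteq> 0" by simp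
  then obtain Ai where A: "A * Ai = 1" "Ai * A = 1"
    using represents_matrix_inv[OF Af] by blast
  have comm: "A * P = P * A"
    by (simp add: A_def left_diff_distrib right_diff_distrib smul_mult)
  have flipA: "flip A * g = g * A"
  proof -
    have "flip P * g = g * P" using g(5) by (simp add: flip_simps g(3))
    then show ?thesis
      by (simp add: A_def flip_simps left_diff_distrib right_diff_distrib smul_mult)
  qed
  have lc: "levi_civita_connection (\<lambda>i. coord_deriv (Some i)) g (christoffel_germ Some g gi)"
    by (rule levi_civita_exists[OF g(3,1) half_half])
  define C where "C = christoffel_germ Some g gi"
  have symC: "ent (C i) k j = ent (C j) k i" for i j k
    using lc by (simp add: C_def levi_civita_connection_def)
  have codA: "ent (map_mat (coord_deriv (Some i)) A + C i * A) k j = ent (map_mat (coord_deriv (Some j)) A + C j * A) k i" for i j k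
  proof -
    have e: "map_mat (coord_deriv (Some i)) A + C i * A = C i - smul y (map_mat (coord_deriv (Some i)) P + C i * P)" for i
      unfolding A_def germ_ring.D_simps dy by (rule sqmat_eqI) (simp add: right_diff_distrib smul_mult algebra_simps)
    show ?thesis
      unfolding e using cod[of i k j] symC[of i k j] by (simp only: C_def ent_simps ent_smul)
  qed
  define K where "K = g * A * A"
  define Ki where "Ki = Ai * Ai * gi"
  have lcK: "levi_civita_connection (\<lambda>i. coord_deriv (Some i)) K (\<lambda>i. Ai * (map_mat (coord_deriv (Some i)) A + C i * A))"
    using germ_ring.levi_civita_gauge[where e = Some, OF lc[folded C_def] g(3) A(1) codA]
    unfolding flipA K_def .
  have KKi: "K * Ki = 1" "Ki * K = 1"
  proof -
    have "K * Ki = g * (A * (A * Ai) * Ai) * gi" by (simp only: K_def Ki_def mult.assoc)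
    then show "K * Ki = 1" by (simp add: A g)
    have "Ki * K = Ai * (Ai * (gi * g) * A) * A" by (simp only: K_def Ki_def mult.assoc)
    then show "Ki * K = 1" by (simp add: A g)
  qed
  have flipK: "flip K = K"
  proof -
    have "flip K = flip A * (flip A * g)" by (simp add: K_def flip_simps g(3))
    also have "\<dots> = flip A * g * A" unfolding flipA by (simp only: flipA mult.assoc[symmetric])
    finally show ?thesis by (simp only: flipA K_def)
  qed
  have conn: "christoffel_germ Some K Ki = (\<lambda>i. Ai * (map_mat (coord_deriv (Some i)) A + C i * A))"
    by (rule ext) (rule germ_ring.levi_civita_unique[OF levi_civita_exists[OF flipK KKi(1) half_half] lcK KKi(2)])
  have R: "ricci_mat (\<lambda>i. coord_deriv (Some i)) (christoffel_germ Some K Ki) =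
      smul (tr (Ai * P)) (g * A) - g * P - g * P + smul (tr Ai) (g * A * P)"
    unfolding conn
    by (rule germ_ring.model_ricci[where e = Some, OF g(3,5) curv[folded C_def] A flipA comm])
  note me = germ_ring.model_einstein[OF x(1) dy(1) yy g(4,6) g(1,2) A_def A R K_def Ki_def refl refl]
  have vy: "vanish 1 y"
    unfolding y_def using germ_filtration.vanish_mult_left[OF germ_filtration.vanish_x] by blast
  have vA: "vanish_mat 1 (A - 1)"
    using germ_filtration.vanish_mat_uminus[OF germ_filtration.vanish_mat_smul'[OF vy, of P]] by (simp add: A_def)
  have "Ai - 1 = - (Ai * (A - 1))" by (simp add: right_diff_distrib A)
  then have vAi: "vanish_mat 1 (Ai - 1)"
    using germ_filtration.vanish_mat_uminus[OF germ_filtration.vanish_mat_mult_left[OF vA, of Ai]] by simp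
  show thesis
    by (rule that[OF A_def[unfolded y_def] A _ _ vA vAi]) (use me in \<open>simp_all only: K_def Ki_def\<close>)
qed

section \<open>The expansion at a point\<close>

lemma smooth_on_entry:
  assumes "smooth_on S f" "x \<in> S" "bounded_linear L"
  obtains F where "smooth_near x F" "\<forall>\<^sub>F y in nhds x. y \<in> S \<longrightarrow> F y = (L (f y) :: real)"
proof -
  obtain V F where V: "open V" "x \<in> V" "\<forall>k. Ck_on k V F" "\<forall>y\<in>S \<inter> V. F y = f y"
    using assms(1,2) unfolding smooth_on_def by blast
  have "smooth_near x (\<lambda>y. L (F y))"
    unfolding smooth_near_def
    by (rule exI[of _ V], intro conjI V(1,2) allI Ck_on_linear[OF assms(3) V(1)]) (rule V(3)[rule_format])
  moreover have "\<forall>\<^sub>F y in nhds x. y \<in> S \<longrightarrow> L (F y) = L (f y)"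
    using eventually_nhds_in_open[OF V(1,2)] by eventually_elim (use V(4) in auto)
  ultimately show thesis by (rule that)
qed

lemma bounded_linear_entry: "bounded_linear (\<lambda>M :: real ^ 'n ^ 'm. M $ i $ j)"
  using bounded_linear_compose[OF bounded_linear_vec_nth bounded_linear_vec_nth] .

lemma smooth_on_open_entry:
  fixes f :: "real ^ 'k \<Rightarrow> real ^ 'n ^ 'm"
  assumes "open S" "smooth_on S f" "x \<in> S"
  shows "smooth_near x (\<lambda>y. f y $ i $ j)"
proof -
  obtain F where F: "smooth_near x F" "\<forall>\<^sub>F y in nhds x. y \<in> S \<longrightarrow> F y = f y $ i $ j"
    using smooth_on_entry[OF assms(2,3) bounded_linear_entry] by blast
  have "\<forall>\<^sub>F y in nhds x. F y = f y $ i $ j"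
    using F(2) eventually_nhds_in_open[OF assms(1,3)] by eventually_elim simp
  with F(1) show ?thesis by (rule smooth_near_transform)
qed

lemma smooth_on_open_real:
  fixes f :: "real ^ 'k \<Rightarrow> real"
  assumes "open S" "smooth_on S f" "x \<in> S"
  shows "smooth_near x f"
proof -
  obtain F where F: "smooth_near x F" "\<forall>\<^sub>F y in nhds x. y \<in> S \<longrightarrow> F y = f y"
    using smooth_on_entry[OF assms(2,3) bounded_linear_ident] by blast
  have "\<forall>\<^sub>F y in nhds x. F y = f y"
    using F(2) eventually_nhds_in_open[OF assms(1,3)] by eventually_elim simp
  with F(1) show ?thesis by (rule smooth_near_transform)
qed

lemma trace_function_exists:
  "\<exists>S. \<forall>z \<Gamma> \<Gamma>i x. represents_family H z \<Gamma> \<Gamma>i x \<longrightarrow>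
     represents z S (tr (\<Gamma>i * slice_germ x \<Gamma> \<Gamma>i) + normal_germ x \<Gamma> \<Gamma>i)"
proof -
  have "\<exists>S. \<forall>i j. \<forall>z \<Gamma> \<Gamma>i x. represents_family H z \<Gamma> \<Gamma>i x \<longrightarrow> represents z (S i j) (ent (slice_germ x \<Gamma> \<Gamma>i) i j)"
    by (intro choice allI slice_function_exists)
  then obtain S where S: "\<And>i j z \<Gamma> \<Gamma>i x. represents_family H z \<Gamma> \<Gamma>i x \<Longrightarrow> represents z (S i j) (ent (slice_germ x \<Gamma> \<Gamma>i) i j)"
    by blast
  obtain F where F: "\<And>z \<Gamma> \<Gamma>i x. represents_family H z \<Gamma> \<Gamma>i x \<Longrightarrow> represents z F (normal_germ x \<Gamma> \<Gamma>i)"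
    using normal_function_exists[of H] by blast
  show ?thesis
  proof (intro exI[of _ "\<lambda>w. (\<Sum>i\<in>UNIV. \<Sum>k\<in>UNIV. matrix_inv (H w) $ i $ k * S k i w) + F w"] allI impI)
    fix z \<Gamma> \<Gamma>i x assume fam: "represents_family H z \<Gamma> \<Gamma>i x"
    then have "represents_mat z (\<lambda>w. matrix_inv (H w)) \<Gamma>i" by (simp add: represents_family_def)
    then show "represents z (\<lambda>w. (\<Sum>i\<in>UNIV. \<Sum>k\<in>UNIV. matrix_inv (H w) $ i $ k * S k i w) + F w)
        (tr (\<Gamma>i * slice_germ x \<Gamma> \<Gamma>i) + normal_germ x \<Gamma> \<Gamma>i)"
      unfolding tr_def ent_mult
      by (intro represents_add represents_sum represents_mult represents_matD S[OF fam] F[OF fam])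
  qed
qed

text \<open>A family that is smooth up to the boundary extends smoothly across it.\<close>

lemma smooth_extension:
  fixes H :: "real \<Rightarrow> real ^ 'n::finite \<Rightarrow> real ^ 'n ^ 'n"
  assumes sm: "smooth_on (S \<times> {0..<a}) (\<lambda>(y, x). H x y)" and S: "open S" "y0 \<in> S" "0 < a"
  obtains Hf where "\<And>i j. smooth_near (cyl_point y0 0) (\<lambda>z. Hf z $ i $ j)"
    "\<forall>\<^sub>F z in nhds (cyl_point y0 0). 0 \<le> z $ None \<longrightarrow> z $ None < a \<and> base_point z \<in> S \<and> Hf z = H (z $ None) (base_point z)"
proof -
  let ?T = "\<lambda>z :: real ^ 'n option. (base_point z, z $ None)"
  let ?z = "cyl_point y0 0"
  have T: "bounded_linear ?T"
    by (intro bounded_linear_Pair bounded_linear_base_point bounded_linear_vec_nth)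
  have in0: "(y0, 0) \<in> S \<times> {0..<a}" using S by simp
  have "\<exists>F. smooth_near (y0, 0) F \<and> (\<forall>\<^sub>F p in nhds (y0, 0). p \<in> S \<times> {0..<a} \<longrightarrow> F p = (case p of (y, x) \<Rightarrow> H x y) $ i $ j)" for i j
    using smooth_on_entry[OF sm in0 bounded_linear_entry[of i j]] by blast
  then have "\<exists>F. \<forall>i j. smooth_near (y0, 0) (F i j) \<and>
      (\<forall>\<^sub>F p in nhds (y0, 0). p \<in> S \<times> {0..<a} \<longrightarrow> F i j p = (case p of (y, x) \<Rightarrow> H x y) $ i $ j)"
    by (intro choice allI)
  then obtain F where F: "\<And>i j. smooth_near (y0, 0) (F i j)"
    "\<And>i j. \<forall>\<^sub>F p in nhds (y0, 0). p \<in> S \<times> {0..<a} \<longrightarrow> F i j p = (case p of (y, x) \<Rightarrow> H x y) $ i $ j"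
    by blast
  define Hf where "Hf z = (\<chi> i j. F i j (?T z))" for z
  have "(?T \<longlongrightarrow> (base_point ?z, ?z $ None)) (nhds ?z)"
    by (intro tendsto_Pair bounded_linear.tendsto[OF bounded_linear_base_point] tendsto_vec_nth filterlim_ident)
  then have lim: "(?T \<longlongrightarrow> (y0, 0)) (nhds ?z)" by simp
  have ev: "\<forall>\<^sub>F z in nhds ?z. ?T z \<in> S \<times> {0..<a} \<longrightarrow> F i j (?T z) = H (z $ None) (base_point z) $ i $ j" for i j
    using filterlim_iff[THEN iffD1, OF lim, rule_format, OF F(2)[of i j]] by (simp add: case_prod_unfold)
  have "\<forall>\<^sub>F z in nhds ?z. \<forall>i\<in>UNIV. \<forall>j\<in>UNIV. ?T z \<in> S \<times> {0..<a} \<longrightarrow> F i j (?T z) = H (z $ None) (base_point z) $ i $ j"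
    by (intro eventually_ball_finite ballI ev finite_class.finite_UNIV)
  moreover have "open (S \<times> {..<a})" by (intro open_Times S(1) open_lessThan)
  then have "\<forall>\<^sub>F z in nhds ?z. ?T z \<in> S \<times> {..<a}"
    using lim S by (auto simp: tendsto_def)
  ultimately have "\<forall>\<^sub>F z in nhds ?z. 0 \<le> z $ None \<longrightarrow> z $ None < a \<and> base_point z \<in> S \<and> Hf z = H (z $ None) (base_point z)"
    by eventually_elim (auto simp: Hf_def vec_eq_iff)
  moreover have "smooth_near ?z (\<lambda>z. Hf z $ i $ j)" for i j
    using smooth_near_affine[OF T, of 0 ?z "F i j"] F(1) by (simp add: Hf_def zero_prod_def[symmetric] )
  ultimately show thesis using that by blast
qed

lemma cyl_point_tendsto:
  fixes w :: "real ^ 'n::finite option"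
  assumes "w $ None = 0" "\<forall>\<^sub>F z in nhds w. Q z"
  shows "\<forall>\<^sub>F t in at_right 0. Q (w + t *\<^sub>R axis None 1)"
proof -
  have "((\<lambda>t. w + t *\<^sub>R axis None 1) \<longlongrightarrow> w + 0 *\<^sub>R axis None 1) (at_right 0)"
    by (intro tendsto_intros)
  then show ?thesis using assms(2) by (simp add: filterlim_iff)
qed

lemma constant_of_deriv_zero:
  fixes z :: "real ^ 'n::finite option"
  assumes r: "represents z f \<gamma>" and d: "coord_deriv None \<gamma> = 0" and z: "z $ None = 0"
  shows "\<forall>\<^sub>F t in at_right 0. f (z + t *\<^sub>R axis None 1) = f z"
proof -
  have "represents z (partial None f) 0"
    using represents_partial[OF r, of None] by (simp add: d)
  then have "\<forall>\<^sub>F w in nhds z. partial None f w = 0"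
    using represents_eq_iff[OF _ represents_0, of z "partial None f" 0] by simp
  then have "\<forall>\<^sub>F w in nhds z. partial None f w = 0 \<and> f differentiable at w"
    using smooth_near_eventually[OF represents_smooth[OF r]] by eventually_elim simp
  then obtain e where e: "e > 0" "\<And>w. dist w z < e \<Longrightarrow> partial None f w = 0 \<and> f differentiable at w"
    unfolding eventually_nhds_metric by auto
  have "f (z + t *\<^sub>R axis None 1) = f z" if t: "0 < t" "t < e" for t
  proof -
    have d: "((\<lambda>s. f (z + s *\<^sub>R axis None 1)) has_real_derivative 0) (at s)" if "0 \<le> s" "s \<le> t" for s
    proof -
      have "dist (z + s *\<^sub>R axis None 1) z < e" using that t by (simp add: dist_norm)
      from e(2)[OF this] line_derivative[of f z s "axis None 1"] show ?thesis by (simp add: partial_def)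
    qed
    have "continuous_on {0..t} (\<lambda>s. f (z + s *\<^sub>R axis None 1))"
      by (intro continuous_at_imp_continuous_on ballI DERIV_isCont[OF d]) auto
    then have "f (z + t *\<^sub>R axis None 1) = f (z + 0 *\<^sub>R axis None 1)"
      by (rule DERIV_isconst2[OF t(1)]) (use d t in auto)
    then show ?thesis by simp
  qed
  then show ?thesis
    unfolding eventually_at_right_field using e(1) by blast
qed

text \<open>The comparison of a Poincare metric with the model. The family extends smoothly across the
  boundary, and the bounds on its Einstein tensor, which hold for \<open>t > 0\<close> only, become orders of
  vanishing of germs. By the uniqueness of the expansion the quotient of the family by the model
  is the identity to order \<open>n\<close>, and its trace is that of the identity to order \<open>n + 1\<close>, hence its
  determinant is 1 to order \<open>n + 1\<close>.\<close>

lemma local_expansion: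
  fixes c :: "('a, 'n::finite) chart" and G :: "real ^ 'n \<Rightarrow> real ^ 'n ^ 'n" and y0 :: "real ^ 'n"
  assumes S: "open S" "y0 \<in> S" and a: "0 < a"
    and sm: "smooth_on (S \<times> {0..<a}) (\<lambda>(y, x). in_coords c (h x c) y)"
    and metric: "\<And>x y. 0 \<le> x \<Longrightarrow> x < a \<Longrightarrow> y \<in> S \<Longrightarrow>
      transpose (in_coords c (h x c) y) = in_coords c (h x c) y \<and> invertible (in_coords c (h x c) y)"
    and G0: "\<And>y. y \<in> S \<Longrightarrow> in_coords c (h 0 c) y = G y" and smG: "smooth_on S G"
    and \<omega>: "open S'" "y0 \<in> S'" "S' \<subseteq> S" "smooth_on S' \<omega>"
    and flat: "\<And>y i j k l. y \<in> S' \<Longrightarrow> riemann (\<lambda>y. exp (2 * \<omega> y) *\<^sub>R G y) i j k l y = 0"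
    and n: "CARD('n) \<ge> 2"
    and einstein: "\<And>y. y \<in> S \<Longrightarrow> \<exists>C. \<forall>\<^sub>F x in at_right 0. \<forall>I J.
      \<bar>einstein_defect h c (cyl_point y x) $ I $ J\<bar> \<le> C * x ^ (CARD('n) - 2)"
    and trace: "\<And>y. y \<in> S \<Longrightarrow> \<exists>C. \<forall>\<^sub>F x in at_right 0.
      \<bar>metric_trace (gplus h c (cyl_point y x)) (einstein_defect h c (cyl_point y x))\<bar> \<le> C * x ^ (CARD('n) + 2)"
  obtains P0 where
    "\<And>i j k l. riemann G i j k l y0 =
      (G y0 ** P0) $ i $ k * G y0 $ j $ l - (G y0 ** P0) $ i $ l * G y0 $ j $ k
      - (G y0 ** P0) $ j $ k * G y0 $ i $ l + (G y0 ** P0) $ j $ l * G y0 $ i $ k"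
    "((\<lambda>t. (det (in_coords c (h t c) y0) / det (G y0) / (det (mat 1 + (- t\<^sup>2 / 2) *\<^sub>R P0))\<^sup>2 - 1) / t ^ CARD('n))
      \<longlongrightarrow> 0) (at_right 0)"
proof -
  let ?n = "CARD('n)"
  let ?x = "normal_coord :: (real ^ 'n option) germ"
  define z0 where "z0 = cyl_point y0 0"
  have z0: "z0 $ None = 0" "base_point z0 = y0" by (simp_all add: z0_def)
  have G: "transpose (G y) = G y" "invertible (G y)" if "y \<in> S" for y
    using metric[of 0 y] G0[OF that] a that by auto
  have smoothG: "smooth_near (base_point z0) (\<lambda>y. G y $ i $ j)" for i j
    unfolding z0 by (rule smooth_on_open_entry[OF S(1) smG S(2)])
  have smooth\<omega>: "smooth_near (base_point z0) \<omega>"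
    unfolding z0 by (rule smooth_on_open_real[OF \<omega>(1,4,2)])
  obtain g gi P where g: "represents_mat z0 (\<lambda>z. G (base_point z)) g"
    "represents_mat z0 (\<lambda>z. matrix_inv (G (base_point z))) gi"
    "g * gi = 1" "gi * g = 1" "flip g = g" "map_mat (coord_deriv None) g = 0"
    "flip (g * P) = g * P" "map_mat (coord_deriv None) P = 0"
    and curv: "\<And>k l a b. ent (curvature (\<lambda>i. coord_deriv (Some i)) (christoffel_germ Some g gi) k l) a b =
      ent P a k * ent g b l - ent P a l * ent g b k - ent 1 a l * ent (g * P) b k + ent 1 a k * ent (g * P) b l"
    and cod: "\<And>i k l. ent (map_mat (coord_deriv (Some k)) P + christoffel_germ Some g gi k * P) i l =
      ent (map_mat (coord_deriv (Some l)) P + christoffel_germ Some g gi l * P) i k"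
    by (rule conformal_germs[OF \<omega>(1), of z0 G \<omega>])
      (use \<omega>(2,3) z0 smoothG smooth\<omega> G flat in \<open>auto\<close>)
  obtain A Ai where A: "A = 1 - smul (half * ?x * ?x) P" "A * Ai = 1" "Ai * A = 1"
    and model: "slice_germ ?x (g * A * A) (Ai * Ai * gi) = 0" "normal_germ ?x (g * A * A) (Ai * Ai * gi) = 0"
    and vA: "vanish_mat 1 (A - 1)" "vanish_mat 1 (Ai - 1)"
    by (rule model_germs[OF g(3-8) curv cod z0(1)])
  define K where "K = g * A * A"
  define Ki where "Ki = Ai * Ai * gi"
  have KKi: "K * Ki = 1" "Ki * K = 1"
  proof -
    have "K * Ki = g * (A * (A * Ai) * Ai) * gi" by (simp only: K_def Ki_def mult.assoc)
    then show "K * Ki = 1" by (simp add: A(2) g)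
    have "Ki * K = Ai * (Ai * (gi * g) * A) * A" by (simp only: K_def Ki_def mult.assoc)
    then show "Ki * K = 1" by (simp add: A(3) g)
  qed
  obtain Hf where Hf: "\<And>i j. smooth_near z0 (\<lambda>z. Hf z $ i $ j)"
    "\<forall>\<^sub>F z in nhds z0. 0 \<le> z $ None \<longrightarrow> z $ None < a \<and> base_point z \<in> S \<and> Hf z = in_coords c (h (z $ None) c) (base_point z)"
    unfolding z0_def using smooth_extension[OF sm S a] by blast
  have "Hf z0 = G y0"
    using eventually_nhds_x_imp_x[OF Hf(2)] z0 G0[OF S(2)] by simp
  then have nz0: "det (Hf z0) \<noteq> 0" using G(2)[OF S(2)] by (simp add: invertible_det_nz)
  obtain H where H: "represents_mat z0 Hf H" using represents_mat_exists[OF Hf(1)] by blast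
  obtain Hi where Hi: "represents_mat z0 (\<lambda>z. matrix_inv (Hf z)) Hi" "H * Hi = 1" "Hi * H = 1"
    using represents_matrix_inv[OF H nz0] by blast
  have fam0: "represents_family Hf z0 H Hi ?x"
    unfolding represents_family_def using H Hi(1) represents_normal_coord[OF z0(1)] by blast
  obtain Q where Q: "open Q" "z0 \<in> Q" "\<And>z. z \<in> Q \<Longrightarrow> 0 \<le> z $ None \<Longrightarrow> z $ None < a \<and> base_point z \<in> S \<and> Hf z = in_coords c (h (z $ None) c) (base_point z)"
    "\<And>z. z \<in> Q \<Longrightarrow> det (Hf z) \<noteq> 0" "\<And>z i j. z \<in> Q \<Longrightarrow> smooth_near z (\<lambda>z. Hf z $ i $ j)"
  proof -
    have "\<forall>\<^sub>F z in nhds z0. \<forall>i\<in>UNIV. \<forall>j\<in>UNIV. smooth_near z (\<lambda>z. Hf z $ i $ j)"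
    proof (intro eventually_ball_finite ballI finite_class.finite_UNIV)
      fix i j show "\<forall>\<^sub>F z in nhds z0. smooth_near z (\<lambda>z. Hf z $ i $ j)"
        by (rule eventually_mono[OF smooth_near_eventually[OF Hf(1)[of i j]]]) simp
    qed
    then have "\<forall>\<^sub>F z in nhds z0. (0 \<le> z $ None \<longrightarrow> z $ None < a \<and> base_point z \<in> S \<and> Hf z = in_coords c (h (z $ None) c) (base_point z))
      \<and> det (Hf z) \<noteq> 0 \<and> (\<forall>i\<in>UNIV. \<forall>j\<in>UNIV. smooth_near z (\<lambda>z. Hf z $ i $ j))"
      using Hf(2) smooth_near_matrix_inv(1)[OF Hf(1) nz0] by eventually_elim simp
    then show thesis
      unfolding eventually_nhds using that by (elim exE conjE) simp
  qed
  \<comment> \<open>At interior points the Einstein tensor is given by values of germs, so that the bounds can be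
    transferred to functions that are smooth across the boundary.\<close>
  have point: "\<exists>\<Gamma> \<Gamma>i x. represents_family Hf z \<Gamma> \<Gamma>i x \<and>
      (\<forall>i j. 4 * z $ None * einstein_defect h c z $ Some i $ Some j = germ_value (ent (slice_germ x \<Gamma> \<Gamma>i) i j)) \<and>
      4 * z $ None * metric_trace (gplus h c z) (einstein_defect h c z) =
        (z $ None)\<^sup>2 * germ_value (tr (\<Gamma>i * slice_germ x \<Gamma> \<Gamma>i) + normal_germ x \<Gamma> \<Gamma>i)"
    if z: "z \<in> Q" "z $ None > 0" for z
  proof -
    obtain \<Gamma> where \<Gamma>: "represents_mat z Hf \<Gamma>" using represents_mat_exists[OF Q(5)[OF z(1)]] by blast
    obtain \<Gamma>i where \<Gamma>i: "represents_mat z (\<lambda>z. matrix_inv (Hf z)) \<Gamma>i"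
      using represents_matrix_inv[OF \<Gamma> Q(4)[OF z(1)]] by blast
    obtain x where x: "represents z (\<lambda>z. z $ None) x"
      using represents_exists[OF smooth_near_linear[OF bounded_linear_vec_nth]] by blast
    have fam: "represents_family Hf z \<Gamma> \<Gamma>i x"
      unfolding represents_family_def using \<Gamma> \<Gamma>i x by blast
    have "open (Q \<inter> {z. z $ None > 0})"
      by (intro open_Int Q(1) open_Collect_less continuous_intros)
    then have ev: "\<forall>\<^sub>F w in nhds z. w \<in> Q \<inter> {z. z $ None > 0}"
      using z by (intro eventually_nhds_in_open) auto
    have e1: "\<forall>\<^sub>F w in nhds z. Hf w = in_coords c (h (w $ None) c) (base_point w)"
      using ev by (rule eventually_mono) (use Q(3) in auto)
    have e2: "\<forall>\<^sub>F w in nhds z. transpose (Hf w) = Hf w"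
    proof (rule eventually_mono[OF ev])
      fix w assume "w \<in> Q \<inter> {z. z $ None > 0}"
      then show "transpose (Hf w) = Hf w"
        using Q(3)[of w] metric[of "w $ None" "base_point w"] by simp
    qed
    show ?thesis
      by (intro exI[of _ \<Gamma>] exI[of _ \<Gamma>i] exI[of _ x] conjI allI fam
          einstein_at_point[where h = h and c = c, OF fam z(2) e1 e2 Q(4)[OF z(1)]])
  qed
  have line: "\<forall>\<^sub>F t in at_right 0. w + t *\<^sub>R axis None 1 = cyl_point (base_point w) t \<and> cyl_point (base_point w) t \<in> Q \<and> t > 0 \<and> t < 1"
    if w: "w \<in> Q" "w $ None = 0" for w
  proof -
    have "\<forall>\<^sub>F t in at_right 0. w + t *\<^sub>R axis None 1 \<in> Q"
      by (rule cyl_point_tendsto[OF w(2) eventually_nhds_in_open[OF Q(1) w(1)]])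
    moreover have "\<forall>\<^sub>F t :: real in at_right 0. t > 0 \<and> t < 1"
      unfolding eventually_at_right_field by (intro exI[of _ 1]) auto
    ultimately show ?thesis
      by eventually_elim (simp add: cyl_point_shift[OF w(2)])
  qed
  have evQ: "\<forall>\<^sub>F w in nhds z0. w \<in> Q" by (rule eventually_nhds_in_open[OF Q(1,2)])
  have slice0: "vanish (?n - 1) (ent (slice_germ ?x H Hi) i j)" for i j
  proof -
    obtain F where F: "\<And>z \<Gamma> \<Gamma>i x. represents_family Hf z \<Gamma> \<Gamma>i x \<Longrightarrow> represents z F (ent (slice_germ x \<Gamma> \<Gamma>i) i j)"
      using slice_function_exists[of Hf i j] by blast
    have val: "F z = 4 * z $ None * einstein_defect h c z $ Some i $ Some j" if z: "z \<in> Q" "z $ None > 0" for z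
    proof -
      obtain \<Gamma> \<Gamma>i x where *: "represents_family Hf z \<Gamma> \<Gamma>i x"
        "4 * z $ None * einstein_defect h c z $ Some i $ Some j = germ_value (ent (slice_germ x \<Gamma> \<Gamma>i) i j)"
        using point[OF z] by blast
      show ?thesis unfolding *(2) using represents_value[OF F[OF *(1)]] by simp
    qed
    show ?thesis
    proof (rule vanish_of_bound[OF F[OF fam0] z0(1)], rule eventually_mono[OF evQ], rule impI)
      fix w assume w: "w \<in> Q" "w $ None = 0"
      have wS: "base_point w \<in> S" using Q(3)[OF w(1)] w(2) by simp
      obtain C where C: "\<forall>\<^sub>F x in at_right 0. \<forall>I J. \<bar>einstein_defect h c (cyl_point (base_point w) x) $ I $ J\<bar> \<le> C * x ^ (?n - 2)"
        using einstein[OF wS] by blast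
      have "\<forall>\<^sub>F t in at_right 0. \<bar>F (w + t *\<^sub>R axis None 1)\<bar> \<le> 4 * C * t ^ (?n - 1)"
        using C line[OF w]
      proof eventually_elim
        case (elim t)
        then have "\<bar>F (w + t *\<^sub>R axis None 1)\<bar> = 4 * t * \<bar>einstein_defect h c (cyl_point (base_point w) t) $ Some i $ Some j\<bar>"
          by (simp add: val abs_mult)
        also have "\<dots> \<le> 4 * t * (C * t ^ (?n - 2))"
          using elim by (intro mult_left_mono) auto
        also have "\<dots> = 4 * C * t ^ Suc (?n - 2)" by simp
        also have "Suc (?n - 2) = ?n - 1" using n by simp
        finally show ?case .
      qed
      then show "\<exists>C. \<forall>\<^sub>F t in at_right 0. \<bar>F (w + t *\<^sub>R axis None 1)\<bar> \<le> C * t ^ (?n - 1)" ..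
    qed
  qed
  have trace0: "vanish ?n (tr (Hi * slice_germ ?x H Hi) + normal_germ ?x H Hi)"
  proof -
    obtain F where F: "\<And>z \<Gamma> \<Gamma>i x. represents_family Hf z \<Gamma> \<Gamma>i x \<Longrightarrow> represents z F (tr (\<Gamma>i * slice_germ x \<Gamma> \<Gamma>i) + normal_germ x \<Gamma> \<Gamma>i)"
      using trace_function_exists[of Hf] by blast
    have val: "4 * z $ None * metric_trace (gplus h c z) (einstein_defect h c z) = (z $ None)\<^sup>2 * F z" if z: "z \<in> Q" "z $ None > 0" for z
    proof -
      obtain \<Gamma> \<Gamma>i x where *: "represents_family Hf z \<Gamma> \<Gamma>i x"
        "4 * z $ None * metric_trace (gplus h c z) (einstein_defect h c z) =
        (z $ None)\<^sup>2 * germ_value (tr (\<Gamma>i * slice_germ x \<Gamma> \<Gamma>i) + normal_germ x \<Gamma> \<Gamma>i)"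
        using point[OF z] by blast
      show ?thesis unfolding *(2) using represents_value[OF F[OF *(1)]] by simp
    qed
    show ?thesis
    proof (rule vanish_of_bound[OF F[OF fam0] z0(1)], rule eventually_mono[OF evQ], rule impI)
      fix w assume w: "w \<in> Q" "w $ None = 0"
      have wS: "base_point w \<in> S" using Q(3)[OF w(1)] w(2) by simp
      obtain C where C: "\<forall>\<^sub>F x in at_right 0. \<bar>metric_trace (gplus h c (cyl_point (base_point w) x)) (einstein_defect h c (cyl_point (base_point w) x))\<bar> \<le> C * x ^ (?n + 2)"
        using trace[OF wS] by blast
      have "\<forall>\<^sub>F t in at_right 0. \<bar>F (w + t *\<^sub>R axis None 1)\<bar> \<le> 4 * \<bar>C\<bar> * t ^ ?n"
        using C line[OF w]
      proof eventually_elim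
        case (elim t)
        define z where "z = cyl_point (base_point w) t"
        have t: "0 < t" "t < 1" using elim by auto
        have "t\<^sup>2 * \<bar>F z\<bar> = \<bar>4 * z $ None * metric_trace (gplus h c z) (einstein_defect h c z)\<bar>"
          using elim by (subst val) (simp_all add: z_def abs_mult)
        also have "\<dots> = 4 * t * \<bar>metric_trace (gplus h c z) (einstein_defect h c z)\<bar>"
          using t by (simp add: z_def abs_mult)
        also have "\<dots> \<le> 4 * t * (C * t ^ (?n + 2))"
          using elim t unfolding z_def by (intro mult_left_mono) auto
        also have "\<dots> = t\<^sup>2 * (4 * C * t * t ^ ?n)" by (simp add: power_add power2_eq_square)
        finally have "\<bar>F z\<bar> \<le> 4 * C * t * t ^ ?n" using t by (simp add: mult_le_cancel_left)
        also have "4 * C * t \<le> 4 * \<bar>C\<bar>"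
        proof -
          have "C * t \<le> \<bar>C\<bar> * t" using t by (intro mult_right_mono) auto
          also have "\<dots> \<le> \<bar>C\<bar> * 1" using t by (intro mult_left_mono) auto
          finally show ?thesis by simp
        qed
        finally show ?case using elim by (simp add: z_def)
      qed
      then show "\<exists>C. \<forall>\<^sub>F t in at_right 0. \<bar>F (w + t *\<^sub>R axis None 1)\<bar> \<le> C * t ^ ?n" ..
    qed
  qed
  have slice0': "vanish_mat (?n - 1) (slice_germ ?x H Hi)"
    using slice0 by (simp add: germ_filtration.vanish_mat_def)
  have initH: "vanish_mat 1 (H - g)"
    unfolding germ_filtration.vanish_mat_def One_nat_def germ_filtration.vanish.simps
  proof (intro allI conjI TrueI)
    fix i j
    have r: "represents z0 (\<lambda>z. Hf z $ i $ j - G (base_point z) $ i $ j) (ent (H - g) i j)"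
      using represents_diff[OF represents_matD[OF H] represents_matD[OF g(1)]] by simp
    show "zero_on_slice (ent (H - g) i j)"
      unfolding zero_on_slice_iff[OF r z0(1)]
      by (rule eventually_mono[OF evQ]) (use Q(3) G0 in auto)
  qed
  have AA: "vanish_mat 1 (M * A * A - M)" for M
  proof -
    have "M * A * A - M = M * (A - 1) * A + M * (A - 1)"
      by (simp add: algebra_simps)
    then show ?thesis
      by (simp only:) (intro germ_filtration.vanish_mat_add germ_filtration.vanish_mat_mult_right[OF germ_filtration.vanish_mat_mult_left[OF vA(1)]]
        germ_filtration.vanish_mat_mult_left[OF vA(1)])
  qed
  have initK: "vanish_mat 1 (K - g)"
    unfolding K_def by (rule AA)
  note eu = germ_filtration.expansion_unique[OF g(3,4,6) Hi(2,3) KKi initH initK slice0' trace0 model[folded K_def Ki_def]]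
  define N where "N = Ki * (H - K)"
  have vN: "vanish_mat ?n N"
    unfolding N_def by (rule germ_filtration.vanish_mat_mult_left[OF eu(1)])
  have "tr N = tr (gi * (H - K)) + tr ((Ai * (Ai - 1) + (Ai - 1)) * gi * (H - K))"
    by (simp add: N_def Ki_def tr_simps algebra_simps)
  moreover have "vanish_mat (1 + ?n) ((Ai * (Ai - 1) + (Ai - 1)) * gi * (H - K))"
    by (intro germ_filtration.vanish_mat_mult[OF germ_filtration.vanish_mat_mult_right eu(1)]
        germ_filtration.vanish_mat_add germ_filtration.vanish_mat_mult_left vA(2))
  ultimately have trN: "vanish (Suc ?n) (tr N)"
    using germ_filtration.vanish_add[OF eu(2) germ_filtration.vanish_tr] by simp
  have N1: "1 + N = Ai * Ai * gi * H"
    by (simp add: N_def right_diff_distrib KKi) (simp add: Ki_def)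
  have vdet: "vanish (Suc ?n) (germ_filtration.detm (Ai * Ai * gi * H) - 1)"
    using germ_filtration.vanish_det[OF vN trN] n by (simp add: N1)
  obtain Pf where Pf: "represents_mat z0 Pf P" using represents_mat_surj by blast
  define Af where "Af z = mat 1 - (1 / 2 * z $ None * z $ None) *\<^sub>R Pf z" for z :: "real ^ 'n option"
  have Af: "represents_mat z0 Af A"
    unfolding represents_mat_def A(1) Af_def
  proof (intro allI)
    fix i j
    have "represents z0 (\<lambda>z. (mat 1 :: real ^ 'n ^ 'n) $ i $ j - 1 / 2 * z $ None * z $ None * Pf z $ i $ j) (ent 1 i j - half * ?x * ?x * ent P i j)"
      by (intro represents_diff represents_mult represents_half represents_normal_coord z0(1) represents_matD[OF Pf] represents_matD[OF represents_mat_one])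
    then show "represents z0 (\<lambda>z. (mat 1 - (1 / 2 * z $ None * z $ None) *\<^sub>R Pf z) $ i $ j) (ent (1 - smul (half * ?x * ?x) P) i j)"
      by simp
  qed
  have nzA: "det (Af z0) \<noteq> 0" by (simp add: Af_def z0(1))
  obtain \<Delta> where \<Delta>: "represents_mat z0 (\<lambda>z. matrix_inv (Af z)) \<Delta>" "\<Delta> * A = 1"
    using represents_matrix_inv[OF Af nzA] by blast
  have "\<Delta> = Ai" by (rule inverse_unique[OF \<Delta>(2) A(2)])
  with \<Delta> have Afi: "represents_mat z0 (\<lambda>z. matrix_inv (Af z)) Ai" by simp
  define r where "r z = det (matrix_inv (Af z) ** matrix_inv (Af z) ** matrix_inv (G (base_point z)) ** Hf z) - 1" for z
  have "represents z0 r (germ_filtration.detm (Ai * Ai * gi * H) - 1)"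
    unfolding r_def by (intro represents_diff represents_1 represents_det represents_mat_mult Afi g(2) H)
  from small_of_vanish[OF this z0(1) vdet]
  have lim: "((\<lambda>t. r (z0 + t *\<^sub>R axis None 1) / t ^ ?n) \<longlongrightarrow> 0) (at_right 0)" .
  have constP: "\<forall>\<^sub>F t in at_right 0. \<forall>i\<in>UNIV. \<forall>j\<in>UNIV. Pf (z0 + t *\<^sub>R axis None 1) $ i $ j = Pf z0 $ i $ j"
  proof (intro eventually_ball_finite ballI finite_class.finite_UNIV)
    fix i j
    have "coord_deriv None (ent P i j) = 0"
      using arg_cong[OF g(8), of "\<lambda>M. ent M i j"] by simp
    then show "\<forall>\<^sub>F t in at_right 0. Pf (z0 + t *\<^sub>R axis None 1) $ i $ j = Pf z0 $ i $ j"
      by (rule constant_of_deriv_zero[OF represents_matD[OF Pf] _ z0(1)])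
  qed
  have sAf: "smooth_near z0 (\<lambda>w. Af w $ i $ j)" for i j
    using represents_smooth[OF represents_matD[OF Af]] .
  have nzAf: "\<forall>\<^sub>F t in at_right 0. det (Af (z0 + t *\<^sub>R axis None 1)) \<noteq> 0"
    by (rule cyl_point_tendsto[OF z0(1)], rule smooth_near_matrix_inv(1)[of z0 Af, OF sAf nzA])
  have "\<forall>\<^sub>F t in at_right 0. r (z0 + t *\<^sub>R axis None 1) / t ^ ?n =
      (det (in_coords c (h t c) y0) / det (G y0) / (det (mat 1 + (- t\<^sup>2 / 2) *\<^sub>R Pf z0))\<^sup>2 - 1) / t ^ ?n"
    using line[OF Q(2) z0(1)] constP nzAf
  proof eventually_elim
    case (elim t)
    define z where "z = z0 + t *\<^sub>R axis None 1"
    have z: "z = cyl_point y0 t" "z \<in> Q" "t > 0" using elim by (simp_all add: z_def z0(2))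
    have "Pf z = Pf z0" using elim(2) by (simp add: z_def vec_eq_iff)
    then have Az: "Af z = mat 1 + (- t\<^sup>2 / 2) *\<^sub>R Pf z0"
      by (simp add: Af_def z(1) power2_eq_square)
    have nzAz: "det (Af z) \<noteq> 0" using elim(3) by (simp add: z_def)
    have Hz: "Hf z = in_coords c (h t c) y0" using Q(3)[OF z(2)] z(1,3) by simp
    have "det (matrix_inv (Af z) ** matrix_inv (Af z) ** matrix_inv (G (base_point z)) ** Hf z) =
        1 / det (Af z) * (1 / det (Af z)) * (1 / det (G y0)) * det (in_coords c (h t c) y0)"
      using nzAz G(2)[OF S(2)] by (simp add: det_mul det_matrix_inv invertible_det_nz z(1) Hz[unfolded z(1)])
    then have "r z = det (in_coords c (h t c) y0) / det (G y0) / (det (mat 1 + (- t\<^sup>2 / 2) *\<^sub>R Pf z0))\<^sup>2 - 1"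
      unfolding r_def Az by (simp add: power2_eq_square)
    then show ?case by (simp add: z_def)
  qed
  from Lim_transform_eventually[OF lim this]
  have lim': "((\<lambda>t. (det (in_coords c (h t c) y0) / det (G y0) / (det (mat 1 + (- t\<^sup>2 / 2) *\<^sub>R Pf z0))\<^sup>2 - 1) / t ^ ?n)
      \<longlongrightarrow> 0) (at_right 0)" .
  have lcg: "levi_civita_connection (\<lambda>i. coord_deriv (Some i)) g (christoffel_germ Some g gi)"
    by (rule levi_civita_exists[OF g(5,3) half_half])
  have symC: "ent (christoffel_germ Some g gi i) k j = ent (christoffel_germ Some g gi j) k i" for i j k
    using lcg unfolding levi_civita_connection_def by blast
  have Rup: "riemann_up G a b k l y0 = Pf z0 $ a $ k * G y0 $ b $ l - Pf z0 $ a $ l * G y0 $ b $ k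
      - (mat 1 :: real ^ 'n ^ 'n) $ a $ l * (G y0 ** Pf z0) $ b $ k + (mat 1 :: real ^ 'n ^ 'n) $ a $ k * (G y0 ** Pf z0) $ b $ l" for a b k l
  proof -
    have gP: "represents_mat z0 (\<lambda>z. G (base_point z) ** Pf z) (g * P)"
      by (rule represents_mat_mult[OF g(1) Pf])
    have "riemann_up G a b k l y0 = germ_value (ent (curvature (\<lambda>i. coord_deriv (Some i)) (christoffel_germ Some g gi) k l) a b)"
      using represents_value[OF represents_riemann_up[OF compatible_base_point g(1,2) symC, of a b k l]] z0(2) by simp
    then show ?thesis
      unfolding curv using represents_value[OF represents_matD[OF Pf]] represents_value[OF represents_matD[OF g(1)]]
        represents_value[OF represents_matD[OF gP]]
      by (simp add: germ_value_hom z0(2) ent_one mat_def if_distrib[of germ_value])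
  qed
  show thesis
  proof (rule that[OF _ lim'])
    fix i j k l
    have s: "(\<Sum>r\<in>UNIV. G y0 $ i $ r * (mat 1 :: real ^ 'n ^ 'n) $ r $ m) = G y0 $ i $ m" for m
      by (simp add: mat_def if_distrib cong: if_cong)
    have p: "(\<Sum>r\<in>UNIV. G y0 $ i $ r * Pf z0 $ r $ m) = (G y0 ** Pf z0) $ i $ m" for m
      by (simp add: matrix_matrix_mult_def)
    have "riemann G i j k l y0 = (\<Sum>r\<in>UNIV. G y0 $ i $ r * Pf z0 $ r $ k) * G y0 $ j $ l
      - (\<Sum>r\<in>UNIV. G y0 $ i $ r * Pf z0 $ r $ l) * G y0 $ j $ k
      - (\<Sum>r\<in>UNIV. G y0 $ i $ r * (mat 1 :: real ^ 'n ^ 'n) $ r $ l) * (G y0 ** Pf z0) $ j $ k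
      + (\<Sum>r\<in>UNIV. G y0 $ i $ r * (mat 1 :: real ^ 'n ^ 'n) $ r $ k) * (G y0 ** Pf z0) $ j $ l"
      unfolding riemann_def Rup sum_distrib_right
      by (simp add: sum.distrib[symmetric] sum_subtractf[symmetric] right_diff_distrib distrib_left mult.assoc)
    then show "riemann G i j k l y0 =
      (G y0 ** Pf z0) $ i $ k * G y0 $ j $ l - (G y0 ** Pf z0) $ i $ l * G y0 $ j $ k
      - (G y0 ** Pf z0) $ j $ k * G y0 $ i $ l + (G y0 ** Pf z0) $ j $ l * G y0 $ i $ k"
      unfolding s p by (simp add: mult.commute)
  qed
qed

section \<open>The volume coefficient\<close>

lemma polynomial_small_imp_zero:
  fixes w :: "nat \<Rightarrow> real"
  assumes "(\<lambda>x. \<Sum>k\<le>m. w k * x ^ (2 * k)) \<in> o[at_right 0](\<lambda>x. x ^ (2 * m))"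
  shows "k \<le> m \<Longrightarrow> w k = 0"
proof (induction k rule: less_induct)
  case (less k)
  have pos: "\<forall>\<^sub>F x :: real in at_right 0. x > 0 \<and> x < 1"
    unfolding eventually_at_right_field by (intro exI[of _ 1]) auto
  have "(\<lambda>x :: real. x ^ (2 * m)) \<in> O[at_right 0](\<lambda>x. x ^ (2 * k))"
  proof (rule bigoI[of _ 1], rule eventually_mono[OF pos])
    fix x :: real assume "x > 0 \<and> x < 1"
    then show "norm (x ^ (2 * m)) \<le> 1 * norm (x ^ (2 * k))"
      using less.prems power_decreasing[of "2 * k" "2 * m" x] by simp
  qed
  from landau_o.small_big_trans[OF assms this]
  have "((\<lambda>x. (\<Sum>j\<le>m. w j * x ^ (2 * j)) / x ^ (2 * k)) \<longlongrightarrow> 0) (at_right 0)"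
    by (rule smalloD_tendsto)
  moreover have "((\<lambda>x. (\<Sum>j\<le>m. w j * x ^ (2 * j)) / x ^ (2 * k)) \<longlongrightarrow> w k) (at_right 0)"
  proof (rule Lim_transform_eventually)
    have lim: "((\<lambda>x. \<Sum>j\<in>{k..m}. w j * x ^ (2 * (j - k))) \<longlongrightarrow> (\<Sum>j\<in>{k..m}. w j * 0 ^ (2 * (j - k)))) (at_right 0)"
      by (intro tendsto_intros)
    have "(\<Sum>j\<in>{k..m}. w j * 0 ^ (2 * (j - k))) = (\<Sum>j\<in>{k..m}. if j = k then w k else 0)"
      by (rule sum.cong) (auto simp: power_0_left)
    also have "\<dots> = w k" using less.prems by simp
    finally show "((\<lambda>x. \<Sum>j\<in>{k..m}. w j * x ^ (2 * (j - k))) \<longlongrightarrow> w k) (at_right 0)"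
      using lim by simp
    show "\<forall>\<^sub>F x in at_right 0. (\<Sum>j\<in>{k..m}. w j * x ^ (2 * (j - k))) = (\<Sum>j\<le>m. w j * x ^ (2 * j)) / x ^ (2 * k)"
      using pos
    proof eventually_elim
      case (elim x)
      have "(\<Sum>j\<le>m. w j * x ^ (2 * j)) = (\<Sum>j\<in>{k..m}. w j * x ^ (2 * j))"
        by (rule sum.mono_neutral_right) (use less in auto)
      also have "\<dots> / x ^ (2 * k) = (\<Sum>j\<in>{k..m}. w j * x ^ (2 * (j - k)))"
        unfolding sum_divide_distrib
      proof (rule sum.cong[OF refl])
        fix j assume "j \<in> {k..m}"
        then have "2 * j = 2 * (j - k) + 2 * k" by auto
        then have "x ^ (2 * j) = x ^ (2 * (j - k)) * x ^ (2 * k)" by (metis power_add)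
        then show "w j * x ^ (2 * j) / x ^ (2 * k) = w j * x ^ (2 * (j - k))" using elim by simp
      qed
      finally show ?case by simp
    qed
  qed
  ultimately show ?case
    using tendsto_unique trivial_limit_at_right_real by blast
qed

text \<open>The coefficient is defined by a choice of an expansion, but expansions are unique.\<close>

lemma volume_coeff_unique:
  fixes c :: "('a, 'n::finite) chart"
  assumes n: "even CARD('n)" and v: "volume_expansion g h c m v"
  shows "volume_coeff g h c CARD('n) m = v CARD('n)"
proof -
  let ?N = "CARD('n) div 2"
  define w where "w = (SOME v. volume_expansion g h c m v)"
  have w: "volume_expansion g h c m w" unfolding w_def by (rule someI[of "volume_expansion g h c m", OF v])
  have two: "2 * ?N = CARD('n)" using n by simp
  have "(\<lambda>x. (\<Sum>k\<le>?N. (v (2 * k) - w (2 * k)) * x ^ (2 * k))) \<in> o[at_right 0](\<lambda>x. x ^ (2 * ?N))"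
  proof -
    have "(\<lambda>x. (sqrt (det (h x c m) / det (g c m)) - (\<Sum>k\<le>?N. w (2 * k) * x ^ (2 * k))) -
        (sqrt (det (h x c m) / det (g c m)) - (\<Sum>k\<le>?N. v (2 * k) * x ^ (2 * k)))) \<in> o[at_right 0](\<lambda>x. x ^ (2 * ?N))"
      using sum_in_smallo(2)[OF w[unfolded volume_expansion_def, THEN conjunct2] v[unfolded volume_expansion_def, THEN conjunct2]]
      unfolding two .
    then show ?thesis by (simp add: left_diff_distrib sum_subtractf)
  qed
  from polynomial_small_imp_zero[OF this, of ?N] show ?thesis
    unfolding volume_coeff_def w_def[symmetric] two by simp
qed

text \<open>An expansion of the determinant gives one of its square root.\<close>

lemma sqrt_expansion:
  fixes d p :: "real \<Rightarrow> real"
  assumes p: "(p \<longlongrightarrow> 1) (at_right 0)"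
    and d: "((\<lambda>t. (d t / (p t)\<^sup>2 - 1) / t ^ n) \<longlongrightarrow> 0) (at_right 0)"
  shows "(\<lambda>t. sqrt (d t) - p t) \<in> o[at_right 0](\<lambda>t. t ^ n)"
proof (rule smalloI_tendsto)
  define \<rho> where "\<rho> t = d t / (p t)\<^sup>2 - 1" for t
  have pos: "\<forall>\<^sub>F t :: real in at_right 0. t > 0 \<and> t < 1"
    unfolding eventually_at_right_field by (intro exI[of _ 1]) auto
  show "\<forall>\<^sub>F t :: real in at_right 0. t ^ n \<noteq> 0"
    using pos by eventually_elim simp
  have pp: "\<forall>\<^sub>F t in at_right 0. p t > 1 / 2"
    using order_tendstoD(1)[OF p, of "1 / 2"] by simp
  have "\<forall>\<^sub>F t in at_right 0. \<bar>\<rho> t / t ^ n\<bar> < 1"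
    using tendstoD[OF d, of 1] by (simp add: \<rho>_def dist_real_def)
  then have r1: "\<forall>\<^sub>F t in at_right 0. \<bar>\<rho> t\<bar> < 1"
    using pos
  proof eventually_elim
    case (elim t)
    have "\<bar>\<rho> t\<bar> < t ^ n" using elim by (simp add: abs_divide pos_divide_less_eq)
    also have "t ^ n \<le> 1" using elim by (simp add: power_le_one)
    finally show ?case .
  qed
  have bound: "\<forall>\<^sub>F t in at_right 0. norm ((sqrt (d t) - p t) / t ^ n) \<le> norm (p t * (\<rho> t / t ^ n))"
    using pp r1 pos
  proof eventually_elim
    case (elim t)
    have "d t = (p t)\<^sup>2 * (1 + \<rho> t)" using elim by (simp add: \<rho>_def)
    then have "sqrt (d t) - p t = p t * (sqrt (1 + \<rho> t) - 1)"
      using elim by (simp add: real_sqrt_mult right_diff_distrib)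
    moreover have "\<bar>sqrt (1 + \<rho> t) - 1\<bar> \<le> \<bar>\<rho> t\<bar>"
    proof -
      have s: "sqrt (1 + \<rho> t) \<ge> 0" "(sqrt (1 + \<rho> t))\<^sup>2 = 1 + \<rho> t" using elim by auto
      have "(sqrt (1 + \<rho> t) - 1) * (sqrt (1 + \<rho> t) + 1) = \<rho> t"
        using s(2) by (simp add: algebra_simps power2_eq_square)
      then have "\<bar>sqrt (1 + \<rho> t) - 1\<bar> * (sqrt (1 + \<rho> t) + 1) = \<bar>\<rho> t\<bar>"
        using s(1) by (metis abs_mult abs_of_nonneg add_nonneg_nonneg zero_le_one)
      moreover have "\<bar>sqrt (1 + \<rho> t) - 1\<bar> * 1 \<le> \<bar>sqrt (1 + \<rho> t) - 1\<bar> * (sqrt (1 + \<rho> t) + 1)"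
        using s(1) by (intro mult_left_mono) auto
      ultimately show ?thesis by simp
    qed
    ultimately show ?case
      using elim by (simp add: abs_mult abs_divide divide_right_mono mult_left_mono)
  qed
  have "((\<lambda>t. p t * (\<rho> t / t ^ n)) \<longlongrightarrow> 1 * 0) (at_right 0)"
    using tendsto_mult[OF p d] by (simp add: \<rho>_def)
  then show "((\<lambda>t. (sqrt (d t) - p t) / t ^ n) \<longlongrightarrow> 0) (at_right 0)"
    using Lim_null_comparison[OF bound tendsto_norm_zero] by simp
qed

lemma even_polynomial_truncation:
  fixes b :: "nat \<Rightarrow> real"
  shows "(\<lambda>x. (\<Sum>k\<le>2 * N. b k * x ^ (2 * k)) - (\<Sum>k\<le>N. b k * x ^ (2 * k))) \<in> o[at_right 0](\<lambda>x. x ^ (2 * N))"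
proof -
  have eq: "(\<Sum>k\<le>2 * N. b k * x ^ (2 * k)) - (\<Sum>k\<le>N. b k * x ^ (2 * k)) = (\<Sum>k\<in>{N<..2 * N}. b k * x ^ (2 * k))" for x
  proof -
    have "(\<Sum>k\<in>{..N} \<union> {N<..2 * N}. b k * x ^ (2 * k)) =
        (\<Sum>k\<le>N. b k * x ^ (2 * k)) + (\<Sum>k\<in>{N<..2 * N}. b k * x ^ (2 * k))"
      by (rule sum.union_disjoint) auto
    moreover have "{..N} \<union> {N<..2 * N} = {..2 * N}" by auto
    ultimately show ?thesis by simp
  qed
  have "(\<lambda>x. \<Sum>k\<in>{N<..2 * N}. b k * x ^ (2 * k)) \<in> o[at_right 0](\<lambda>x. x ^ (2 * N))"
  proof (rule big_sum_in_smallo)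
    fix k assume k: "k \<in> {N<..2 * N}"
    show "(\<lambda>x. b k * x ^ (2 * k)) \<in> o[at_right 0](\<lambda>x. x ^ (2 * N))"
    proof (rule smalloI_tendsto)
      have "((\<lambda>x. b k * x ^ (2 * (k - N))) \<longlongrightarrow> b k * 0 ^ (2 * (k - N))) (at_right 0)"
        by (intro tendsto_intros)
      then have lim: "((\<lambda>x. b k * x ^ (2 * (k - N))) \<longlongrightarrow> 0) (at_right 0)"
        using k by (simp add: power_0_left)
      have pos: "\<forall>\<^sub>F x :: real in at_right 0. x > 0"
        by (simp add: eventually_at_right_less)
      show "((\<lambda>x. b k * x ^ (2 * k) / x ^ (2 * N)) \<longlongrightarrow> 0) (at_right 0)"
      proof (rule Lim_transform_eventually[OF lim], rule eventually_mono[OF pos])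
        fix x :: real assume x: "x > 0"
        have "2 * k = 2 * (k - N) + 2 * N" using k by auto
        then have "x ^ (2 * k) = x ^ (2 * (k - N)) * x ^ (2 * N)" by (metis power_add)
        then show "b k * x ^ (2 * (k - N)) = b k * x ^ (2 * k) / x ^ (2 * N)" using x by simp
      qed
      show "\<forall>\<^sub>F x :: real in at_right 0. x ^ (2 * N) \<noteq> 0"
        by (rule eventually_mono[OF pos]) simp
    qed
  qed
  then show ?thesis by (simp only: eq)
qed

lemma in_coords_chart:
  assumes "smooth_manifold M A" "c \<in> A" "m \<in> fst c"
  shows "in_coords c F (snd c m) = F m" "open (snd c ` fst c)"
    "openin M W \<Longrightarrow> open (snd c ` (fst c \<inter> W))"
    "y \<in> snd c ` fst c \<Longrightarrow> inv_into (fst c) (snd c) y \<in> fst c \<and> snd c (inv_into (fst c) (snd c) y) = y"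
proof -
  have *: "openin M (fst c)" "open (snd c ` fst c)"
    "homeomorphic_map (subtopology M (fst c)) (top_of_set (snd c ` fst c)) (snd c)"
    using assms(1,2) unfolding smooth_manifold_def by (auto simp: case_prod_unfold)
  have top: "topspace (subtopology M (fst c)) = fst c"
    using openin_subset[OF *(1)] by (simp add: Int_absorb1)
  have inj: "inj_on (snd c) (fst c)"
    using homeomorphic_imp_injective_map[OF *(3)] unfolding top .
  show "in_coords c F (snd c m) = F m"
    using inj assms(3) by (simp add: in_coords_def inv_into_f_f)
  show "open (snd c ` fst c)" by (fact *(2))
  show "open (snd c ` (fst c \<inter> W))" if "openin M W"
  proof -
    have "openin (subtopology M (fst c)) (fst c \<inter> W)"
      using that by (metis inf_commute openin_subtopology_Int)
    then have "openin (top_of_set (snd c ` fst c)) (snd c ` (fst c \<inter> W))"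
      using homeomorphic_imp_open_map[OF *(3)] by (simp add: open_map_def)
    then show ?thesis using *(2) by (metis openin_open_trans)
  qed
  show "inv_into (fst c) (snd c) y \<in> fst c \<and> snd c (inv_into (fst c) (snd c) y) = y" if "y \<in> snd c ` fst c"
    using that by (simp add: inv_into_into f_inv_into_f)
qed

theorem mainTheorem2:
  fixes M :: "'a topology"
    and A :: "('a, 'n::finite) chart set"
    and g :: "('a, 'n) tensor2"
    and p q :: nat
    and a :: real
    and h :: "real \<Rightarrow> ('a, 'n) tensor2"
  assumes "smooth_manifold M A"
    and "even CARD('n)"
    and "pseudo_metric A g"
    and "metric_signature A g p q"
    and "locally_conformally_flat M A g"
    and "poincare_metric A g a h"
  shows "\<forall>c\<in>A. \<forall>m\<in>fst c.
    volume_coeff g h c CARD('n) m =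
      (-2) powi (- int (CARD('n) div 2)) * inverse (fact (CARD('n) div 2)) * pfaffian q g c m"
proof (intro ballI)
  fix c m assume c: "c \<in> A" and m: "m \<in> fst c"
  let ?n = "CARD('n)" and ?N = "CARD('n) div 2"
  note chart = in_coords_chart[OF assms(1) c]
  define S where "S = snd c ` fst c"
  define y0 where "y0 = snd c m"
  define G where "G = in_coords c (g c)"
  have S: "open S" "y0 \<in> S"
    using chart(2)[OF m] m by (simp_all add: S_def y0_def)
  have n0: "?n > 0" by simp
  have n2: "2 * ?N = ?n" using assms(2) by simp
  have n: "?n \<ge> 2" using n0 n2 by arith
  have pm: "0 < a" "\<And>x. 0 \<le> x \<Longrightarrow> x < a \<Longrightarrow> pseudo_metric A (h x)"
    "smooth_on (S \<times> {0..<a}) (\<lambda>(y, x). in_coords c (h x c) y)" "\<And>m. m \<in> fst c \<Longrightarrow> h 0 c m = g c m"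
    using assms(6) c unfolding poincare_metric_def S_def by auto
  have bounds: "\<exists>C. \<forall>\<^sub>F x in at_right 0. \<forall>y\<in>K. \<forall>I J.
       \<bar>einstein_defect h c (cyl_point y x) $ I $ J\<bar> \<le> C * x ^ (?n - 2)"
    "\<exists>C. \<forall>\<^sub>F x in at_right 0. \<forall>y\<in>K.
       \<bar>metric_trace (gplus h c (cyl_point y x)) (einstein_defect h c (cyl_point y x))\<bar> \<le> C * x ^ (?n + 2)"
    if "compact K" "K \<subseteq> S" for K
    using assms(6) c that unfolding poincare_metric_def S_def by blast+
  have inv: "inv_into (fst c) (snd c) y \<in> fst c" if "y \<in> S" for y
    using chart(4)[OF m] that by (simp add: S_def)
  obtain W \<omega> where W: "openin M W" "m \<in> W" "smooth_fun_on A W \<omega>" "flat_on A W (\<lambda>c x. exp (2 * \<omega> x) *\<^sub>R g c x)"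
  proof -
    have "m \<in> topspace M" using assms(1) c m unfolding smooth_manifold_def by blast
    then show thesis using assms(5) that unfolding locally_conformally_flat_def by blast
  qed
  define S' where "S' = snd c ` (fst c \<inter> W)"
  have S': "open S'" "y0 \<in> S'" "S' \<subseteq> S"
    using chart(3)[OF m W(1)] m W(2) by (auto simp: S'_def S_def y0_def)
  have sm\<omega>: "smooth_on S' (in_coords c \<omega>)"
    using W(3) c unfolding smooth_fun_on_def S'_def by (auto simp: case_prod_unfold)
  have flat: "riemann (\<lambda>y. exp (2 * in_coords c \<omega> y) *\<^sub>R G y) i j k l y = 0" if y: "y \<in> S'" for y i j k l
  proof -
    obtain m' where m': "m' \<in> fst c \<inter> W" "y = snd c m'" using y unfolding S'_def by blast
    have "in_coords c (\<lambda>x. exp (2 * \<omega> x) *\<^sub>R g c x) = (\<lambda>y. exp (2 * in_coords c \<omega> y) *\<^sub>R G y)"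
      by (simp add: in_coords_def[abs_def] G_def)
    then show ?thesis
      using W(4)[unfolded flat_on_def, rule_format, OF c m'(1), of i j k l] by (simp only: m'(2))
  qed
  have smG: "smooth_on S G"
    using assms(3) c unfolding pseudo_metric_def S_def G_def by blast
  have sym: "transpose (in_coords c (h x c) y) = in_coords c (h x c) y \<and> invertible (in_coords c (h x c) y)"
    if "0 \<le> x" "x < a" "y \<in> S" for x y
    using pm(2)[OF that(1,2)] c inv[OF that(3)] unfolding pseudo_metric_def in_coords_def by blast
  have init: "in_coords c (h 0 c) y = G y" if "y \<in> S" for y
    using pm(4)[OF inv[OF that]] by (simp add: in_coords_def G_def)
  have defect: "\<exists>C. \<forall>\<^sub>F x in at_right 0. \<forall>I J. \<bar>einstein_defect h c (cyl_point y x) $ I $ J\<bar> \<le> C * x ^ (?n - 2)"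
    and trace: "\<exists>C. \<forall>\<^sub>F x in at_right 0.
      \<bar>metric_trace (gplus h c (cyl_point y x)) (einstein_defect h c (cyl_point y x))\<bar> \<le> C * x ^ (?n + 2)"
    if "y \<in> S" for y
    using bounds[of "{y}"] that by simp_all
  obtain P0 where
    R: "\<And>i j k l. riemann G i j k l y0 =
      (G y0 ** P0) $ i $ k * G y0 $ j $ l - (G y0 ** P0) $ i $ l * G y0 $ j $ k
      - (G y0 ** P0) $ j $ k * G y0 $ i $ l + (G y0 ** P0) $ j $ l * G y0 $ i $ k" and
    lim: "((\<lambda>t. (det (in_coords c (h t c) y0) / det (G y0) / (det (mat 1 + (- t\<^sup>2 / 2) *\<^sub>R P0))\<^sup>2 - 1) / t ^ ?n)
      \<longlongrightarrow> 0) (at_right 0)"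
  proof (rule local_expansion[where c = c and h = h and G = G and \<omega> = "in_coords c \<omega>",
        OF S pm(1,3) sym init smG S' sm\<omega> flat n defect trace]; assumption?, goal_cases)
    case (1 P0)
    show ?case by (rule 1(1)[OF 1(2,3)])
  qed
  have Gm: "G y0 = g c m" unfolding G_def y0_def by (rule chart(1)[OF m])
  have hm: "in_coords c (h t c) y0 = h t c m" for t unfolding y0_def by (rule chart(1)[OF m])
  have sig: "form_signature p q (G y0)"
    using assms(4) c m unfolding metric_signature_def Gm by blast
  have nz: "det (G y0) \<noteq> 0" by (rule form_signature_det(2)[OF sig])
  define L where "L = G y0 ** P0"
  define b where "b k = of_nat (?n choose k) * mixed_sum (G y0) L {..<k} / (fact ?n * det (G y0)) * (- 1 / 2) ^ k" for k
  have det: "det (mat 1 + (- t\<^sup>2 / 2) *\<^sub>R P0) = (\<Sum>k\<le>?n. b k * t ^ (2 * k))" for t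
  proof -
    have "G y0 + (- t\<^sup>2 / 2) *\<^sub>R L = G y0 ** (mat 1 + (- t\<^sup>2 / 2) *\<^sub>R P0)"
      unfolding L_def matrix_add_ldistrib matrix_mul_rid
      by (simp add: vec_eq_iff matrix_matrix_mult_def sum_distrib_left sum_negf mult_ac)
    then have "fact ?n * det (G y0) * det (mat 1 + (- t\<^sup>2 / 2) *\<^sub>R P0) =
        (\<Sum>k\<le>?n. of_nat (?n choose k) * mixed_sum (G y0) L {..<k} * (- t\<^sup>2 / 2) ^ k)"
      unfolding det_pencil[symmetric] by (simp add: det_mul)
    then have "det (mat 1 + (- t\<^sup>2 / 2) *\<^sub>R P0) =
        (\<Sum>k\<le>?n. of_nat (?n choose k) * mixed_sum (G y0) L {..<k} * (- t\<^sup>2 / 2) ^ k) / (fact ?n * det (G y0))"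
      using nz by (simp add: field_simps)
    also have "\<dots> = (\<Sum>k\<le>?n. b k * t ^ (2 * k))"
      unfolding sum_divide_distrib
    proof (rule sum.cong[OF refl])
      fix k
      have "(- t\<^sup>2 / 2) ^ k = (- 1 / 2) ^ k * t ^ (2 * k)"
        unfolding power_mult power_mult_distrib[symmetric] by simp
      then show "of_nat (?n choose k) * mixed_sum (G y0) L {..<k} * (- t\<^sup>2 / 2) ^ k / (fact ?n * det (G y0)) = b k * t ^ (2 * k)"
        by (simp add: b_def)
    qed
    finally show ?thesis .
  qed
  have "(\<Sum>k\<le>?n. b k * 0 ^ (2 * k)) = 1"
    using det[of 0] by simp
  then have b0: "b 0 = 1"
    by (simp add: power_0_left if_distrib cong: if_cong)
  have lim1: "((\<lambda>t. \<Sum>k\<le>?n. b k * t ^ (2 * k)) \<longlongrightarrow> 1) (at_right 0)"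
  proof -
    have "((\<lambda>t. \<Sum>k\<le>?n. b k * t ^ (2 * k)) \<longlongrightarrow> (\<Sum>k\<le>?n. b k * 0 ^ (2 * k))) (at_right 0)"
      by (intro tendsto_intros)
    then show ?thesis using \<open>(\<Sum>k\<le>?n. b k * 0 ^ (2 * k)) = 1\<close> by simp
  qed
  have "(\<lambda>t. sqrt (det (h t c m) / det (g c m)) - (\<Sum>k\<le>?n. b k * t ^ (2 * k))) \<in> o[at_right 0](\<lambda>t. t ^ ?n)"
    using sqrt_expansion[OF lim1 lim[unfolded det hm Gm]] .
  from sum_in_smallo(1)[OF this even_polynomial_truncation[of b ?N, unfolded n2]]
  have "(\<lambda>t. sqrt (det (h t c m) / det (g c m)) - (\<Sum>k\<le>?N. b k * t ^ (2 * k))) \<in> o[at_right 0](\<lambda>t. t ^ ?n)"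
    by simp
  then have "volume_expansion g h c m (\<lambda>j. b (j div 2))"
    unfolding volume_expansion_def using b0 by simp
  from volume_coeff_unique[OF assms(2) this]
  have vol: "volume_coeff g h c ?n m = b ?N" .
  have pf: "pfaffian q g c m = mixed_sum (G y0) L {..<?N} / (fact ?N * det (G y0))"
    unfolding pfaffian_def Gm[symmetric] G_def[symmetric] y0_def[symmetric]
    by (rule pfaffian_pencil[OF assms(2) sig]) (simp only: R L_def)
  have "fact ?n = fact ?N * fact ?N * (of_nat (?n choose ?N) :: real)"
  proof -
    have "fact ?N * fact (?n - ?N) * (?n choose ?N) = fact ?n"
      by (rule binomial_fact_lemma) simp
    moreover have "?n - ?N = ?N" using n2 by simp
    ultimately have "fact ?N * fact ?N * (?n choose ?N) = fact ?n" by simp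
    then show ?thesis by (metis of_nat_fact of_nat_mult)
  qed
  moreover have "(of_nat (?n choose ?N) :: real) \<noteq> 0" by simp
  ultimately have val: "b ?N = mixed_sum (G y0) L {..<?N} / (fact ?N * det (G y0)) / fact ?N * (- 1 / 2) ^ ?N"
    unfolding b_def by (simp add: field_simps)
  have pow: "(- 2 :: real) powi (- int ?N) = (- 1 / 2) ^ ?N"
  proof -
    have "(- 1 / 2 :: real) = inverse (- 2)" by simp
    then show ?thesis by (simp only: power_int_minus power_int_of_nat power_inverse)
  qed
  show "volume_coeff g h c ?n m = (-2) powi (- int ?N) * inverse (fact ?N) * pfaffian q g c m"
    unfolding vol pf val pow divide_inverse by (simp only: mult_ac)
qed

end
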